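(* For any $\mu>0$, $\epsilon>0$ and $\eta>0$, define the events $$A_{k,n}=\left\{|X_{k+1}(n)-u(k,n)|>\mu k^{-(\frac14-\eta)}\ \text{ or }\ |(X_{k+2}(n)-X_{k+1}(n))-\partial_x u(k,n)|>\mu k^{-(\frac34-\eta)}\right\}$$ and $$B_n^{\epsilon}=\bigcup_{n^{\epsilon}\le k\le n}A_{k,n},$$ where the union is over integers $k$. Then $P(\limsup_n B_n^{\epsilon})=0$.
   Context: Fix $\alpha\in(0,1)$ and let $\sigma=\sqrt{\alpha(1-\alpha)}$. Let $W$ be a standard two-dimensional Brownian motion on $[0,\infty)$, extended by $W(s)=0$ for $s\le 0$. Discrete Conga line (coupled to $W$): $X_1(n)=W(n)$ for integers $n\ge 0$, i.e. $X_1(n)=\sum_{i=1}^n Z_i$ with $Z_i=W(i)-W(i-1)$ i.i.d. standard two-dimensional normal. Inductively, for $j\ge1$, $X_{j+1}(0)=0$ and $X_{j+1}(n)=(1-\alpha)X_{j+1}(n-1)+\alpha X_j(n-1)$ for $n\ge 1$. Continuous Conga line: for $x>0$, $t>0$, $$u(x,t)=\int_0^t W(t-z)\,\frac{1}{\sqrt{2\pi}}\,\frac{x+\alpha z}{2\sigma z^{3/2}}\exp\left(-\frac{(x-\alpha z)^2}{2\sigma^2 z}\right)dz ,$$ which almost surely equals $\int_0^t\overline{\Phi}\left(\frac{x-\alpha z}{\sigma\sqrt z}\right)dW^t_z$, where $W^t_z=W(t)-W(t-z)$, $0\le z\le t$, and $\overline\Phi=1-\Phi$ with $\Phi$ the standard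 normal distribution function. The process $u$ is smooth in $x$, and $\partial_x u$ is its partial derivative in $x$. $|\cdot|$ is the Euclidean norm. *)

theory Defs
  imports "HOL-Probability.Probability"
begin

text \<open>
  Standard Brownian motion on $[0,\infty)$ with values in Euclidean space. The index type is
  \<^typ>\<open>real\<close>, and nothing is required here at negative times. The product density is that of
  $N(0,(t-s)I)$; the second argument of \<^const>\<open>normal_density\<close> is the standard deviation.
\<close>

definition standard_brownian_motion :: "'a measure \<Rightarrow> (real \<Rightarrow> 'a \<Rightarrow> real ^ 'n) \<Rightarrow> bool" where
  "standard_brownian_motion M W \<longleftrightarrow>
     prob_space M \<and>
     (\<forall>t\<ge>0. W t \<in> borel_measurable M) \<and>
     (AE \<omega> in M. W 0 \<omega> = 0) \<and>
     (\<forall>s t. 0 \<le> s \<longrightarrow> s < t \<longrightarrow>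
        distributed M lborel (\<lambda>\<omega>. W t \<omega> - W s \<omega>)
          (\<lambda>x. ennreal (\<Prod>i\<in>UNIV. normal_density 0 (sqrt (t - s)) (x $ i)))) \<and>
     (\<forall>(N::nat) (\<tau>::nat \<Rightarrow> real). 0 \<le> \<tau> 0 \<longrightarrow> (\<forall>i<N. \<tau> i < \<tau> (Suc i)) \<longrightarrow>
        prob_space.indep_vars M (\<lambda>_. borel) (\<lambda>i \<omega>. W (\<tau> (Suc i)) \<omega> - W (\<tau> i) \<omega>) {..<N}) \<and>
     (AE \<omega> in M. continuous_on {0..} (\<lambda>t. W t \<omega>))"

text \<open>
  The two Conga lines are functions of a single path \<open>w\<close> of the driving Brownian motion.
  In \<open>conga \<alpha> w j n\<close>, which is $X_j(n)$, the particles are numbered from \<open>j = 1\<close>;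
  the value at \<open>j = 0\<close> is a dummy.
\<close>

fun conga :: "real \<Rightarrow> (real \<Rightarrow> real ^ 2) \<Rightarrow> nat \<Rightarrow> nat \<Rightarrow> real ^ 2" where
  "conga \<alpha> w 0 n = 0"
| "conga \<alpha> w (Suc 0) n = w (real n)"
| "conga \<alpha> w (Suc (Suc j)) 0 = 0"
| "conga \<alpha> w (Suc (Suc j)) (Suc n) =
     (1 - \<alpha>) *\<^sub>R conga \<alpha> w (Suc (Suc j)) n + \<alpha> *\<^sub>R conga \<alpha> w (Suc j) n"

definition conga_sigma :: "real \<Rightarrow> real" where
  "conga_sigma \<alpha> = sqrt (\<alpha> * (1 - \<alpha>))"

definition conga_kernel :: "real \<Rightarrow> real \<Rightarrow> real \<Rightarrow> real" where
  "conga_kernel \<alpha> x z =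
     1 / sqrt (2 * pi) * ((x + \<alpha> * z) / (2 * conga_sigma \<alpha> * z powr (3/2))) *
     exp (- ((x - \<alpha> * z)\<^sup>2 / (2 * (conga_sigma \<alpha>)\<^sup>2 * z)))"

definition cont_conga :: "real \<Rightarrow> (real \<Rightarrow> real ^ 2) \<Rightarrow> real \<Rightarrow> real \<Rightarrow> real ^ 2" where
  "cont_conga \<alpha> w x t = (LINT z:{0<..<t}|lborel. conga_kernel \<alpha> x z *\<^sub>R w (t - z))"

definition cont_conga_dx :: "real \<Rightarrow> (real \<Rightarrow> real ^ 2) \<Rightarrow> real \<Rightarrow> real \<Rightarrow> real ^ 2" where
  "cont_conga_dx \<alpha> w x t = vector_derivative (\<lambda>y. cont_conga \<alpha> w y t) (at x)"

definition event_A ::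
  "'a measure \<Rightarrow> (real \<Rightarrow> 'a \<Rightarrow> real ^ 2) \<Rightarrow> real \<Rightarrow> real \<Rightarrow> real \<Rightarrow> nat \<Rightarrow> nat \<Rightarrow> 'a set" where
  "event_A M W \<alpha> \<mu> \<eta> k n =
     {\<omega> \<in> space M.
        norm (conga \<alpha> (\<lambda>t. W t \<omega>) (k + 1) n - cont_conga \<alpha> (\<lambda>t. W t \<omega>) (real k) (real n))
          > \<mu> * real k powr (- (1/4 - \<eta>)) \<or>
        norm ((conga \<alpha> (\<lambda>t. W t \<omega>) (k + 2) n - conga \<alpha> (\<lambda>t. W t \<omega>) (k + 1) n)
               - cont_conga_dx \<alpha> (\<lambda>t. W t \<omega>) (real k) (real n))
          > \<mu> * real k powr (- (3/4 - \<eta>))}"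

definition event_B ::
  "'a measure \<Rightarrow> (real \<Rightarrow> 'a \<Rightarrow> real ^ 2) \<Rightarrow> real \<Rightarrow> real \<Rightarrow> real \<Rightarrow> real \<Rightarrow> nat \<Rightarrow> 'a set" where
  "event_B M W \<alpha> \<mu> \<eta> \<epsilon> n =
     (\<Union>k\<in>{k. real n powr \<epsilon> \<le> real k \<and> k \<le> n}. event_A M W \<alpha> \<mu> \<eta> k n)"

end

theory Submission
  imports Defs "HOL-Real_Asymp.Real_Asymp"
begin

text \<open>
  Unrolling its recursion turns the discrete line into a linear functional of the increments of
  the driving path: the increment of \<open>W\<close> between the times \<open>n - m - 1\<close> and \<open>n - m\<close> enters
  \<open>X_{k+1}(n)\<close> with the coefficient \<open>P(Bin(m, \<alpha>) \<ge> k)\<close>. After an integration by parts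
  the continuous line is a functional of the same kind, in which the increment at age \<open>z\<close> carries
  the Gaussian tail \<open>G(k, z)\<close>, the normal tail at \<open>(k - \<alpha> z) / (\<sigma> sqrt z)\<close>. The
  error \<open>X_{k+1}(n) - u(k, n)\<close> is therefore Gaussian, and its variance is the integral over
  \<open>0 < z < n\<close> of the squared distance between a binomial tail and its normal approximation. For
  the difference \<open>X_{k+2}(n) - X_{k+1}(n)\<close> against the derivative of \<open>u\<close> the tails are replaced by
  (minus) the binomial point mass \<open>b(k, m)\<close> and the normal density \<open>q(k, z)\<close>.

  The integrand is concentrated at the front \<open>z \<approx> k / \<alpha>\<close>, in a window of width about
  \<open>sqrt k\<close>. There the local limit theorem \<open>|b(k, m) - q(k, m)| \<le> C / m\<close> bounds the density
  error by \<open>C / k\<close> (lemma \<open>local_limit_theorem\<close>, by Fourier inversion). Adding up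
  about \<open>sqrt k\<close> such errors bounds the tail error by about \<open>1 / sqrt k\<close> (lemma
  \<open>near_bounds\<close>). With \<open>R = k^(1/2 + \<delta>)\<close>, everything outside the window
  \<open>|\<alpha> z - k| < R\<close> is of order \<open>exp(- k^(2 \<delta>) / 64)\<close> by Chernoff bounds (lemma
  \<open>far_bounds\<close>). As \<open>n \<le> k^(1/\<epsilon>)\<close> whenever \<open>n^\<epsilon> \<le> k\<close>, this outside
  part is negligible even after integration over \<open>(0, n)\<close>. Hence the two variances are at most
  \<open>C k^(-1/2 + \<eta>)\<close> and \<open>C k^(-3/2 + \<eta>)\<close> (lemma \<open>variance_bounds\<close>).

  The thresholds \<open>\<mu> k^(-(1/4 - \<eta>))\<close> and \<open>\<mu> k^(-(3/4 - \<eta>))\<close> exceed the corresponding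
  standard deviations by a factor of order \<open>k^(\<eta>/2)\<close>, so that for large \<open>k\<close> each event \<open>A_{k,n}\<close> with
  \<open>k \<ge> n^\<epsilon>\<close> has probability at most \<open>8 exp(- c k^\<eta>)\<close>. A union over the at most \<open>n + 1\<close> values of \<open>k\<close>, each at least
  \<open>n^\<epsilon>\<close>, leaves a summable sequence, and the Borel-Cantelli lemma concludes.

  To avoid stochastic integrals, time is discretised with mesh \<open>1 / N\<close>. On a grid both lines are
  finite sums of independent Gaussian increments, whose exponential moments are explicit. Along a
  continuous path the grid sums converge as \<open>N \<rightarrow> \<infinity>\<close> (lemma
  \<open>conga_error_grid_limits\<close>), and a bound that is uniform in \<open>N\<close> passes to the limit.
\<close>

section \<open>Gaussian sums of Brownian increments\<close>

text \<open>
  The joint density is a product, so by Fubini all coordinates but the \<open>j\<close>-th integrate to 1. In the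
  remaining one, tilting a centred normal density by \<open>exp (\<theta> x)\<close> gives a shifted normal density
  of the same width, multiplied by the moment generating function.
\<close>

lemma normal_density_mgf_component:
  fixes Y :: "'a \<Rightarrow> real ^ 'n" and \<theta> :: real
  assumes D: "distributed M lborel Y (\<lambda>x. ennreal (\<Prod>i\<in>UNIV. normal_density 0 s (x $ i)))"
    and s: "s > 0"
  shows "(\<integral>\<^sup>+\<omega>. ennreal (exp (\<theta> * Y \<omega> $ j)) \<partial>M) = ennreal (exp (\<theta>\<^sup>2 * s\<^sup>2 / 2))"
proof -
  have one: "(\<integral>\<^sup>+x. ennreal (normal_density m s x) \<partial>lborel) = 1" for m
    using s by (subst nn_integral_eq_integral) auto
  have tilt: "normal_density 0 s x * exp (\<theta> * x) = exp (\<theta>\<^sup>2 * s\<^sup>2 / 2) * normal_density (\<theta> * s\<^sup>2) s x" for x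
  proof -
    have "- (x - 0)\<^sup>2 / (2 * s\<^sup>2) + \<theta> * x = \<theta>\<^sup>2 * s\<^sup>2 / 2 + (- (x - \<theta> * s\<^sup>2)\<^sup>2 / (2 * s\<^sup>2))"
      using s by (simp add: field_simps power2_eq_square)
    then have "exp (- (x - 0)\<^sup>2 / (2 * s\<^sup>2)) * exp (\<theta> * x)
        = exp (\<theta>\<^sup>2 * s\<^sup>2 / 2) * exp (- (x - \<theta> * s\<^sup>2)\<^sup>2 / (2 * s\<^sup>2))"
      by (simp only: exp_add[symmetric])
    then show ?thesis unfolding normal_density_def by (simp add: algebra_simps)
  qed
  define h where "h i x = (if i = j then exp (\<theta> * x) else 1) * normal_density 0 s x" for i x
  have h0: "h i x \<ge> 0" for i x by (simp add: h_def)
  have hm: "h i \<in> borel_measurable borel" for i unfolding h_def by measurable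
  define f where "f b x = ennreal (h (axis_index b) x)" for b :: "real ^ 'n" and x
  have reidx: "(\<Prod>b\<in>Basis. g (axis_index b) (b :: real ^ 'n)) = (\<Prod>i\<in>UNIV. g i (axis i 1))" 
    for g :: "'n \<Rightarrow> real ^ 'n \<Rightarrow> ennreal"
  proof -
    have B: "(Basis :: (real ^ 'n) set) = (\<lambda>i. axis i 1) ` UNIV"
      by (auto simp: Basis_vec_def)
    have "inj (\<lambda>i :: 'n. axis i (1::real))"
      by (auto simp: inj_on_def axis_eq_axis)
    then show ?thesis unfolding B
      by (subst prod.reindex) (auto simp: axis_index_axis)
  qed
  have "(\<integral>\<^sup>+\<omega>. ennreal (exp (\<theta> * Y \<omega> $ j)) \<partial>M) =
     (\<integral>\<^sup>+x. ennreal (\<Prod>i\<in>UNIV. normal_density 0 s (x $ i)) * ennreal (exp (\<theta> * x $ j)) \<partial>lborel)"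
    by (rule distributed_nn_integral[OF D, symmetric]) measurable
  also have "\<dots> = (\<integral>\<^sup>+x. (\<Prod>b\<in>Basis. f b (x \<bullet> b)) \<partial>lborel)"
  proof (rule nn_integral_cong)
    fix x :: "real ^ 'n"
    have "(\<Prod>b\<in>Basis. f b (x \<bullet> b)) = (\<Prod>i\<in>UNIV. ennreal (h i (x $ i)))"
      unfolding f_def using reidx[of "\<lambda>i b. ennreal (h i (x \<bullet> b))"] by (simp add: inner_axis)
    also have "\<dots> = ennreal (\<Prod>i\<in>UNIV. h i (x $ i))"
      using h0 by (simp add: prod_ennreal)
    also have "(\<Prod>i\<in>UNIV. h i (x $ i)) = (\<Prod>i\<in>UNIV. if i = j then exp (\<theta> * x $ i) else 1) * (\<Prod>i\<in>UNIV. normal_density 0 s (x $ i))"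
      unfolding h_def by (simp add: prod.distrib)
    also have "(\<Prod>i\<in>UNIV. if i = j then exp (\<theta> * x $ i) else 1) = exp (\<theta> * x $ j)"
      by (simp add: prod.delta)
    finally show "ennreal (\<Prod>i\<in>UNIV. normal_density 0 s (x $ i)) * ennreal (exp (\<theta> * x $ j)) = (\<Prod>b\<in>Basis. f b (x \<bullet> b))"
      by (simp add: ennreal_mult'[symmetric] prod_nonneg mult.commute)
  qed
  also have "\<dots> = (\<Prod>b\<in>Basis. (\<integral>\<^sup>+x. f b x \<partial>lborel))"
    by (rule nn_integral_lborel_prod) (auto simp: f_def intro!: measurable_compose[OF hm])
  also have "\<dots> = (\<Prod>i\<in>UNIV. (\<integral>\<^sup>+x. ennreal (h i x) \<partial>lborel))"
    unfolding f_def using reidx[of "\<lambda>i b. (\<integral>\<^sup>+x. ennreal (h i x) \<partial>lborel)"] by simp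
  also have "\<dots> = (\<Prod>i\<in>UNIV. if i = j then ennreal (exp (\<theta>\<^sup>2 * s\<^sup>2 / 2)) else 1)"
  proof (rule prod.cong[OF refl])
    fix i
    show "(\<integral>\<^sup>+x. ennreal (h i x) \<partial>lborel) = (if i = j then ennreal (exp (\<theta>\<^sup>2 * s\<^sup>2 / 2)) else 1)"
    proof (cases "i = j")
      case True
      have "(\<integral>\<^sup>+x. ennreal (h i x) \<partial>lborel) = (\<integral>\<^sup>+x. ennreal (exp (\<theta>\<^sup>2 * s\<^sup>2 / 2)) * ennreal (normal_density (\<theta> * s\<^sup>2) s x) \<partial>lborel)"
        using tilt True by (simp add: h_def ennreal_mult'[symmetric] mult.commute)
      also have "\<dots> = ennreal (exp (\<theta>\<^sup>2 * s\<^sup>2 / 2))"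
        by (subst nn_integral_cmult) (auto simp: one)
      finally show ?thesis using True by simp
    next
      case False
      then show ?thesis by (simp add: h_def one)
    qed
  qed
  also have "\<dots> = ennreal (exp (\<theta>\<^sup>2 * s\<^sup>2 / 2))"
    by (simp add: prod.delta)
  finally show ?thesis .
qed

text \<open>
  Independence turns the exponential moment of the sum into a product. The variance of the linear
  functional appears as the sum of \<open>(c i)\<^sup>2\<close> weighted by the lengths of the time steps.
\<close>

lemma brownian_increment_sum_mgf:
  fixes W :: "real \<Rightarrow> 'a \<Rightarrow> real ^ 'n" and c :: "nat \<Rightarrow> real"
  assumes BM: "standard_brownian_motion M W" and \<tau>0: "0 \<le> \<tau> 0" and \<tau>: "\<And>i. i < K \<Longrightarrow> \<tau> i < \<tau> (Suc i)"
  shows "(\<integral>\<^sup>+\<omega>. ennreal (exp (\<theta> * (\<Sum>i<K. c i *\<^sub>R (W (\<tau> (Suc i)) \<omega> - W (\<tau> i) \<omega>)) $ j)) \<partial>M)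
       = ennreal (exp (\<theta>\<^sup>2 * (\<Sum>i<K. (c i)\<^sup>2 * (\<tau> (Suc i) - \<tau> i)) / 2))"
proof -
  let ?D = "\<lambda>i \<omega>. W (\<tau> (Suc i)) \<omega> - W (\<tau> i) \<omega>"
  interpret prob_space M using BM by (simp add: standard_brownian_motion_def)
  have pos: "0 \<le> \<tau> i" if "i \<le> K" for i
    using that by (induction i) (use \<tau>0 \<tau> in \<open>auto simp: Suc_le_eq intro: order.trans less_imp_le\<close>)
  have ind: "indep_vars (\<lambda>_. borel) (\<lambda>i \<omega>. W (\<tau> (Suc i)) \<omega> - W (\<tau> i) \<omega>) {..<K}"
    using BM \<tau>0 \<tau> unfolding standard_brownian_motion_def by blast
  have ind': "indep_vars (\<lambda>_. borel) (\<lambda>i \<omega>. ennreal (exp ((\<theta> * c i) * (?D i \<omega>) $ j))) {..<K}"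
    by (rule indep_vars_compose2[OF ind]) measurable
  have "(\<integral>\<^sup>+\<omega>. ennreal (exp (\<theta> * (\<Sum>i<K. c i *\<^sub>R ?D i \<omega>) $ j)) \<partial>M)
     = (\<integral>\<^sup>+\<omega>. (\<Prod>i<K. ennreal (exp ((\<theta> * c i) * (?D i \<omega>) $ j))) \<partial>M)"
    by (simp add: prod_ennreal exp_sum[symmetric] sum_distrib_left sum_component mult.assoc)
  also have "\<dots> = (\<Prod>i<K. \<integral>\<^sup>+\<omega>. ennreal (exp ((\<theta> * c i) * (?D i \<omega>) $ j)) \<partial>M)"
    by (rule indep_vars_nn_integral[OF _ ind']) auto
  also have "\<dots> = (\<Prod>i<K. ennreal (exp ((\<theta> * c i)\<^sup>2 * (\<tau> (Suc i) - \<tau> i) / 2)))"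
  proof (rule prod.cong[OF refl])
    fix i assume "i \<in> {..<K}"
    then have i: "i < K" by simp
    have "distributed M lborel (\<lambda>\<omega>. W (\<tau> (Suc i)) \<omega> - W (\<tau> i) \<omega>)
          (\<lambda>x. ennreal (\<Prod>l\<in>UNIV. normal_density 0 (sqrt (\<tau> (Suc i) - \<tau> i)) (x $ l)))"
      using BM \<tau>[OF i] pos[of i] i unfolding standard_brownian_motion_def by simp
    from normal_density_mgf_component[OF this, of "\<theta> * c i" j]
    show "(\<integral>\<^sup>+\<omega>. ennreal (exp ((\<theta> * c i) * (?D i \<omega>) $ j)) \<partial>M)
       = ennreal (exp ((\<theta> * c i)\<^sup>2 * (\<tau> (Suc i) - \<tau> i) / 2))"
      using \<tau>[OF i] by simp
  qed
  also have "\<dots> = ennreal (exp (\<theta>\<^sup>2 * (\<Sum>i<K. (c i)\<^sup>2 * (\<tau> (Suc i) - \<tau> i)) / 2))"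
    by (simp add: prod_ennreal exp_sum[symmetric] sum_distrib_left sum_divide_distrib power_mult_distrib mult.assoc)
  finally show ?thesis .
qed

lemma brownian_increment_sum_measurable:
  fixes W :: "real \<Rightarrow> 'a \<Rightarrow> real ^ 'n" and c :: "nat \<Rightarrow> real"
  assumes BM: "standard_brownian_motion M W" and \<tau>: "\<And>i. i \<le> K \<Longrightarrow> 0 \<le> \<tau> i"
  shows "(\<lambda>\<omega>. \<Sum>i<K. c i *\<^sub>R (W (\<tau> (Suc i)) \<omega> - W (\<tau> i) \<omega>)) \<in> borel_measurable M"
  using BM \<tau> unfolding standard_brownian_motion_def
  by (intro borel_measurable_sum borel_measurable_scaleR borel_measurable_diff borel_measurable_const) auto

text \<open>
  A vector of norm above \<open>L\<close> in the plane has a coordinate of modulus at least \<open>L / 2\<close>. Each of the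
  four resulting one-sided events is estimated by the exponential Markov inequality, which accounts
  for the factor 4 and for the constant 8 in the exponent.
\<close>

lemma brownian_increment_sum_tail:
  fixes W :: "real \<Rightarrow> 'a \<Rightarrow> real ^ 2" and c :: "nat \<Rightarrow> real"
  assumes BM: "standard_brownian_motion M W" and \<tau>0: "0 \<le> \<tau> 0" and \<tau>: "\<And>i. i < K \<Longrightarrow> \<tau> i < \<tau> (Suc i)"
    and v: "(\<Sum>i<K. (c i)\<^sup>2 * (\<tau> (Suc i) - \<tau> i)) \<le> v" "v > 0" and L: "L > 0"
  shows "emeasure M {\<omega> \<in> space M. norm (\<Sum>i<K. c i *\<^sub>R (W (\<tau> (Suc i)) \<omega> - W (\<tau> i) \<omega>)) > L}
       \<le> ennreal (4 * exp (- (L\<^sup>2 / (8 * v))))"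
proof -
  let ?S = "\<lambda>\<omega>. \<Sum>i<K. c i *\<^sub>R (W (\<tau> (Suc i)) \<omega> - W (\<tau> i) \<omega>)"
  interpret prob_space M using BM by (simp add: standard_brownian_motion_def)
  have pos: "0 \<le> \<tau> i" if "i \<le> K" for i
    using that by (induction i) (use \<tau>0 \<tau> in \<open>auto simp: Suc_le_eq intro: order.trans less_imp_le\<close>)
  have [measurable]: "?S \<in> borel_measurable M"
    by (rule brownian_increment_sum_measurable[OF BM pos])
  have [measurable]: "(\<lambda>\<omega>. ?S \<omega> $ j) \<in> borel_measurable M" for j
    by (rule borel_measurable_continuous_on[of "\<lambda>x. x $ j"]) (auto intro!: continuous_intros)
  have one_sided: "emeasure M {\<omega> \<in> space M. s * ?S \<omega> $ j \<ge> L/2} \<le> ennreal (exp (- (L\<^sup>2 / (8 * v))))"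
    if s: "s\<^sup>2 = 1" for s :: real and j
  proof -
    \<comment> \<open>The optimal tilt for the deviation \<open>L / 2\<close> at variance \<open>v\<close>.\<close>
    define \<theta> where "\<theta> = L / (2 * v)"
    have \<theta>: "\<theta> > 0" using L v by (simp add: \<theta>_def)
    have "emeasure M {\<omega> \<in> space M. s * ?S \<omega> $ j \<ge> L/2}
       = emeasure M {\<omega> \<in> space M. 1 \<le> ennreal (exp (- (\<theta> * L / 2))) * ennreal (exp ((\<theta> * s) * ?S \<omega> $ j))}"
    proof (intro arg_cong[where f="emeasure M"] Collect_cong conj_cong refl)
      fix \<omega>
      have "(1 \<le> ennreal (exp (- (\<theta> * L / 2))) * ennreal (exp ((\<theta> * s) * ?S \<omega> $ j)))
         \<longleftrightarrow> 1 \<le> exp (- (\<theta> * L / 2) + (\<theta> * s) * ?S \<omega> $ j)"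
        by (simp add: ennreal_mult'[symmetric] exp_add[symmetric] del: ennreal_1 add: ennreal_1[symmetric])
      also have "\<dots> \<longleftrightarrow> \<theta> * (L/2) \<le> \<theta> * (s * ?S \<omega> $ j)"
        by (simp add: mult.assoc)
      also have "\<dots> \<longleftrightarrow> L/2 \<le> s * ?S \<omega> $ j" by (rule mult_le_cancel_left_pos[OF \<theta>])
      finally show "(L/2 \<le> s * ?S \<omega> $ j) = (1 \<le> ennreal (exp (- (\<theta> * L / 2))) * ennreal (exp ((\<theta> * s) * ?S \<omega> $ j)))" by simp
    qed
    also have "\<dots> \<le> ennreal (exp (- (\<theta> * L / 2))) * (\<integral>\<^sup>+\<omega>. ennreal (exp ((\<theta> * s) * ?S \<omega> $ j)) \<partial>M)"
    proof -
      let ?u = "\<lambda>\<omega>. ennreal (exp ((\<theta> * s) * ?S \<omega> $ j))"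
      have u: "(\<lambda>\<omega>. ?u \<omega> * indicator (space M) \<omega>) \<in> borel_measurable M" by measurable
      have "(\<integral>\<^sup>+\<omega>. ?u \<omega> * indicator (space M) \<omega> \<partial>M) = (\<integral>\<^sup>+\<omega>. ?u \<omega> \<partial>M)"
        by (rule nn_integral_cong) simp
      with nn_integral_Markov_inequality[OF u sets.top, of "ennreal (exp (- (\<theta> * L / 2)))"]
      show ?thesis by (simp only:)
    qed
    also have "\<dots> = ennreal (exp (- (\<theta> * L / 2) + (\<theta> * s)\<^sup>2 * (\<Sum>i<K. (c i)\<^sup>2 * (\<tau> (Suc i) - \<tau> i)) / 2))"
      by (subst brownian_increment_sum_mgf[where \<tau>=\<tau> and K=K, OF BM \<tau>0 \<tau>]) (simp_all only: exp_add ennreal_mult'[OF exp_ge_zero])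
    also have "\<dots> \<le> ennreal (exp (- (L\<^sup>2 / (8 * v))))"
    proof -
      have "(\<theta> * s)\<^sup>2 * (\<Sum>i<K. (c i)\<^sup>2 * (\<tau> (Suc i) - \<tau> i)) \<le> \<theta>\<^sup>2 * v"
        using v s by (simp add: power_mult_distrib mult_left_mono)
      moreover have "- (\<theta> * L / 2) + \<theta>\<^sup>2 * v / 2 = - (L\<^sup>2 / (8 * v))"
        using v by (simp add: \<theta>_def field_simps power2_eq_square)
      ultimately show ?thesis by simp
    qed
    finally show ?thesis .
  qed
  let ?E = "\<lambda>s j. {\<omega> \<in> space M. s * ?S \<omega> $ j \<ge> L/2}"
  have "{\<omega> \<in> space M. norm (?S \<omega>) > L} \<subseteq> ?E 1 1 \<union> ?E (-1) 1 \<union> ?E 1 2 \<union> ?E (-1) 2"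
  proof
    fix \<omega> assume \<omega>: "\<omega> \<in> {\<omega> \<in> space M. norm (?S \<omega>) > L}"
    have "norm (?S \<omega>) \<le> (\<Sum>i\<in>UNIV. \<bar>?S \<omega> $ i\<bar>)" by (rule norm_le_l1_cart)
    also have "\<dots> = \<bar>?S \<omega> $ 1\<bar> + \<bar>?S \<omega> $ 2\<bar>" by (rule sum_2)
    finally have "L < \<bar>?S \<omega> $ 1\<bar> + \<bar>?S \<omega> $ 2\<bar>" using \<omega> by auto
    then have "L / 2 \<le> ?S \<omega> $ 1 \<or> L / 2 \<le> - ?S \<omega> $ 1 \<or> L / 2 \<le> ?S \<omega> $ 2 \<or> L / 2 \<le> - ?S \<omega> $ 2"
      by argo
    with \<omega> show "\<omega> \<in> ?E 1 1 \<union> ?E (-1) 1 \<union> ?E 1 2 \<union> ?E (-1) 2" by auto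
  qed
  then have "emeasure M {\<omega> \<in> space M. norm (?S \<omega>) > L} \<le> emeasure M (?E 1 1 \<union> ?E (-1) 1 \<union> ?E 1 2 \<union> ?E (-1) 2)"
    by (rule emeasure_mono) measurable
  also have "\<dots> \<le> emeasure M (?E 1 1) + emeasure M (?E (-1) 1) + emeasure M (?E 1 2) + emeasure M (?E (-1) 2)"
    by (intro order.trans[OF emeasure_subadditive] add_mono order_refl) measurable
  also have "\<dots> \<le> ennreal (exp (- (L\<^sup>2 / (8 * v)))) + ennreal (exp (- (L\<^sup>2 / (8 * v)))) + ennreal (exp (- (L\<^sup>2 / (8 * v)))) + ennreal (exp (- (L\<^sup>2 / (8 * v))))"
    by (intro add_mono one_sided) auto
  also have "\<dots> = ennreal (4 * exp (- (L\<^sup>2 / (8 * v))))"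
    by (simp add: ennreal_plus[symmetric] del: ennreal_plus)
  finally show ?thesis .
qed

section \<open>Grid sums and their limits\<close>

text \<open>
  The probability that a binomial variable with \<open>m\<close> trials and success probability \<open>\<alpha>\<close> is at
  least \<open>k\<close>. Conditioning on one trial gives the third equation. This is the recursion of the
  Conga line itself, and the only description of the binomial distribution that the proof uses.
\<close>

fun binomial_tail :: "real \<Rightarrow> nat \<Rightarrow> nat \<Rightarrow> real" where
  "binomial_tail \<alpha> 0 m = 1"
| "binomial_tail \<alpha> (Suc k) 0 = 0"
| "binomial_tail \<alpha> (Suc k) (Suc m) = (1 - \<alpha>) * binomial_tail \<alpha> (Suc k) m + \<alpha> * binomial_tail \<alpha> k m"

text \<open>
  The linear functional of the path \<open>w\<close> with coefficient function \<open>c\<close>, on a grid of mesh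
  \<open>1 / N\<close>. The argument of \<open>c\<close> is the age \<open>z = i / N\<close> of the increment, measured backwards from
  time \<open>n\<close>, so that both lines are described by coefficients that do not depend on \<open>n\<close>.
\<close>

definition grid_sum :: "(real \<Rightarrow> 'v::real_vector) \<Rightarrow> nat \<Rightarrow> nat \<Rightarrow> (real \<Rightarrow> real) \<Rightarrow> 'v" where
  "grid_sum w n N c =
     (\<Sum>i<n * N. c (real i / real N) *\<^sub>R (w (real n - real i / real N) - w (real n - real (Suc i) / real N)))"

lemma grid_sum_diff: "grid_sum w n N c - grid_sum w n N d = grid_sum w n N (\<lambda>z. c z - d z)"
  by (simp add: grid_sum_def sum_subtractf[symmetric] scaleR_diff_left)

text \<open>
  Shifting the summation index by one step of time turns the recursion of \<open>binomial_tail\<close> into the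
  recursion of the Conga line. For a follower the increment of age 0 has coefficient 0, since it has so far
  reached the leader only.
\<close>

lemma conga_eq_sum_increments:
  assumes "w 0 = 0"
  shows "conga \<alpha> w (Suc k) n =
    (\<Sum>m<n. binomial_tail \<alpha> k m *\<^sub>R (w (real n - real m) - w (real n - real (Suc m))))"
proof (induction k arbitrary: n)
  case 0
  have "(\<Sum>m<n. w (real n - real m) - w (real n - real (Suc m))) = w (real n) - w 0"
    using sum_lessThan_telescope'[of "\<lambda>m. w (real n - real m)" n] by simp
  then show ?case using assms by simp
next
  case (Suc k)
  note IHk = Suc
  show ?case
  proof (induction n)
    case 0
    then show ?case by simp
  next
    case (Suc n)
    let ?S = "\<lambda>F. \<Sum>m<n. F m *\<^sub>R (w (real n - real m) - w (real n - real (Suc m)))"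
    have "(\<Sum>m<Suc n. binomial_tail \<alpha> (Suc k) m *\<^sub>R (w (real (Suc n) - real m) - w (real (Suc n) - real (Suc m))))
      = ?S (\<lambda>m. binomial_tail \<alpha> (Suc k) (Suc m))"
      by (subst sum.lessThan_Suc_shift) (simp add: diff_diff_eq add.commute)
    also have "\<dots> = (1 - \<alpha>) *\<^sub>R ?S (binomial_tail \<alpha> (Suc k)) + \<alpha> *\<^sub>R ?S (binomial_tail \<alpha> k)"
      by (simp add: scaleR_sum_right sum.distrib[symmetric] scaleR_add_left)
    also have "\<dots> = (1 - \<alpha>) *\<^sub>R conga \<alpha> w (Suc (Suc k)) n + \<alpha> *\<^sub>R conga \<alpha> w (Suc k) n"
      by (simp only: Suc.IH IHk)
    finally show ?case by simp
  qed
qed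

text \<open>
  The coefficient depends on the age only through its integer part, so the \<open>N\<close> grid increments
  that make up one unit of time telescope.
\<close>

lemma conga_eq_grid_sum:
  assumes "w 0 = 0" and N: "N > 0"
  shows "conga \<alpha> w (Suc k) n = grid_sum w n N (\<lambda>z. binomial_tail \<alpha> k (nat \<lfloor>z\<rfloor>))"
proof -
  let ?f = "\<lambda>i. binomial_tail \<alpha> k (nat \<lfloor>real i / real N\<rfloor>) *\<^sub>R
      (w (real n - real i / real N) - w (real n - real (Suc i) / real N))"
  have block: "sum ?f {m * N..<m * N + N} = binomial_tail \<alpha> k m *\<^sub>R (w (real n - real m) - w (real n - real (Suc m)))" for m
  proof -
    have "sum ?f {m * N..<m * N + N} = (\<Sum>i\<in>{m * N..<m * N + N}. binomial_tail \<alpha> k m *\<^sub>R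
      (w (real n - real i / real N) - w (real n - real (Suc i) / real N)))"
    proof (rule sum.cong[OF refl])
      fix i assume i: "i \<in> {m * N..<m * N + N}"
      then have "i div N = m" using N by (intro div_nat_eqI) (auto simp: mult.commute)
      then have "nat \<lfloor>real i / real N\<rfloor> = m" by (simp add: floor_divide_of_nat_eq)
      then show "?f i = binomial_tail \<alpha> k m *\<^sub>R (w (real n - real i / real N) - w (real n - real (Suc i) / real N))" by simp
    qed
    also have "\<dots> = binomial_tail \<alpha> k m *\<^sub>R (\<Sum>i\<in>{m * N..<m * N + N}. 
      (w (real n - real i / real N) - w (real n - real (Suc i) / real N)))"
      by (simp add: scaleR_sum_right)
    also have "(\<Sum>i\<in>{m * N..<m * N + N}. (w (real n - real i / real N) - w (real n - real (Suc i) / real N)))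
       = w (real n - real (m * N) / real N) - w (real n - real (m * N + N) / real N)"
      using sum_Suc_diff'[of "m * N" "m * N + N" "\<lambda>i. - w (real n - real i / real N)"] by (simp add: algebra_simps)
    also have "\<dots> = w (real n - real m) - w (real n - real (Suc m))"
    proof -
      have "real (m * N) / real N = real m" "real (m * N + N) / real N = real (Suc m)"
        using N by (auto simp: field_simps)
      then show ?thesis by (simp only:)
    qed
    finally show ?thesis .
  qed
  have "grid_sum w n N (\<lambda>z. binomial_tail \<alpha> k (nat \<lfloor>z\<rfloor>)) = (\<Sum>m<n. sum ?f {m * N..<m * N + N})"
    unfolding grid_sum_def by (rule sum.nat_group[symmetric])
  then show ?thesis by (simp only: block conga_eq_sum_increments[where w=w, OF assms(1)])
qed

lemma integral_grid_cells:
  fixes F :: "real \<Rightarrow> 'v::euclidean_space"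
  assumes N: "N > 0" and F: "F integrable_on {0..real K / real N}"
  shows "integral {0..real K / real N} F = (\<Sum>i<K. integral {real i / real N..real (Suc i) / real N} F)"
  using F
proof (induction K)
  case (Suc K)
  have le: "0 \<le> real K / real N" "real K / real N \<le> real (Suc K) / real N" using N by (auto simp: field_simps)
  have "F integrable_on {0..real K / real N}"
    using Suc.prems le by (auto intro: integrable_on_subinterval)
  moreover have "integral {0..real K / real N} F + integral {real K / real N..real (Suc K) / real N} F = integral {0..real (Suc K) / real N} F"
    using Henstock_Kurzweil_Integration.integral_combine[OF le Suc.prems] .
  ultimately show ?case using Suc.IH by simp
qed simp

text \<open>
  On each cell the increment of \<open>g\<close> is the integral of \<open>p\<close>, so the error made on a cell is the
  integral of \<open>p z\<close> times the oscillation of \<open>f\<close>, which is uniformly small. The derivative is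
  required only inside the interval, because the kernels below are singular expressions at time 0.
\<close>

lemma riemann_stieltjes_grid_limit:
  fixes f :: "real \<Rightarrow> 'v::euclidean_space" and g p :: "real \<Rightarrow> real"
  assumes contg: "continuous_on {0..real n} g"
    and deriv: "\<And>z. 0 < z \<Longrightarrow> z < real n \<Longrightarrow> (g has_real_derivative p z) (at z)"
    and contp: "continuous_on {0..real n} p" and contf: "continuous_on {0..real n} f"
  shows "(\<lambda>N. \<Sum>i<n * Suc N. (g (real (Suc i) / real (Suc N)) - g (real i / real (Suc N))) *\<^sub>R f (real (Suc i) / real (Suc N)))
     \<longlonglongrightarrow> integral {0..real n} (\<lambda>z. p z *\<^sub>R f z)"
proof (rule LIMSEQ_I)
  fix r :: real assume r: "r > 0"
  have "bounded (p ` {0..real n})"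
    by (rule compact_imp_bounded[OF compact_continuous_image[OF contp]]) auto
  then obtain P where P: "P > 0" "\<And>z. z \<in> {0..real n} \<Longrightarrow> \<bar>p z\<bar> \<le> P"
    by (auto simp: bounded_pos)
  \<comment> \<open>The sum of the cell errors is at most \<open>n P e\<close>, and this choice makes it less than \<open>r\<close>.\<close>
  define e where "e = r / (2 * P * (real n + 1))"
  have e: "e > 0" using r P by (simp add: e_def)
  have "uniformly_continuous_on {0..real n} f"
    by (rule compact_uniformly_continuous[OF contf]) auto
  then obtain d where d: "d > 0" "\<And>x y. x \<in> {0..real n} \<Longrightarrow> y \<in> {0..real n} \<Longrightarrow> dist y x < d \<Longrightarrow> dist (f y) (f x) < e"
    using e unfolding uniformly_continuous_on_def by metis
  obtain N0 where N0: "inverse (real (Suc N0)) < d" using reals_Archimedean[OF d(1)] by blast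
  show "\<exists>no. \<forall>N\<ge>no. norm ((\<Sum>i<n * Suc N. (g (real (Suc i) / real (Suc N)) - g (real i / real (Suc N))) *\<^sub>R f (real (Suc i) / real (Suc N))) - integral {0..real n} (\<lambda>z. p z *\<^sub>R f z)) < r"
  proof (intro exI allI impI)
    fix N assume N: "N0 \<le> N"
    define h where "h i = real i / real (Suc N)" for i
    have hstep: "h (Suc i) = h i + 1 / real (Suc N)" for i by (simp add: h_def field_simps)
    have small: "1 / real (Suc N) < d"
    proof -
      have "1 / real (Suc N) \<le> inverse (real (Suc N0))" using N by (simp add: field_simps)
      then show ?thesis using N0 by simp
    qed
    have hn: "h i \<le> real n" if "i \<le> n * Suc N" for i
    proof -
      have "real i \<le> real n * real (Suc N)" using that by (metis of_nat_le_iff of_nat_mult)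
      then show ?thesis by (simp add: h_def pos_divide_le_eq)
    qed
    have h0: "0 \<le> h i" for i by (simp add: h_def)
    have hend: "real (n * Suc N) / real (Suc N) = real n"
      unfolding of_nat_mult by (rule nonzero_mult_div_cancel_right) simp
    have pf: "(\<lambda>z. p z *\<^sub>R f z) integrable_on {0..real n}"
      by (intro integrable_continuous_real continuous_intros contp contf)
    have split: "integral {0..real n} (\<lambda>z. p z *\<^sub>R f z) = (\<Sum>i<n * Suc N. integral {h i..h (Suc i)} (\<lambda>z. p z *\<^sub>R f z))"
      using integral_grid_cells[of "Suc N" "\<lambda>z. p z *\<^sub>R f z" "n * Suc N"] pf unfolding hend h_def by simp
    have cell: "norm ((g (h (Suc i)) - g (h i)) *\<^sub>R f (h (Suc i)) - integral {h i..h (Suc i)} (\<lambda>z. p z *\<^sub>R f z)) \<le> P * e * (1 / real (Suc N))"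
      if i: "i < n * Suc N" for i
    proof -
      have sub: "{h i..h (Suc i)} \<subseteq> {0..real n}" using h0[of i] hn[of "Suc i"] i by auto
      have le: "h i \<le> h (Suc i)" by (simp add: hstep)
      have "(p has_integral (g (h (Suc i)) - g (h i))) {h i..h (Suc i)}"
        by (rule fundamental_theorem_of_calculus_interior[OF le continuous_on_subset[OF contg sub]])
           (use sub deriv h0[of i] hn[of "Suc i"] i in \<open>auto simp: has_real_derivative_iff_has_vector_derivative[symmetric]\<close>)
      then have 1: "((\<lambda>z. p z *\<^sub>R f (h (Suc i))) has_integral (g (h (Suc i)) - g (h i)) *\<^sub>R f (h (Suc i))) {h i..h (Suc i)}"
        by (rule has_integral_scaleR_left)
      have 2: "((\<lambda>z. p z *\<^sub>R f z) has_integral integral {h i..h (Suc i)} (\<lambda>z. p z *\<^sub>R f z)) {h i..h (Suc i)}"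
        by (rule integrable_integral) (rule integrable_on_subinterval[OF pf sub])
      have 3: "((\<lambda>z. p z *\<^sub>R f (h (Suc i)) - p z *\<^sub>R f z) has_integral
         ((g (h (Suc i)) - g (h i)) *\<^sub>R f (h (Suc i)) - integral {h i..h (Suc i)} (\<lambda>z. p z *\<^sub>R f z))) (cbox (h i) (h (Suc i)))"
        using has_integral_diff[OF 1 2] by simp
      have "norm ((g (h (Suc i)) - g (h i)) *\<^sub>R f (h (Suc i)) - integral {h i..h (Suc i)} (\<lambda>z. p z *\<^sub>R f z))
           \<le> P * e * measure lborel (cbox (h i) (h (Suc i)))"
      proof (rule has_integral_bound[OF _ 3])
        show "0 \<le> P * e" using P e by simp
        fix z assume z: "z \<in> cbox (h i) (h (Suc i))"
        then have zin: "z \<in> {0..real n}" "h (Suc i) \<in> {0..real n}" using sub le by auto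
        have "dist (h (Suc i)) z < d" using z small hstep[of i] by (auto simp: dist_real_def)
        then have "norm (f (h (Suc i)) - f z) \<le> e" using d(2)[OF zin] by (simp add: dist_norm)
        then have "\<bar>p z\<bar> * norm (f (h (Suc i)) - f z) \<le> P * e"
          using P zin by (intro mult_mono) auto
        then show "norm (p z *\<^sub>R f (h (Suc i)) - p z *\<^sub>R f z) \<le> P * e"
          by (simp add: scaleR_diff_right[symmetric])
      qed
      then show ?thesis using le by (simp add: hstep)
    qed
    have "norm ((\<Sum>i<n * Suc N. (g (h (Suc i)) - g (h i)) *\<^sub>R f (h (Suc i))) - integral {0..real n} (\<lambda>z. p z *\<^sub>R f z))
       \<le> (\<Sum>i<n * Suc N. P * e * (1 / real (Suc N)))"
      unfolding split sum_subtractf[symmetric] by (rule sum_norm_le) (use cell in auto)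
    also have "\<dots> = real n * (P * e)"
      by (simp add: field_simps)
    also have "\<dots> < r"
    proof -
      have "P * e = r / (2 * (real n + 1))" using P by (simp add: e_def)
      then have "real n * (P * e) = r * (real n / (2 * (real n + 1)))" by simp
      also have "\<dots> < r * 1" using r by (intro mult_strict_left_mono) (auto simp: field_simps)
      finally show ?thesis by simp
    qed
    finally show "norm ((\<Sum>i<n * Suc N. (g (real (Suc i) / real (Suc N)) - g (real i / real (Suc N))) *\<^sub>R f (real (Suc i) / real (Suc N))) - integral {0..real n} (\<lambda>z. p z *\<^sub>R f z)) < r"
      by (simp only: h_def)
  qed
qed

lemma sum_by_parts:
  fixes f :: "nat \<Rightarrow> 'v::real_vector" and g :: "nat \<Rightarrow> real"
  shows "(\<Sum>i<K. (g (Suc i) - g i) *\<^sub>R f (Suc i)) = (\<Sum>i<K. g i *\<^sub>R (f i - f (Suc i))) + (g K *\<^sub>R f K - g 0 *\<^sub>R f 0)"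
  by (induction K) (auto simp: algebra_simps)

text \<open>
  Summation by parts moves the difference from \<open>g\<close> to the path. Both boundary terms vanish: at age 0
  because \<open>g 0 = 0\<close>, and at age \<open>n\<close> because the path starts at 0. Evaluating the path at the right
  end of each cell makes the coefficient of the remaining sum exactly \<open>g\<close> at the grid points.
\<close>

lemma grid_sum_tendsto_integral:
  fixes w :: "real \<Rightarrow> 'v::euclidean_space" and g p :: "real \<Rightarrow> real"
  assumes contg: "continuous_on {0..real n} g"
    and deriv: "\<And>z. 0 < z \<Longrightarrow> z < real n \<Longrightarrow> (g has_real_derivative p z) (at z)"
    and contp: "continuous_on {0..real n} p" and g0: "g 0 = 0"
    and contw: "continuous_on {0..} w" and w0: "w 0 = 0"
  shows "(\<lambda>N. grid_sum w n (Suc N) g) \<longlonglongrightarrow> integral {0..real n} (\<lambda>z. p z *\<^sub>R w (real n - z))"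
proof -
  have contf: "continuous_on {0..real n} (\<lambda>z. w (real n - z))"
    by (rule continuous_on_compose2[OF contw]) (auto intro!: continuous_intros)
  have eq: "(\<Sum>i<n * Suc N. (g (real (Suc i) / real (Suc N)) - g (real i / real (Suc N))) *\<^sub>R w (real n - real (Suc i) / real (Suc N)))
     = grid_sum w n (Suc N) g" for N
  proof -
    have hend: "real (n * Suc N) / real (Suc N) = real n"
      unfolding of_nat_mult by (rule nonzero_mult_div_cancel_right) simp
    show ?thesis
    unfolding sum_by_parts[of "\<lambda>i. g (real i / real (Suc N))" "\<lambda>i. w (real n - real i / real (Suc N))"] grid_sum_def hend
    by (simp add: g0 w0 del: of_nat_Suc)
  qed
  show ?thesis
    using riemann_stieltjes_grid_limit[OF contg deriv contp contf] unfolding eq .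
qed

section \<open>The continuous line as a limit of grid sums\<close>

text \<open>
  The complementary distribution function of the standard normal law. Taking it as a measure makes its
  values lie in \<open>[0, 1]\<close> without any computation of Gaussian integrals.
\<close>

definition normal_tail :: "real \<Rightarrow> real" where
  "normal_tail y = measure std_normal_distribution {y<..}"

lemma measure_std_normal:
  assumes "A \<in> sets borel"
  shows "measure std_normal_distribution A = (LINT x|lborel. std_normal_density x * indicator A x)"
proof -
  interpret prob_space std_normal_distribution by (rule prob_space_normal_density) simp
  have "measure std_normal_distribution A = (LINT x|std_normal_distribution. indicator A x)"
    using assms by simp
  also have "\<dots> = (LINT x|lborel. std_normal_density x * indicator A x)"
    using assms by (subst integral_density) (auto simp: normal_density_nonneg)
  finally show ?thesis .
qed

text \<open>
  Where \<open>y * (x - y) \<ge> 0\<close>, the standard normal density at \<open>x\<close> is at most \<open>exp (- y\<^sup>2 / 2)\<close>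
  times the density of a normal law centred at \<open>y\<close>. This gives both tail bounds at once: the upper
  one from \<open>{y<..}\<close> with \<open>y \<ge> 0\<close>, the lower one from \<open>{..y}\<close> with \<open>y \<le> 0\<close>.
\<close>

lemma std_normal_half_line_bound:
  assumes A: "A \<in> sets borel" and sign: "\<And>x. x \<in> A \<Longrightarrow> y * (x - y) \<ge> 0"
  shows "measure std_normal_distribution A \<le> exp (- y\<^sup>2 / 2)"
proof -
  have "(LINT x|lborel. std_normal_density x * indicator A x) \<le> (LINT x|lborel. exp (- y\<^sup>2 / 2) * normal_density y 1 x)"
  proof (rule integral_mono)
    show "integrable lborel (\<lambda>x. std_normal_density x * indicator A x)"
      using A by (intro integrable_real_mult_indicator) auto
    show "integrable lborel (\<lambda>x. exp (- y\<^sup>2 / 2) * normal_density y 1 x)" by simp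
    fix x :: real
    have e: "- x\<^sup>2 / 2 \<le> - y\<^sup>2 / 2 + - (x - y)\<^sup>2 / 2" if "y * (x - y) \<ge> 0"
      using that by (simp add: power2_eq_square field_simps)
    have "x \<in> A \<Longrightarrow> exp (- x\<^sup>2 / 2) \<le> exp (- y\<^sup>2 / 2) * exp (- (x - y)\<^sup>2 / 2)"
      unfolding exp_add[symmetric] exp_le_cancel_iff using e sign by blast
    then show "std_normal_density x * indicator A x \<le> exp (- y\<^sup>2 / 2) * normal_density y 1 x"
      by (auto simp: normal_density_def indicator_def field_simps)
  qed
  then show ?thesis using measure_std_normal[OF A] by simp
qed

lemma normal_tail_upper: "y \<ge> 0 \<Longrightarrow> normal_tail y \<le> exp (- y\<^sup>2 / 2)"
  unfolding normal_tail_def by (rule std_normal_half_line_bound) auto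

lemma normal_tail_nonneg: "0 \<le> normal_tail y" and normal_tail_le_1: "normal_tail y \<le> 1"
proof -
  interpret prob_space std_normal_distribution by (rule prob_space_normal_density) simp
  show "0 \<le> normal_tail y" "normal_tail y \<le> 1" by (auto simp: normal_tail_def)
qed

lemma normal_tail_lower: "y \<le> 0 \<Longrightarrow> 1 - normal_tail y \<le> exp (- y\<^sup>2 / 2)"
proof -
  assume y: "y \<le> 0"
  interpret prob_space std_normal_distribution by (rule prob_space_normal_density) simp
  have "1 - normal_tail y = measure std_normal_distribution (space std_normal_distribution - {y<..})"
    unfolding normal_tail_def by (rule prob_compl[symmetric]) simp
  also have "space std_normal_distribution - {y<..} = {..y}" by auto
  also have "measure std_normal_distribution {..y} \<le> exp (- y\<^sup>2 / 2)"
    by (rule std_normal_half_line_bound) (use y in \<open>auto intro: mult_nonpos_nonpos\<close>)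
  finally show ?thesis .
qed

lemma normal_tail_has_derivative:
  "(normal_tail has_real_derivative - std_normal_density y) (at y)"
proof -
  interpret prob_space std_normal_distribution by (rule prob_space_normal_density) simp
  have cont: "continuous_on S std_normal_density" for S
    unfolding normal_density_def by (intro continuous_intros) auto
  have eq: "normal_tail x = normal_tail (y - 1) - integral {y-1..x} std_normal_density" if "y - 1 \<le> x" for x
  proof -
    have "{y-1<..} = {y-1<..x} \<union> {x<..}" using that by auto
    then have "normal_tail (y - 1) = measure std_normal_distribution {y-1<..x} + normal_tail x"
      unfolding normal_tail_def by (simp add: finite_measure_Union disjoint_iff)
    moreover have "measure std_normal_distribution {y-1<..x} = (LINT x:{y-1<..x}|lborel. std_normal_density x)"
      by (subst measure_std_normal) (auto simp: set_lebesgue_integral_def mult.commute)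
    moreover have "\<dots> = integral {y-1<..x} std_normal_density"
      by (rule set_borel_integral_eq_integral) (auto simp: set_integrable_def mult.commute[of "indicator _ _"] intro!: integrable_real_mult_indicator)
    moreover have "integral {y-1<..x} std_normal_density = integral {y-1..x} std_normal_density"
      by (rule integral_spike_set; rule negligible_subset[of "{y-1}"]) auto
    ultimately show ?thesis by simp
  qed
  have "((\<lambda>x. integral {y-1..x} std_normal_density) has_real_derivative std_normal_density y) (at y within {y-1..y+1})"
    by (rule integral_has_real_derivative[OF cont]) auto
  then have "((\<lambda>x. normal_tail (y - 1) - integral {y-1..x} std_normal_density) has_real_derivative - std_normal_density y) (at y within {y-1..y+1})"
    by (auto intro!: derivative_eq_intros)
  then have "(normal_tail has_real_derivative - std_normal_density y) (at y within {y-1..y+1})"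
    by (rule has_field_derivative_transform_within[where d=1, OF _ _ _ eq[symmetric]]) auto
  moreover have "at y within {y-1..y+1} = at y"
    by (rule at_within_interior) auto
  ultimately show ?thesis by simp
qed

definition standardized :: "real \<Rightarrow> real \<Rightarrow> real \<Rightarrow> real" where
  "standardized \<alpha> x z = (x - \<alpha> * z) / (conga_sigma \<alpha> * sqrt z)"

text \<open>
  The coefficient of the continuous line. The quotient \<open>standardized \<alpha> x 0\<close> has the default value 0,
  at which the normal tail is \<open>1/2\<close>; the limit at small times for \<open>x > 0\<close> is 0, and the case
  distinction makes the function continuous there.
\<close>

definition gauss_tail :: "real \<Rightarrow> real \<Rightarrow> real \<Rightarrow> real" where
  "gauss_tail \<alpha> x z = (if z \<le> 0 then 0 else normal_tail (standardized \<alpha> x z))"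

text \<open>
  The density of the normal law with mean \<open>\<alpha> z\<close> and variance \<open>\<sigma>\<^sup>2 z\<close>. At \<open>z = 0\<close> the
  division by zero gives the value 0, which is also the limit for \<open>x > 0\<close>.
\<close>

definition gauss_density :: "real \<Rightarrow> real \<Rightarrow> real \<Rightarrow> real" where
  "gauss_density \<alpha> x z = std_normal_density (standardized \<alpha> x z) / (conga_sigma \<alpha> * sqrt z)"

text \<open>
  The derivative of the kernel in \<open>x\<close>. Since the kernel is the time derivative of
  \<open>gauss_tail\<close>, whose derivative in \<open>x\<close> is \<open>- gauss_density\<close>, this is also minus the time derivative
  of \<open>gauss_density\<close>.
\<close>

definition conga_kernel_dx :: "real \<Rightarrow> real \<Rightarrow> real \<Rightarrow> real" where
  "conga_kernel_dx \<alpha> x z = 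
     (1 - (x - \<alpha> * z) * (x + \<alpha> * z) / ((conga_sigma \<alpha>)\<^sup>2 * z)) *
     exp (- ((x - \<alpha> * z)\<^sup>2 / (2 * (conga_sigma \<alpha>)\<^sup>2 * z))) / (sqrt (2 * pi) * (2 * conga_sigma \<alpha> * (z * sqrt z)))"

lemma powr_3_2: "z \<ge> 0 \<Longrightarrow> z powr (3/2) = z * sqrt (z::real)"
proof -
  assume "z \<ge> 0"
  have "z powr (3/2) = z powr (1 + 1/2)" by simp
  also have "\<dots> = z powr 1 * z powr (1/2)" by (rule powr_add)
  finally show ?thesis using \<open>z \<ge> 0\<close> by (simp add: powr_half_sqrt)
qed

lemma std_normal_density_deriv:
  "(std_normal_density has_real_derivative - (y * std_normal_density y)) (at y)"
proof -
  have "((\<lambda>y. c * exp (- y\<^sup>2 / 2)) has_real_derivative - (y * (c * exp (- y\<^sup>2 / 2)))) (at y)" for c :: real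
    by (auto intro!: derivative_eq_intros)
  then show ?thesis unfolding std_normal_density_def[abs_def] .
qed

text \<open>
  Continuity on a closed time interval for functions given by expressions that divide by the time: at
  positive times the expression is continuous, and at time 0 a linear bound takes over.
\<close>

lemma continuous_on_at_zero_time:
  fixes f :: "real \<times> real \<Rightarrow> real"
  assumes cont: "continuous_on (UNIV \<times> {0<..}) f"
    and zero: "\<And>x. f (x, 0) = 0"
    and bound: "\<And>x z. x \<in> {l..u} \<Longrightarrow> 0 < z \<Longrightarrow> z \<le> 1 \<Longrightarrow> \<bar>f (x, z)\<bar> \<le> C * z"
  shows "continuous_on ({l..u} \<times> {0..T}) f"
  unfolding continuous_on_def
proof
  fix y assume y: "y \<in> {l..u} \<times> {0..T}"
  obtain x z where xz: "y = (x, z)" by (cases y)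
  show "(f \<longlongrightarrow> f y) (at y within {l..u} \<times> {0..T})"
  proof (cases "z = 0")
    case False
    then have z: "z > 0" using y xz by auto
    have "open (UNIV \<times> {0::real<..} :: (real \<times> real) set)" by (intro open_Times) auto
    then have "isCont f y" using cont z xz by (auto simp: continuous_on_eq_continuous_at)
    then show ?thesis by (auto simp: isCont_def intro: tendsto_within_subset)
  next
    case True
    have "((\<lambda>p. C * snd p) \<longlongrightarrow> C * snd y) (at y within {l..u} \<times> {0..T})"
      by (intro tendsto_intros)
    then have lim: "((\<lambda>p. C * snd p) \<longlongrightarrow> 0) (at y within {l..u} \<times> {0..T})" using True xz by simp
    have "((\<lambda>p. snd p) \<longlongrightarrow> snd y) (at y within {l..u} \<times> {0..T})" by (intro tendsto_intros)
    then have "eventually (\<lambda>p. snd p < 1) (at y within {l..u} \<times> {0..T})"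
      by (rule order_tendstoD) (use True xz in simp)
    moreover have "eventually (\<lambda>p. p \<in> {l..u} \<times> {0..T}) (at y within {l..u} \<times> {0..T})"
      by (auto simp: eventually_at_filter)
    ultimately have "eventually (\<lambda>p. norm (f p) \<le> C * snd p) (at y within {l..u} \<times> {0..T})"
    proof eventually_elim
      case (elim p)
      obtain x' z' where p: "p = (x', z')" by (cases p)
      show ?case
      proof (cases "z' = 0")
        case False
        then show ?thesis using elim p bound[of x' z'] by auto
      qed (simp add: p zero)
    qed
    then have "(f \<longlongrightarrow> 0) (at y within {l..u} \<times> {0..T})"
      by (rule Lim_null_comparison[OF _ lim])
    then show ?thesis using True xz zero by simp
  qed
qed

locale conga_rate =
  fixes \<alpha> \<sigma> :: real
  assumes a: "0 < \<alpha>" "\<alpha> < 1"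
  defines "\<sigma> \<equiv> conga_sigma \<alpha>"
begin

lemma sigma_pos: "\<sigma> > 0" and sigma_sq: "\<sigma>\<^sup>2 = \<alpha> * (1 - \<alpha>)"
  using a by (simp_all add: \<sigma>_def conga_sigma_def)

lemma sigma_sq_le: "\<sigma>\<^sup>2 \<le> \<alpha>"
  unfolding sigma_sq using a by (simp add: mult_left_le)

lemma standardized_sq: "z > 0 \<Longrightarrow> (standardized \<alpha> x z)\<^sup>2 / 2 = (x - \<alpha> * z)\<^sup>2 / (2 * \<sigma>\<^sup>2 * z)"
  by (simp add: standardized_def \<sigma>_def power_divide power_mult_distrib)

lemma density_standardized:
  "z > 0 \<Longrightarrow> std_normal_density (standardized \<alpha> x z) = exp (- ((x - \<alpha> * z)\<^sup>2 / (2 * \<sigma>\<^sup>2 * z))) / sqrt (2 * pi)"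
  unfolding std_normal_density_def using standardized_sq[of z x] by simp

lemma standardized_deriv_z:
  assumes z: "z > 0"
  shows "((\<lambda>z. standardized \<alpha> x z) has_real_derivative - (x + \<alpha> * z) / (2 * \<sigma> * (z * sqrt z))) (at z)"
proof -
  obtain r where r: "r > 0" "z = r * r" "sqrt z = r" using z by (metis real_sqrt_gt_zero real_sqrt_mult_self abs_of_pos)
  show ?thesis unfolding standardized_def \<sigma>_def[symmetric]
    using z sigma_pos r by (auto intro!: derivative_eq_intros simp: field_simps) 
qed

lemma gauss_tail_deriv_z:
  assumes z: "z > 0"
  shows "((\<lambda>z. gauss_tail \<alpha> x z) has_real_derivative conga_kernel \<alpha> x z) (at z)"
proof -
  have "((\<lambda>z. normal_tail (standardized \<alpha> x z)) has_real_derivative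
      - std_normal_density (standardized \<alpha> x z) * (- (x + \<alpha> * z) / (2 * \<sigma> * (z * sqrt z)))) (at z)"
    by (rule DERIV_chain2[OF normal_tail_has_derivative standardized_deriv_z[OF z]])
  moreover have "- std_normal_density (standardized \<alpha> x z) * (- (x + \<alpha> * z) / (2 * \<sigma> * (z * sqrt z))) = conga_kernel \<alpha> x z"
  proof -
    have "- d * (- (x + \<alpha> * z) / K) = d * ((x + \<alpha> * z) / K)" for d K
      by (cases "K = 0") (auto simp: field_simps)
    then show ?thesis
      unfolding density_standardized[OF z] conga_kernel_def powr_3_2[OF less_imp_le[OF z]] \<sigma>_def[symmetric]
      by simp
  qed
  ultimately have "((\<lambda>z. normal_tail (standardized \<alpha> x z)) has_real_derivative conga_kernel \<alpha> x z) (at z)" by simp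
  then show ?thesis
    by (rule has_field_derivative_transform_within_open[where S="{0<..}"]) (use z in \<open>auto simp: gauss_tail_def\<close>)
qed

lemma gauss_tail_deriv_x:
  assumes z: "z > 0"
  shows "((\<lambda>x. gauss_tail \<alpha> x z) has_real_derivative - gauss_density \<alpha> x z) (at x)"
proof -
  have "((\<lambda>x. standardized \<alpha> x z) has_real_derivative 1 / (\<sigma> * sqrt z)) (at x)"
    unfolding standardized_def \<sigma>_def[symmetric] using sigma_pos z by (auto intro!: derivative_eq_intros)
  from DERIV_chain2[OF normal_tail_has_derivative this] z
  show ?thesis by (simp add: gauss_tail_def gauss_density_def \<sigma>_def)
qed

lemma gauss_density_deriv_x:
  assumes z: "z > 0"
  shows "((\<lambda>x. gauss_density \<alpha> x z) has_real_derivative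
     - (standardized \<alpha> x z * std_normal_density (standardized \<alpha> x z)) / (\<sigma>\<^sup>2 * z)) (at x)"
proof -
  have "((\<lambda>x. standardized \<alpha> x z) has_real_derivative 1 / (\<sigma> * sqrt z)) (at x)"
    unfolding standardized_def \<sigma>_def[symmetric] using sigma_pos z by (auto intro!: derivative_eq_intros)
  from DERIV_cdivide[OF DERIV_chain2[OF std_normal_density_deriv this], of "\<sigma> * sqrt z"] z
  show ?thesis by (simp add: gauss_density_def \<sigma>_def power2_eq_square mult.assoc mult.left_commute)
qed

lemma gauss_density_deriv_z:
  assumes z: "z > 0"
  shows "((\<lambda>z. gauss_density \<alpha> x z) has_real_derivative - conga_kernel_dx \<alpha> x z) (at z)"
proof -
  obtain r where r: "r > 0" "z = r * r" "sqrt z = r" using z by (metis real_sqrt_gt_zero real_sqrt_mult_self abs_of_pos)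
  define d where "d = std_normal_density (standardized \<alpha> x z)"
  have d1: "((\<lambda>z. std_normal_density (standardized \<alpha> x z)) has_real_derivative
      - (standardized \<alpha> x z * d) * (- (x + \<alpha> * z) / (2 * \<sigma> * (z * sqrt z)))) (at z)"
    unfolding d_def by (rule DERIV_chain2[OF std_normal_density_deriv standardized_deriv_z[OF z]])
  have d2: "((\<lambda>z. \<sigma> * sqrt z) has_real_derivative \<sigma> / (2 * sqrt z)) (at z)"
    using z by (auto intro!: derivative_eq_intros simp: field_simps)
  have "((\<lambda>z. gauss_density \<alpha> x z) has_real_derivative 
     ((- (standardized \<alpha> x z * d) * (- (x + \<alpha> * z) / (2 * \<sigma> * (z * sqrt z)))) * (\<sigma> * sqrt z) - d * (\<sigma> / (2 * sqrt z))) / ((\<sigma> * sqrt z) * (\<sigma> * sqrt z))) (at z)"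
    unfolding gauss_density_def \<sigma>_def[symmetric]
    by (rule DERIV_cong[OF DERIV_divide[OF d1 d2]]) (use sigma_pos z in \<open>simp_all add: d_def\<close>)
  moreover have "((- (standardized \<alpha> x z * d) * (- (x + \<alpha> * z) / (2 * \<sigma> * (z * sqrt z)))) * (\<sigma> * sqrt z) - d * (\<sigma> / (2 * sqrt z))) / ((\<sigma> * sqrt z) * (\<sigma> * sqrt z))
     = - (1 - (x - \<alpha> * z) * (x + \<alpha> * z) / (\<sigma>\<^sup>2 * z)) * d / (2 * \<sigma> * (z * sqrt z))"
    unfolding standardized_def \<sigma>_def[symmetric] r(3) unfolding r(2) using r(1) sigma_pos 
    by (simp add: field_simps power2_eq_square)
  moreover have "- (1 - (x - \<alpha> * z) * (x + \<alpha> * z) / (\<sigma>\<^sup>2 * z)) * d / (2 * \<sigma> * (z * sqrt z)) = - conga_kernel_dx \<alpha> x z"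
  proof -
    have "- X * (E / S) / K = - (X * E / (S * K))" for X E S K :: real by simp
    then show ?thesis unfolding conga_kernel_dx_def d_def density_standardized[OF z] \<sigma>_def[symmetric] .
  qed
  ultimately show ?thesis by simp
qed

lemma conga_kernel_deriv_x:
  assumes z: "z \<ge> 0"
  shows "((\<lambda>x. conga_kernel \<alpha> x z) has_real_derivative conga_kernel_dx \<alpha> x z) (at x)"
proof (cases "z = 0")
  case True
  then show ?thesis by (simp add: conga_kernel_def conga_kernel_dx_def)
next
  case False
  then have z: "z > 0" using z by simp
  define E where "E = exp (- ((x - \<alpha> * z)\<^sup>2 / (2 * \<sigma>\<^sup>2 * z)))"
  have 1: "((\<lambda>x. exp (- ((x - \<alpha> * z)\<^sup>2 / (2 * \<sigma>\<^sup>2 * z)))) has_real_derivative - ((x - \<alpha> * z) / (\<sigma>\<^sup>2 * z)) * E) (at x)"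
    unfolding E_def using z sigma_pos by (auto intro!: derivative_eq_intros simp: field_simps)
  have 2: "((\<lambda>x. 1 / sqrt (2 * pi) * ((x + \<alpha> * z) / (2 * \<sigma> * (z * sqrt z)))) has_real_derivative 1 / sqrt (2 * pi) * (1 / (2 * \<sigma> * (z * sqrt z)))) (at x)"
    using sigma_pos z by (auto intro!: derivative_eq_intros)
  show ?thesis unfolding conga_kernel_def powr_3_2[OF less_imp_le[OF z]] conga_kernel_dx_def \<sigma>_def[symmetric] E_def[symmetric]
    using DERIV_mult[OF 2 1] unfolding E_def[symmetric]
    by (rule DERIV_cong) (use z sigma_pos in \<open>simp add: field_simps\<close>)
qed

text \<open>
  For \<open>x\<close> bounded away from 0 the exponent contains a term \<open>- A / z\<close>, which beats every power of
  \<open>1 / z\<close>. The fourth power covers the singularity \<open>z^(-5/2)\<close> of \<open>conga_kernel_dx\<close> with a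
  factor \<open>z\<close> to spare.
\<close>

lemma heat_factor_small_time:
  assumes x: "0 < l" "l \<le> u"
  shows "\<exists>C\<ge>0. \<forall>x\<in>{l..u}. \<forall>z. 0 < z \<longrightarrow> exp (- ((x - \<alpha> * z)\<^sup>2 / (2 * \<sigma>\<^sup>2 * z))) \<le> C * z^4"
proof -
  define A where "A = l\<^sup>2 / (2 * \<sigma>\<^sup>2)"
  define B where "B = \<alpha> * u / \<sigma>\<^sup>2"
  have A: "A > 0" using x sigma_pos by (simp add: A_def)
  have "exp (- ((x - \<alpha> * z)\<^sup>2 / (2 * \<sigma>\<^sup>2 * z))) \<le> (exp B * (4^4 / A^4)) * z^4" if xz: "x \<in> {l..u}" "z > 0" for x z
  proof -
    have "(x - \<alpha> * z)\<^sup>2 / (2 * \<sigma>\<^sup>2 * z) = x\<^sup>2 / (2 * \<sigma>\<^sup>2) / z - \<alpha> * x / \<sigma>\<^sup>2 + \<alpha>\<^sup>2 * z / (2 * \<sigma>\<^sup>2)"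
      using xz sigma_pos by (simp add: field_simps power2_eq_square)
    moreover have "x\<^sup>2 / (2 * \<sigma>\<^sup>2) / z \<ge> A / z"
      unfolding A_def using xz x by (intro divide_right_mono power_mono) auto
    moreover have "\<alpha> * x / \<sigma>\<^sup>2 \<le> B" unfolding B_def using xz a by (intro divide_right_mono mult_left_mono) auto
    moreover have "\<alpha>\<^sup>2 * z / (2 * \<sigma>\<^sup>2) \<ge> 0" using xz by simp
    ultimately have "- ((x - \<alpha> * z)\<^sup>2 / (2 * \<sigma>\<^sup>2 * z)) \<le> B + - (A / z)" by linarith
    then have "exp (- ((x - \<alpha> * z)\<^sup>2 / (2 * \<sigma>\<^sup>2 * z))) \<le> exp B * exp (- (A / z))"
      unfolding exp_add[symmetric] by simp
    also have "exp (- (A / z)) \<le> 4^4 / (A/z)^4"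
    proof -
      \<comment> \<open>The bound \<open>u^4 / 4^4 \<le> exp u\<close> is the fourth power of \<open>u / 4 \<le> exp (u / 4)\<close>.\<close>
      have "A/z/4 \<le> exp (A/z/4)" using exp_ge_add_one_self[of "A/z/4"] by linarith
      then have "(A/z/4)^4 \<le> (exp (A/z/4))^4"
        using A xz by (intro power_mono) auto
      also have "\<dots> = exp (A/z)" by (simp add: exp_of_nat_mult[symmetric])
      finally have "(A/z)^4 / 4^4 \<le> exp (A/z)" by (simp add: power_divide)
      then have "inverse (exp (A/z)) \<le> inverse ((A/z)^4 / 4^4)"
        using A xz by (intro le_imp_inverse_le) auto
      then show ?thesis by (simp add: exp_minus)
    qed
    also have "4^4 / (A/z)^4 = 4^4 / A^4 * z^4" using A xz by (simp add: power_divide)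
    finally show ?thesis by simp
  qed
  then show ?thesis using A by (intro exI[of _ "exp B * (4^4 / A^4)"]) auto
qed

text \<open>
  Up to bounded factors, all four are at most the heat factor over a half-integral power of \<open>z\<close>. Writing
  \<open>z = r * r\<close> turns these into integral powers of \<open>r\<close>, and \<open>r^8 / r^n \<le> z\<close> for \<open>n \<le> 6\<close>.
  The tail is estimated only ahead of the mean, where its argument is nonnegative.
\<close>

lemma kernels_small_time:
  assumes x: "0 < l" "l \<le> u"
  shows "\<exists>C. \<forall>x\<in>{l..u}. \<forall>z. 0 < z \<longrightarrow> z \<le> 1 \<longrightarrow> \<bar>conga_kernel \<alpha> x z\<bar> \<le> C * z \<and> \<bar>conga_kernel_dx \<alpha> x z\<bar> \<le> C * z
      \<and> gauss_density \<alpha> x z \<le> C * z \<and> (\<alpha> * z \<le> x \<longrightarrow> gauss_tail \<alpha> x z \<le> C * z)"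
proof -
  obtain C where C: "C \<ge> 0" "\<And>x z. x \<in> {l..u} \<Longrightarrow> 0 < z \<Longrightarrow> exp (- ((x - \<alpha> * z)\<^sup>2 / (2 * \<sigma>\<^sup>2 * z))) \<le> C * z^4"
    using heat_factor_small_time[OF x] by blast
  define s where "s = sqrt (2 * pi)"
  have s: "s \<ge> 1" using pi_gt3 by (simp add: s_def)
  define C1 where "C1 = C * ((u + 1) / (2 * \<sigma>))"
  define C2 where "C2 = C * ((1 + (u + 1) * (u + 1) / \<sigma>\<^sup>2) / (2 * \<sigma>))"
  define C3 where "C3 = C / \<sigma>"
  have nn: "C1 \<ge> 0" "C2 \<ge> 0" "C3 \<ge> 0" using C sigma_pos x by (auto simp: C1_def C2_def C3_def)
  have main: "\<bar>conga_kernel \<alpha> x z\<bar> \<le> C1 * z \<and> \<bar>conga_kernel_dx \<alpha> x z\<bar> \<le> C2 * z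
      \<and> gauss_density \<alpha> x z \<le> C3 * z \<and> (\<alpha> * z \<le> x \<longrightarrow> gauss_tail \<alpha> x z \<le> C * z)"
    if xz: "x \<in> {l..u}" "0 < z" "z \<le> 1" for x z
  proof -
    define E where "E = exp (- ((x - \<alpha> * z)\<^sup>2 / (2 * \<sigma>\<^sup>2 * z)))"
    have E: "0 \<le> E" "E \<le> C * z^4" using C(2)[of x z] xz by (auto simp: E_def)
    obtain r where r: "r > 0" "z = r * r" "sqrt z = r" using xz by (metis real_sqrt_gt_zero real_sqrt_mult_self abs_of_pos)
    have r1: "r \<le> 1" using r xz by (metis real_sqrt_le_1_iff)
    have pw: "r ^ n \<le> 1" for n using r r1 by (simp add: power_le_one)
    have az: "0 \<le> \<alpha> * z" "\<alpha> * z \<le> 1" using a xz by (auto intro: mult_le_one)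
    have Er: "E \<le> C * r^8" using E r(2) by (simp add: power_mult_distrib power2_eq_square eval_nat_numeral mult_ac)
    have div: "E / (s * r ^ n) \<le> C * z" if "n \<le> 6" for n
    proof -
      have "E / (s * r ^ n) \<le> E / (1 * r ^ n)"
        using s r E by (intro divide_left_mono mult_right_mono) auto
      also have "\<dots> \<le> C * r^8 / r ^ n" using Er r by (simp add: divide_right_mono)
      also have "\<dots> = C * (z * r ^ (6 - n))"
      proof -
        have "r ^ 8 = z * r ^ (6 - n) * r ^ n"
          using that by (simp add: r(2) mult.assoc power_add[symmetric] power_Suc[symmetric] del: power_Suc)
        then show ?thesis using r(1) by simp
      qed
      also have "\<dots> \<le> C * (z * 1)" using C xz pw by (intro mult_left_mono) auto
      finally show ?thesis by simp
    qed
    have 1: "\<bar>conga_kernel \<alpha> x z\<bar> \<le> C1 * z"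
    proof -
      have "conga_kernel \<alpha> x z = (x + \<alpha> * z) / (2 * \<sigma>) * (E / (s * r ^ 3))"
        unfolding conga_kernel_def powr_3_2[OF less_imp_le[OF xz(2)]] \<sigma>_def[symmetric] s_def[symmetric] E_def[symmetric] r(3)
        by (simp add: r(2) power3_eq_cube)
      moreover have "0 \<le> (x + \<alpha> * z) / (2 * \<sigma>)" "(x + \<alpha> * z) / (2 * \<sigma>) \<le> (u + 1) / (2 * \<sigma>)"
        using xz x az sigma_pos by (auto intro!: divide_right_mono)
      moreover have "0 \<le> E / (s * r ^ 3)" using E s r by simp
      ultimately have "\<bar>conga_kernel \<alpha> x z\<bar> = (x + \<alpha> * z) / (2 * \<sigma>) * (E / (s * r ^ 3))"
        by (metis abs_of_nonneg mult_nonneg_nonneg)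
      also have "\<dots> \<le> (u + 1) / (2 * \<sigma>) * (C * z)"
        by (rule mult_mono) (use div[of 3] xz x sigma_pos E s r az in \<open>auto intro!: divide_right_mono\<close>)
      finally have "\<bar>conga_kernel \<alpha> x z\<bar> \<le> (u + 1) / (2 * \<sigma>) * (C * z)" .
      then show ?thesis by (simp add: C1_def mult_ac)
    qed
    have 2: "\<bar>conga_kernel_dx \<alpha> x z\<bar> \<le> C2 * z"
    proof -
      have "conga_kernel_dx \<alpha> x z = (z - (x - \<alpha> * z) * (x + \<alpha> * z) / \<sigma>\<^sup>2) / (2 * \<sigma>) * (E / (s * r ^ 5))"
      proof -
        have r5: "r ^ 5 = z * (z * r)" by (simp add: r(2) eval_nat_numeral)
        have "1 - (x - \<alpha> * z) * (x + \<alpha> * z) / (\<sigma>\<^sup>2 * z) = (z - (x - \<alpha> * z) * (x + \<alpha> * z) / \<sigma>\<^sup>2) / z"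
          using xz by (simp add: diff_divide_distrib)
        then show ?thesis
          unfolding conga_kernel_dx_def \<sigma>_def[symmetric] s_def[symmetric] E_def[symmetric] r(3) r5 by simp
      qed
      then have eq: "\<bar>conga_kernel_dx \<alpha> x z\<bar> = \<bar>(z - (x - \<alpha> * z) * (x + \<alpha> * z) / \<sigma>\<^sup>2) / (2 * \<sigma>)\<bar> * \<bar>E / (s * r ^ 5)\<bar>"
        by (simp only: abs_mult)
      have le: "\<bar>(z - (x - \<alpha> * z) * (x + \<alpha> * z) / \<sigma>\<^sup>2) / (2 * \<sigma>)\<bar> \<le> (1 + (u + 1) * (u + 1) / \<sigma>\<^sup>2) / (2 * \<sigma>)"
      proof -
        have "\<bar>(x - \<alpha> * z) * (x + \<alpha> * z)\<bar> \<le> (u + 1) * (u + 1)"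
          unfolding abs_mult using xz x az by (intro mult_mono) auto
        then have "\<bar>(x - \<alpha> * z) * (x + \<alpha> * z) / \<sigma>\<^sup>2\<bar> \<le> (u + 1) * (u + 1) / \<sigma>\<^sup>2"
          by (simp add: divide_right_mono)
        then have "\<bar>z - (x - \<alpha> * z) * (x + \<alpha> * z) / \<sigma>\<^sup>2\<bar> \<le> 1 + (u + 1) * (u + 1) / \<sigma>\<^sup>2"
          using xz by linarith
        then show ?thesis using sigma_pos by (simp add: divide_right_mono)
      qed
      have "0 \<le> E / (s * r ^ 5)" using E s r by simp
      then have "\<bar>E / (s * r ^ 5)\<bar> \<le> C * z" using div[of 5] by simp
      then have "\<bar>conga_kernel_dx \<alpha> x z\<bar> \<le> (1 + (u + 1) * (u + 1) / \<sigma>\<^sup>2) / (2 * \<sigma>) * (C * z)"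
        unfolding eq by (rule mult_mono[OF le]) (use sigma_pos x in auto)
      then show ?thesis by (simp add: C2_def mult_ac)
    qed
    have 3: "gauss_density \<alpha> x z \<le> C3 * z"
    proof -
      have "gauss_density \<alpha> x z = (E / (s * r ^ 1)) / \<sigma>"
        unfolding gauss_density_def density_standardized[OF xz(2)] \<sigma>_def[symmetric] s_def[symmetric] E_def[symmetric] r(3) by simp
      also have "\<dots> \<le> (C * z) / \<sigma>" by (rule divide_right_mono) (use div[of 1] sigma_pos in auto)
      finally show ?thesis by (simp add: C3_def)
    qed
    have 4: "gauss_tail \<alpha> x z \<le> C * z" if "\<alpha> * z \<le> x"
    proof -
      have "standardized \<alpha> x z \<ge> 0" unfolding standardized_def using that sigma_pos r(1,3) by (simp add: \<sigma>_def)
      from normal_tail_upper[OF this] have "gauss_tail \<alpha> x z \<le> E"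
        using xz standardized_sq[OF xz(2), of x] by (simp add: gauss_tail_def E_def)
      also have "\<dots> \<le> C * (z * (z^3))" using E by (simp add: eval_nat_numeral)
      also have "\<dots> \<le> C * (z * 1)" using C xz by (intro mult_left_mono) (auto simp: power_le_one)
      finally show ?thesis by simp
    qed
    from 1 2 3 4 show ?thesis by blast
  qed
  define D where "D = C + C1 + C2 + C3"
  have D: "C1 * z \<le> D * z" "C2 * z \<le> D * z" "C3 * z \<le> D * z" "C * z \<le> D * z" if "z > 0" for z
    using that nn C by (auto simp: D_def intro!: mult_right_mono)
  show ?thesis
  proof (intro exI[of _ D] ballI allI impI)
    fix x z :: real assume "x \<in> {l..u}" "0 < z" "z \<le> 1"
    from main[OF this] D[OF this(2)]
    show "\<bar>conga_kernel \<alpha> x z\<bar> \<le> D * z \<and> \<bar>conga_kernel_dx \<alpha> x z\<bar> \<le> D * z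
      \<and> gauss_density \<alpha> x z \<le> D * z \<and> (\<alpha> * z \<le> x \<longrightarrow> gauss_tail \<alpha> x z \<le> D * z)" by linarith
  qed
qed

lemma kernel_continuous:
  assumes x: "0 < l" "l \<le> u"
  shows "continuous_on ({l..u} \<times> {0..T}) (\<lambda>(x, z). conga_kernel \<alpha> x z)"
    and "continuous_on ({l..u} \<times> {0..T}) (\<lambda>(x, z). conga_kernel_dx \<alpha> x z)"
proof -
  obtain C where C: "\<And>x z. x \<in> {l..u} \<Longrightarrow> 0 < z \<Longrightarrow> z \<le> 1 \<Longrightarrow> \<bar>conga_kernel \<alpha> x z\<bar> \<le> C * z \<and> \<bar>conga_kernel_dx \<alpha> x z\<bar> \<le> C * z"
    using kernels_small_time[OF x] by blast
  have s: "conga_sigma \<alpha> \<noteq> 0" using sigma_pos by (simp add: \<sigma>_def)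
  show "continuous_on ({l..u} \<times> {0..T}) (\<lambda>(x, z). conga_kernel \<alpha> x z)"
    by (rule continuous_on_at_zero_time[where C=C])
       (use C s in \<open>auto simp: conga_kernel_def case_prod_unfold intro!: continuous_intros\<close>)
  show "continuous_on ({l..u} \<times> {0..T}) (\<lambda>(x, z). conga_kernel_dx \<alpha> x z)"
    by (rule continuous_on_at_zero_time[where C=C])
       (use C s in \<open>auto simp: conga_kernel_dx_def case_prod_unfold intro!: continuous_intros\<close>)
qed

lemma kernel_continuous_time:
  assumes x: "0 < x"
  shows "continuous_on {0..T} (conga_kernel \<alpha> x)" "continuous_on {0..T} (conga_kernel_dx \<alpha> x)"
proof -
  have c: "continuous_on {0..T} (\<lambda>z. (x, z))" by (intro continuous_intros)
  show "continuous_on {0..T} (conga_kernel \<alpha> x)"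
    using continuous_on_compose2[OF kernel_continuous(1)[OF x order_refl] c, of T] by auto
  show "continuous_on {0..T} (conga_kernel_dx \<alpha> x)"
    using continuous_on_compose2[OF kernel_continuous(2)[OF x order_refl] c, of T] by auto
qed

lemma gauss_continuous_time:
  assumes x: "0 < x"
  shows "continuous_on {0..T} (gauss_tail \<alpha> x)" "continuous_on {0..T} (gauss_density \<alpha> x)"
proof -
  obtain C where C: "\<And>z. 0 < z \<Longrightarrow> z \<le> 1 \<Longrightarrow> gauss_density \<alpha> x z \<le> C * z"
      "\<And>z. 0 < z \<Longrightarrow> z \<le> 1 \<Longrightarrow> \<alpha> * z \<le> x \<Longrightarrow> gauss_tail \<alpha> x z \<le> C * z"
    using kernels_small_time[OF x order_refl] by auto
  have lim: "((\<lambda>z. C * z) \<longlongrightarrow> 0) (at 0 within {0..T})"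
    by (rule tendsto_eq_intros refl | simp)+
  have small: "eventually (\<lambda>z. \<alpha> * z < x) (at 0 within {0..T})" "eventually (\<lambda>z. z < 1) (at 0 within {0..T})"
  proof -
    have "((\<lambda>z. \<alpha> * z) \<longlongrightarrow> 0) (at 0 within {0..T})" "((\<lambda>z. z) \<longlongrightarrow> (0::real)) (at 0 within {0..T})"
      by (rule tendsto_eq_intros refl | simp)+
    then show "eventually (\<lambda>z. \<alpha> * z < x) (at 0 within {0..T})" "eventually (\<lambda>z. z < 1) (at 0 within {0..T})"
      using x by (auto intro: order_tendstoD)
  qed
  have inside: "eventually (\<lambda>z. z \<in> {0..T}) (at 0 within {0..T})" by (auto simp: eventually_at_filter)
  have tail0: "(gauss_tail \<alpha> x \<longlongrightarrow> gauss_tail \<alpha> x 0) (at 0 within {0..T})"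
  proof -
    have "eventually (\<lambda>z. norm (gauss_tail \<alpha> x z) \<le> C * z) (at 0 within {0..T})"
      using small inside
    proof eventually_elim
      case (elim z)
      show ?case using C(2)[of z] elim normal_tail_nonneg by (cases "z = 0") (auto simp: gauss_tail_def)
    qed
    then show ?thesis using Lim_null_comparison[OF _ lim, of "gauss_tail \<alpha> x"] by (simp add: gauss_tail_def)
  qed
  have dens0: "(gauss_density \<alpha> x \<longlongrightarrow> gauss_density \<alpha> x 0) (at 0 within {0..T})"
  proof -
    have nn: "gauss_density \<alpha> x z \<ge> 0" if "z \<ge> 0" for z using sigma_pos that by (simp add: gauss_density_def \<sigma>_def)
    have "eventually (\<lambda>z. norm (gauss_density \<alpha> x z) \<le> C * z) (at 0 within {0..T})"
      using small inside
    proof eventually_elim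
      case (elim z)
      show ?case using C(1)[of z] elim nn[of z] by (cases "z = 0") (auto simp: gauss_density_def)
    qed
    then show ?thesis using Lim_null_comparison[OF _ lim, of "gauss_density \<alpha> x"] by (simp add: gauss_density_def)
  qed
  have "(f \<longlongrightarrow> f z) (at z within {0..T})"
    if "(f \<longlongrightarrow> f 0) (at 0 within {0..T})" "\<And>z. z > 0 \<Longrightarrow> isCont f z" "z \<in> {0..T}" for f :: "real \<Rightarrow> real" and z
    using that by (cases "z = 0") (auto simp: isCont_def intro: tendsto_within_subset[OF _ subset_UNIV])
  then show "continuous_on {0..T} (gauss_tail \<alpha> x)" "continuous_on {0..T} (gauss_density \<alpha> x)"
    unfolding continuous_on_def
    using tail0 dens0 DERIV_isCont[OF gauss_tail_deriv_z] DERIV_isCont[OF gauss_density_deriv_z] by blast+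
qed

lemma cont_conga_eq_integral:
  fixes w :: "real \<Rightarrow> real ^ 2"
  assumes contw: "continuous_on {0..} w" and x: "0 < x" and t: "0 \<le> t"
  shows "cont_conga \<alpha> w x t = integral {0..t} (\<lambda>z. conga_kernel \<alpha> x z *\<^sub>R w (t - z))"
proof -
  have "continuous_on {0..t} (\<lambda>z. w (t - z))"
    by (rule continuous_on_compose2[OF contw]) (auto intro!: continuous_intros)
  then have "continuous_on {0..t} (\<lambda>z. conga_kernel \<alpha> x z *\<^sub>R w (t - z))"
    by (intro continuous_intros kernel_continuous_time x)
  then have "set_integrable lborel {0..t} (\<lambda>z. conga_kernel \<alpha> x z *\<^sub>R w (t - z))"
    by (rule borel_integrable_atLeastAtMost')
  then have "set_integrable lborel {0<..<t} (\<lambda>z. conga_kernel \<alpha> x z *\<^sub>R w (t - z))"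
    by (rule set_integrable_subset) auto
  from set_borel_integral_eq_integral(2)[OF this]
  show ?thesis unfolding cont_conga_def by (simp add: integral_open_interval_real)
qed

text \<open>
  The derivative may be taken under the integral sign, because \<open>conga_kernel_dx\<close> is continuous up to
  time 0, uniformly for \<open>x\<close> in a neighbourhood of the given point that stays away from 0.
\<close>

lemma cont_conga_dx_eq_integral:
  fixes w :: "real \<Rightarrow> real ^ 2"
  assumes contw: "continuous_on {0..} w" and x: "0 < x" and t: "0 \<le> t"
  shows "cont_conga_dx \<alpha> w x t = integral {0..t} (\<lambda>z. conga_kernel_dx \<alpha> x z *\<^sub>R w (t - z))"
proof -
  define U where "U = {x/2..2*x}"
  have cw: "continuous_on {0..t} (\<lambda>z. w (t - z))"
    by (rule continuous_on_compose2[OF contw]) (auto intro!: continuous_intros)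
  have cw2: "continuous_on (U \<times> {0..t}) (\<lambda>p. w (t - snd p))"
    by (rule continuous_on_compose2[OF cw]) (auto intro!: continuous_intros)
  have "((\<lambda>y. integral (cbox 0 t) (\<lambda>z. conga_kernel \<alpha> y z *\<^sub>R w (t - z))) has_vector_derivative
      integral (cbox 0 t) (\<lambda>z. conga_kernel_dx \<alpha> x z *\<^sub>R w (t - z))) (at x within U)"
  proof (rule leibniz_rule_vector_derivative)
    fix y z assume yz: "y \<in> U" "z \<in> cbox 0 t"
    have "((\<lambda>y. conga_kernel \<alpha> y z) has_real_derivative conga_kernel_dx \<alpha> y z) (at y within U)"
      using conga_kernel_deriv_x[of z y] yz by (auto intro: has_field_derivative_at_within)
    then show "((\<lambda>y. conga_kernel \<alpha> y z *\<^sub>R w (t - z)) has_vector_derivative conga_kernel_dx \<alpha> y z *\<^sub>R w (t - z)) (at y within U)"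
      by (auto intro!: derivative_eq_intros simp: has_real_derivative_iff_has_vector_derivative)
  next
    fix y assume "y \<in> U"
    then have "y > 0" using x by (auto simp: U_def)
    then show "(\<lambda>z. conga_kernel \<alpha> y z *\<^sub>R w (t - z)) integrable_on cbox 0 t"
      using cw by (auto intro!: integrable_continuous_real continuous_intros kernel_continuous_time)
  next
    show "continuous_on (U \<times> cbox 0 t) (\<lambda>(y, z). conga_kernel_dx \<alpha> y z *\<^sub>R w (t - z))"
      using kernel_continuous(2)[of "x/2" "2*x" t] x cw2
      by (auto simp: case_prod_unfold U_def intro!: continuous_intros)
  qed (use x in \<open>auto simp: U_def\<close>)
  moreover have "at x within U = at x"
    by (rule at_within_interior) (use x in \<open>auto simp: U_def\<close>)
  ultimately have D: "((\<lambda>y. integral {0..t} (\<lambda>z. conga_kernel \<alpha> y z *\<^sub>R w (t - z))) has_vector_derivative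
      integral {0..t} (\<lambda>z. conga_kernel_dx \<alpha> x z *\<^sub>R w (t - z))) (at x)" by simp
  have "((\<lambda>y. cont_conga \<alpha> w y t) has_vector_derivative
      integral {0..t} (\<lambda>z. conga_kernel_dx \<alpha> x z *\<^sub>R w (t - z))) (at x)"
    by (rule has_vector_derivative_transform_within_open[OF D, of "{0<..}"])
       (use x in \<open>auto simp: cont_conga_eq_integral[OF contw _ t]\<close>)
  then show ?thesis unfolding cont_conga_dx_def by (rule vector_derivative_at)
qed

lemma cont_conga_grid_limit:
  fixes w :: "real \<Rightarrow> real ^ 2"
  assumes contw: "continuous_on {0..} w" and w0: "w 0 = 0" and x: "0 < x"
  shows "(\<lambda>N. grid_sum w n (Suc N) (gauss_tail \<alpha> x)) \<longlonglongrightarrow> cont_conga \<alpha> w x (real n)"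
  unfolding cont_conga_eq_integral[OF contw x of_nat_0_le_iff]
proof (rule grid_sum_tendsto_integral[OF gauss_continuous_time(1)[OF x] _ kernel_continuous_time(1)[OF x] _ contw w0])
  show "(gauss_tail \<alpha> x has_real_derivative conga_kernel \<alpha> x z) (at z)" if "0 < z" for z
    by (rule gauss_tail_deriv_z[OF that])
qed (simp add: gauss_tail_def)

lemma cont_conga_dx_grid_limit:
  fixes w :: "real \<Rightarrow> real ^ 2"
  assumes contw: "continuous_on {0..} w" and w0: "w 0 = 0" and x: "0 < x"
  shows "(\<lambda>N. grid_sum w n (Suc N) (\<lambda>z. - gauss_density \<alpha> x z)) \<longlonglongrightarrow> cont_conga_dx \<alpha> w x (real n)"
  unfolding cont_conga_dx_eq_integral[OF contw x of_nat_0_le_iff]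
proof (rule grid_sum_tendsto_integral[OF continuous_on_minus[OF gauss_continuous_time(2)[OF x]] _ kernel_continuous_time(2)[OF x] _ contw w0])
  fix z :: real assume "0 < z"
  from DERIV_minus[OF gauss_density_deriv_z[OF this, of x]]
  show "((\<lambda>z. - gauss_density \<alpha> x z) has_real_derivative conga_kernel_dx \<alpha> x z) (at z)" by simp
qed (simp add: gauss_density_def)

end

section \<open>Local limit theorem for the binomial distribution\<close>

text \<open>
  The characteristic functions of one Bernoulli step and of the normal law with the same mean and
  variance. They agree to second order at 0, and this is what the local limit theorem rests on.
\<close>

definition bernoulli_char :: "real \<Rightarrow> real \<Rightarrow> complex" where
  "bernoulli_char \<alpha> \<theta> = complex_of_real (1 - \<alpha>) + complex_of_real \<alpha> * iexp \<theta>"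

definition gauss_char :: "real \<Rightarrow> real \<Rightarrow> complex" where
  "gauss_char \<alpha> \<theta> = iexp (\<alpha> * \<theta>) * complex_of_real (exp (- ((conga_sigma \<alpha>)\<^sup>2 * \<theta>\<^sup>2 / 2)))"

definition binomial_mass :: "real \<Rightarrow> nat \<Rightarrow> nat \<Rightarrow> real" where
  "binomial_mass \<alpha> k m = binomial_tail \<alpha> k m - binomial_tail \<alpha> (Suc k) m"

lemma integral_iexp_period:
  fixes k :: int
  shows "integral {-pi..pi} (\<lambda>\<theta>. iexp (- (of_int k * \<theta>))) = (if k = 0 then complex_of_real (2 * pi) else 0)"
proof (cases "k = 0")
  case True
  then show ?thesis by (simp add: scaleR_conv_of_real)
next
  case False
  define F where "F \<theta> = \<i> * iexp (- (of_int k * \<theta>)) / of_int k" for \<theta>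
  have "((\<lambda>\<theta>. iexp (- (of_int k * \<theta>))) has_integral F pi - F (-pi)) {-pi..pi}"
  proof (rule fundamental_theorem_of_calculus)
    fix x :: real
    have "((\<lambda>\<theta>. exp (- (\<i> * of_int k) * complex_of_real \<theta>)) has_vector_derivative - (\<i> * of_int k) * exp (- (\<i> * of_int k) * complex_of_real x)) (at x within {-pi..pi})"
      by (rule has_vector_derivative_real_field) (auto intro!: derivative_eq_intros)
    then have "((\<lambda>\<theta>. (\<i> / of_int k) * exp (- (\<i> * of_int k) * complex_of_real \<theta>)) has_vector_derivative 
       (\<i> / of_int k) * (- (\<i> * of_int k) * exp (- (\<i> * of_int k) * complex_of_real x))) (at x within {-pi..pi})"
      by (rule has_vector_derivative_mult_right)
    then show "(F has_vector_derivative iexp (- (of_int k * x))) (at x within {-pi..pi})"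
      using False unfolding F_def[abs_def] by (simp add: field_simps)
  qed simp
  moreover have "F pi = F (-pi)"
  proof -
    have "exp (\<i> * (of_int k * complex_of_real pi)) = exp (- (\<i> * (of_int k * complex_of_real pi)))"
    proof -
      have "exp (\<i> * (of_int k * complex_of_real pi)) = exp (- (\<i> * (of_int k * complex_of_real pi)) + of_int (2 * k) * complex_of_real pi * \<i>)"
        by (rule arg_cong[where f=exp]) (simp add: algebra_simps)
      also have "\<dots> = exp (- (\<i> * (of_int k * complex_of_real pi)))"
        unfolding exp_add using exp_2pi_1_int[of k] by (simp add: mult_ac)
      finally show ?thesis .
    qed
    then show ?thesis by (simp add: F_def)
  qed
  ultimately show ?thesis using False by (simp add: integral_unique)
qed

lemma continuous_bernoulli_char: "continuous_on S (\<lambda>\<theta>. bernoulli_char \<alpha> \<theta> ^ m * iexp (- (x * \<theta>)))"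
  unfolding bernoulli_char_def by (intro continuous_intros)

text \<open>
  Fourier inversion on the integers. Multiplication by the Bernoulli characteristic function acts on
  the inverted coefficients as the recursion of the point masses. Integer indices \<open>k\<close> are used so that the
  step from \<open>k\<close> to \<open>k - 1\<close> is always possible; the masses at negative indices are 0.
\<close>

lemma binomial_mass_fourier:
  "integral {-pi..pi} (\<lambda>\<theta>. bernoulli_char \<alpha> \<theta> ^ m * iexp (- (of_int k * \<theta>)))
    = complex_of_real (2 * pi * (if k < 0 then 0 else binomial_mass \<alpha> (nat k) m))"
proof (induction m arbitrary: k)
  case 0
  have "binomial_mass \<alpha> j 0 = (if j = 0 then 1 else 0)" for j
    by (cases j) (auto simp: binomial_mass_def)
  then show ?case using integral_iexp_period[of k] by auto
next
  case (Suc m)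
  have int: "(\<lambda>\<theta>. bernoulli_char \<alpha> \<theta> ^ m * iexp (- (of_int j * \<theta>))) integrable_on {-pi..pi}" for j
    by (rule integrable_continuous_real[OF continuous_bernoulli_char])
  have shift: "iexp \<theta> * iexp (- (of_int k * \<theta>)) = iexp (- (of_int (k - 1) * \<theta>))" for \<theta>
    unfolding exp_add[symmetric] by (rule arg_cong[where f=exp]) (simp add: algebra_simps)
  have "bernoulli_char \<alpha> \<theta> ^ Suc m * iexp (- (of_int k * \<theta>)) =
     complex_of_real (1 - \<alpha>) * (bernoulli_char \<alpha> \<theta> ^ m * iexp (- (of_int k * \<theta>))) +
     complex_of_real \<alpha> * (bernoulli_char \<alpha> \<theta> ^ m * iexp (- (of_int (k - 1) * \<theta>)))" for \<theta>
    unfolding shift[symmetric] power_Suc by (subst (1) bernoulli_char_def) (simp add: algebra_simps)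
  then have "integral {-pi..pi} (\<lambda>\<theta>. bernoulli_char \<alpha> \<theta> ^ Suc m * iexp (- (of_int k * \<theta>)))
    = complex_of_real (1 - \<alpha>) * integral {-pi..pi} (\<lambda>\<theta>. bernoulli_char \<alpha> \<theta> ^ m * iexp (- (of_int k * \<theta>)))
    + complex_of_real \<alpha> * integral {-pi..pi} (\<lambda>\<theta>. bernoulli_char \<alpha> \<theta> ^ m * iexp (- (of_int (k - 1) * \<theta>)))"
    using int by (simp only: integral_add integral_mult_right integrable_on_mult_right)
  also have "\<dots> = complex_of_real (2 * pi * (if k < 0 then 0 else binomial_mass \<alpha> (nat k) (Suc m)))"
  proof (cases "nat k")
    case 0
    then show ?thesis
      unfolding Suc.IH of_real_mult[symmetric] of_real_add[symmetric]
      by (intro arg_cong[where f=complex_of_real]) (auto simp: binomial_mass_def algebra_simps)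
  next
    case nat_k: (Suc j)
    then have k: "\<not> k < 0" "\<not> k - 1 < 0" "nat (k - 1) = j" by auto
    then show ?thesis
      unfolding Suc.IH of_real_mult[symmetric] of_real_add[symmetric] nat_k
      by (intro arg_cong[where f=complex_of_real]) (auto simp: binomial_mass_def algebra_simps)
  qed
  finally show ?case .
qed

lemma norm_power_diff_le:
  fixes z w :: complex
  assumes "norm z \<le> r" "norm w \<le> r"
  shows "norm (z ^ Suc m - w ^ Suc m) \<le> real (Suc m) * r ^ m * norm (z - w)"
proof (induction m)
  case (Suc m)
  have r: "r \<ge> 0" using assms(1) norm_ge_zero order.trans by blast
  have "z ^ Suc (Suc m) - w ^ Suc (Suc m) = z * (z ^ Suc m - w ^ Suc m) + (z - w) * w ^ Suc m"
    by (simp add: algebra_simps)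
  then have "norm (z ^ Suc (Suc m) - w ^ Suc (Suc m)) \<le> norm z * norm (z ^ Suc m - w ^ Suc m) + norm (z - w) * norm w ^ Suc m"
    by (metis norm_triangle_ineq norm_mult norm_power)
  also have "\<dots> \<le> r * (real (Suc m) * r ^ m * norm (z - w)) + norm (z - w) * r ^ Suc m"
    using assms r by (intro add_mono mult_mono Suc.IH power_mono) auto
  also have "\<dots> = real (Suc (Suc m)) * r ^ Suc m * norm (z - w)"
    by (simp add: algebra_simps)
  finally show ?case .
qed simp

text \<open>
  The upper bound follows from \<open>exp t \<ge> 1 + t + t\<^sup>2 / 2\<close>, because
  \<open>(1 - t + t\<^sup>2 / 2) (1 + t + t\<^sup>2 / 2) = 1 + t^4 / 4\<close> is at least 1.
\<close>

lemma exp_minus_bounds: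
  fixes t :: real
  assumes "t \<ge> 0"
  shows "\<bar>exp (- t) - (1 - t)\<bar> \<le> t\<^sup>2 / 2"
proof -
  have lo: "1 - t \<le> exp (- t)" using exp_ge_add_one_self[of "-t"] by simp
  have e: "1 + t + t\<^sup>2 / 2 \<le> exp t" by (rule exp_lower_Taylor_quadratic[OF assms])
  have p: "0 < 1 + t + t\<^sup>2 / 2" using assms by (simp add: add_pos_nonneg)
  have nn: "0 \<le> 1 - t + t\<^sup>2 / 2"
  proof -
    have "1 - t + t\<^sup>2 / 2 = ((1 - t)\<^sup>2 + 1) / 2" by (simp add: power2_eq_square field_simps)
    moreover have "0 \<le> ((1 - t)\<^sup>2 + 1) / 2" by simp
    ultimately show ?thesis by (simp only:)
  qed
  have "1 \<le> (1 - t + t\<^sup>2 / 2) * (1 + t + t\<^sup>2 / 2)"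
  proof -
    have "(1 - t + t\<^sup>2 / 2) * (1 + t + t\<^sup>2 / 2) = 1 + (t\<^sup>2)\<^sup>2 / 4" by (simp add: power2_eq_square field_simps)
    then show ?thesis by simp
  qed
  also have "\<dots> \<le> (1 - t + t\<^sup>2 / 2) * exp t" using e nn by (rule mult_left_mono)
  finally have "1 / exp t \<le> 1 - t + t\<^sup>2 / 2" by (simp add: pos_divide_le_eq)
  then have "exp (- t) \<le> 1 - t + t\<^sup>2 / 2" by (simp add: exp_minus inverse_eq_divide)
  with lo show ?thesis by (auto simp: abs_if)
qed

lemma iexp_taylor2: "cmod (iexp x - (1 + \<i> * complex_of_real x - complex_of_real (x\<^sup>2 / 2))) \<le> \<bar>x\<bar> ^ 3 / 6"
proof -
  have "(\<Sum>k\<le>2. (\<i> * complex_of_real x) ^ k / fact k) = 1 + \<i> * complex_of_real x - complex_of_real (x\<^sup>2 / 2)"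
  proof -
    have "(\<i> * complex_of_real x)\<^sup>2 = - complex_of_real (x\<^sup>2)" by (simp add: power_mult_distrib)
    moreover have "{..2::nat} = {0, 1, 2}" by auto
    ultimately show ?thesis by simp
  qed
  then show ?thesis using iexp_approx1[of x 2] by (simp add: eval_nat_numeral)
qed

text \<open>
  With \<open>x = |\<theta>| / 2 \<le> 2\<close>, Taylor expansion gives \<open>sin x \<ge> x (1 - x\<^sup>2 / 6) \<ge> x / 3\<close>, and
  \<open>1 - cos \<theta>\<close> is twice the square of the sine. The constant is not optimal; any positive
  one gives Gaussian decay of the Bernoulli characteristic function on \<open>[- pi, pi]\<close>.
\<close>

lemma one_minus_cos_ge:
  assumes "\<bar>\<theta>\<bar> \<le> pi"
  shows "1 - cos \<theta> \<ge> \<theta>\<^sup>2 / 18"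
proof -
  define x where "x = \<bar>\<theta>\<bar> / 2"
  have x: "0 \<le> x" "x \<le> 2" using assms pi_less_4 by (auto simp: x_def)
  have "\<bar>Im (iexp x - (1 + \<i> * complex_of_real x - complex_of_real (x\<^sup>2 / 2)))\<bar> \<le> \<bar>x\<bar> ^ 3 / 6"
    using abs_Im_le_cmod iexp_taylor2 order.trans by blast
  then have "\<bar>sin x - x\<bar> \<le> x ^ 3 / 6" using x by (simp add: Im_exp)
  moreover have "x ^ 3 \<le> 4 * x"
  proof -
    have "x\<^sup>2 \<le> 2\<^sup>2" using x by (intro power_mono) auto
    then have "x * x\<^sup>2 \<le> x * 4" using x by (intro mult_left_mono) auto
    then show ?thesis by (simp add: power3_eq_cube power2_eq_square)
  qed
  ultimately have "x / 3 \<le> sin x" by linarith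
  then have "(x / 3)\<^sup>2 \<le> (sin x)\<^sup>2" using x by (intro power_mono) auto
  moreover have "cos (2 * x) = 1 - 2 * (sin x)\<^sup>2" by (rule cos_double_sin)
  moreover have "cos (2 * x) = cos \<theta>" by (simp add: x_def)
  moreover have "(x / 3)\<^sup>2 = \<theta>\<^sup>2 / 36" by (simp add: x_def power_divide)
  ultimately show ?thesis by linarith
qed

context conga_rate
begin

lemma norm_bernoulli_char:
  assumes "\<bar>\<theta>\<bar> \<le> pi"
  shows "norm (bernoulli_char \<alpha> \<theta>) \<le> exp (- (\<sigma>\<^sup>2 / 18 * \<theta>\<^sup>2))"
proof -
  have "(norm (bernoulli_char \<alpha> \<theta>))\<^sup>2 = (1 - \<alpha> + \<alpha> * cos \<theta>)\<^sup>2 + (\<alpha> * sin \<theta>)\<^sup>2"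
    unfolding cmod_power2 by (simp add: bernoulli_char_def Re_exp Im_exp)
  also have "\<dots> = (1 - \<alpha>)\<^sup>2 + 2 * (1 - \<alpha>) * \<alpha> * cos \<theta> + \<alpha>\<^sup>2 * ((cos \<theta>)\<^sup>2 + (sin \<theta>)\<^sup>2)"
    by (simp add: power2_eq_square algebra_simps del: sin_cos_squared_add3)
  also have "\<dots> = 1 - 2 * \<sigma>\<^sup>2 * (1 - cos \<theta>)"
    unfolding sigma_sq sin_cos_squared_add2 by (simp add: power2_eq_square algebra_simps)
  also have "\<dots> \<le> 1 - 2 * \<sigma>\<^sup>2 * (\<theta>\<^sup>2 / 18)"
    using one_minus_cos_ge[OF assms] by (intro diff_left_mono mult_left_mono) auto
  also have "\<dots> \<le> exp (- (2 * \<sigma>\<^sup>2 * (\<theta>\<^sup>2 / 18)))"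
    using exp_ge_add_one_self[of "- (2 * \<sigma>\<^sup>2 * (\<theta>\<^sup>2 / 18))"] by simp
  also have "\<dots> = (exp (- (\<sigma>\<^sup>2 / 18 * \<theta>\<^sup>2)))\<^sup>2"
    by (simp add: power2_eq_square exp_add[symmetric])
  finally show ?thesis by (rule power2_le_imp_le) simp
qed

lemma norm_gauss_char: "norm (gauss_char \<alpha> \<theta>) \<le> exp (- (\<sigma>\<^sup>2 / 18 * \<theta>\<^sup>2))"
  unfolding gauss_char_def \<sigma>_def[symmetric] by (simp add: norm_mult)

text \<open>
  Both characteristic functions have the second order Taylor polynomial
  \<open>1 + \<i> \<alpha> \<theta> - \<alpha> \<theta>\<^sup>2 / 2\<close>: for the Gaussian one this is the identity
  \<open>\<alpha>\<^sup>2 + \<sigma>\<^sup>2 = \<alpha>\<close>. What remains is of third order on the bounded range \<open>|\<theta>| \<le> pi\<close>.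
\<close>

lemma char_diff_bound:
  assumes "\<bar>\<theta>\<bar> \<le> pi"
  shows "norm (bernoulli_char \<alpha> \<theta> - gauss_char \<alpha> \<theta>) \<le> 2 * \<bar>\<theta>\<bar> ^ 3"
proof -
  define t where "t = \<sigma>\<^sup>2 * \<theta>\<^sup>2 / 2"
  define P where "P x = 1 + \<i> * complex_of_real x - complex_of_real (x\<^sup>2 / 2)" for x
  let ?A = "iexp (\<alpha> * \<theta>)" and ?B = "complex_of_real (exp (- t))"
  have t: "0 \<le> t" by (simp add: t_def)
  have eq: "bernoulli_char \<alpha> \<theta> - gauss_char \<alpha> \<theta> =
     complex_of_real \<alpha> * (iexp \<theta> - P \<theta>) - (?A - P (\<alpha> * \<theta>)) - ?A * complex_of_real (exp (- t) - (1 - t)) + complex_of_real t * (?A - 1)"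
  proof -
    have "complex_of_real \<alpha> * P \<theta> + (complex_of_real (1 - \<alpha>)) = P (\<alpha> * \<theta>) - complex_of_real t"
    proof -
      have "t = (\<alpha> - \<alpha>\<^sup>2) * \<theta>\<^sup>2 / 2" unfolding t_def sigma_sq by (simp add: power2_eq_square algebra_simps)
      then have "complex_of_real t = (complex_of_real \<alpha> - (complex_of_real \<alpha>)\<^sup>2) * (complex_of_real \<theta>)\<^sup>2 / 2"
        by (simp only: of_real_mult of_real_divide of_real_diff of_real_power of_real_numeral)
      then show ?thesis by (simp add: P_def power_mult_distrib field_simps)
    qed
    then show ?thesis unfolding bernoulli_char_def gauss_char_def \<sigma>_def[symmetric] t_def[symmetric]
      by (simp add: algebra_simps)
  qed
  have 1: "norm (complex_of_real \<alpha> * (iexp \<theta> - P \<theta>)) \<le> \<bar>\<theta>\<bar> ^ 3 / 6"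
  proof -
    have "norm (complex_of_real \<alpha> * (iexp \<theta> - P \<theta>)) \<le> 1 * (\<bar>\<theta>\<bar> ^ 3 / 6)"
      unfolding norm_mult using a iexp_taylor2[of \<theta>] unfolding P_def by (intro mult_mono) auto
    then show ?thesis by simp
  qed
  have le: "\<bar>\<alpha> * \<theta>\<bar> \<le> \<bar>\<theta>\<bar>" using a by (simp add: abs_mult mult_left_le_one_le)
  have 2: "norm (?A - P (\<alpha> * \<theta>)) \<le> \<bar>\<theta>\<bar> ^ 3 / 6"
  proof -
    have "\<bar>\<alpha> * \<theta>\<bar> ^ 3 \<le> \<bar>\<theta>\<bar> ^ 3" using le by (intro power_mono) auto
    then show ?thesis using iexp_taylor2[of "\<alpha> * \<theta>"] unfolding P_def by linarith
  qed
  have t1: "t \<le> \<theta>\<^sup>2 / 2" using sigma_sq_le a by (simp add: t_def mult_left_le_one_le)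
  have 3: "norm (?A * complex_of_real (exp (- t) - (1 - t))) \<le> \<bar>\<theta>\<bar> ^ 3 / 2"
  proof -
    have "norm (?A * complex_of_real (exp (- t) - (1 - t))) \<le> t\<^sup>2 / 2"
      using exp_minus_bounds[OF t] by (simp add: norm_mult del: of_real_diff)
    also have "\<dots> \<le> (\<theta>\<^sup>2 / 2)\<^sup>2 / 2" using t t1 by (intro divide_right_mono power_mono) auto
    also have "\<dots> = \<bar>\<theta>\<bar> ^ 3 * (\<bar>\<theta>\<bar> / 8)"
    proof -
      have "\<theta>\<^sup>2 = \<bar>\<theta>\<bar> * \<bar>\<theta>\<bar>" by (simp add: power2_eq_square)
      then show ?thesis by (simp add: eval_nat_numeral)
    qed
    also have "\<dots> \<le> \<bar>\<theta>\<bar> ^ 3 * (1/2)" using assms pi_less_4 by (intro mult_left_mono) auto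
    finally show ?thesis by simp
  qed
  have 4: "norm (complex_of_real t * (?A - 1)) \<le> \<bar>\<theta>\<bar> ^ 3 / 2"
  proof -
    have "norm (?A - 1) \<le> \<bar>\<alpha> * \<theta>\<bar>" using iexp_approx1[of "\<alpha> * \<theta>" 0] by simp
    then have "norm (?A - 1) \<le> \<bar>\<theta>\<bar>" using le by linarith
    then have "norm (complex_of_real t * (?A - 1)) \<le> (\<theta>\<^sup>2 / 2) * \<bar>\<theta>\<bar>"
      unfolding norm_mult using t t1 by (intro mult_mono) auto
    also have "\<dots> = \<bar>\<theta>\<bar> ^ 3 / 2" by (simp add: power3_eq_cube power2_eq_square)
    finally show ?thesis .
  qed
  have tri: "norm (u - v - w + x) \<le> norm u + norm v + norm w + norm x" for u v w x :: complex
    by (smt (verit) norm_triangle_ineq norm_triangle_ineq4)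
  have "norm (bernoulli_char \<alpha> \<theta> - gauss_char \<alpha> \<theta>) \<le> \<bar>\<theta>\<bar> ^ 3 / 6 + \<bar>\<theta>\<bar> ^ 3 / 6 + \<bar>\<theta>\<bar> ^ 3 / 2 + \<bar>\<theta>\<bar> ^ 3 / 2"
    unfolding eq using tri 1 2 3 4 by (meson add_mono order.trans)
  also have "\<dots> \<le> 2 * \<bar>\<theta>\<bar> ^ 3" by simp
  finally show ?thesis .
qed

text \<open>
  A rescaling of the characteristic function of the standard normal law, which is again Gaussian.
\<close>

lemma gauss_density_fourier:
  assumes m: "m > 0"
  shows "integrable lborel (\<lambda>\<theta>. gauss_char \<alpha> \<theta> ^ m * iexp (- (x * \<theta>)))"
    and "(LINT \<theta>|lborel. gauss_char \<alpha> \<theta> ^ m * iexp (- (x * \<theta>))) = complex_of_real (2 * pi * gauss_density \<alpha> x (real m))"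
proof -
  define s where "s = \<sigma> * sqrt (real m)"
  have s: "s > 0" using sigma_pos m by (simp add: s_def)
  define y where "y = standardized \<alpha> x (real m)"
  have ys: "- y * s = \<alpha> * real m - x" unfolding y_def standardized_def \<sigma>_def[symmetric] s_def[symmetric] using s by simp
  define g where "g u = std_normal_density u *\<^sub>R iexp (- y * u)" for u
  have gi: "integrable lborel g"
  proof (rule Bochner_Integration.integrable_bound[where f=std_normal_density])
    show "AE u in lborel. norm (g u) \<le> norm (std_normal_density u)" by (simp add: g_def)
    show "g \<in> borel_measurable lborel" unfolding g_def by measurable
  qed simp
  have G: "(LINT u|lborel. g u) = complex_of_real (exp (- (y\<^sup>2) / 2))"
  proof -
    have "char std_normal_distribution (- y) = (LINT u|std_normal_distribution. iexp (- y * u))"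
      by (simp add: char_def)
    also have "\<dots> = (LINT u|lborel. g u)" unfolding g_def
      by (rule integral_density) auto
    finally show ?thesis by (simp add: char_std_normal_distribution)
  qed
  have pt: "gauss_char \<alpha> \<theta> ^ m * iexp (- (x * \<theta>)) = sqrt (2 * pi) *\<^sub>R g (0 + s * \<theta>)" for \<theta>
  proof -
    have "gauss_char \<alpha> \<theta> ^ m = iexp (real m * (\<alpha> * \<theta>)) * complex_of_real (exp (real m * - (\<sigma>\<^sup>2 * \<theta>\<^sup>2 / 2)))"
      unfolding gauss_char_def \<sigma>_def[symmetric] power_mult_distrib exp_of_nat_mult of_real_power[symmetric]
      by (simp add: exp_of_nat_mult[symmetric] mult_ac)
    then have "gauss_char \<alpha> \<theta> ^ m * iexp (- (x * \<theta>)) =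
       (iexp (real m * (\<alpha> * \<theta>)) * iexp (- (x * \<theta>))) * complex_of_real (exp (real m * - (\<sigma>\<^sup>2 * \<theta>\<^sup>2 / 2)))"
      by simp
    also have "iexp (real m * (\<alpha> * \<theta>)) * iexp (- (x * \<theta>)) = iexp (- y * (s * \<theta>))"
    proof -
      have "- y * (s * \<theta>) = (\<alpha> * real m - x) * \<theta>" unfolding ys[symmetric] by simp
      then show ?thesis unfolding exp_add[symmetric] by (intro arg_cong[where f=exp]) (simp add: algebra_simps)
    qed
    also have "real m * - (\<sigma>\<^sup>2 * \<theta>\<^sup>2 / 2) = - (s * \<theta>)\<^sup>2 / 2"
      by (simp add: s_def power_mult_distrib)
    also have "exp (- (s * \<theta>)\<^sup>2 / 2) = sqrt (2 * pi) * std_normal_density (s * \<theta>)"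
      by (simp add: std_normal_density_def)
    finally show ?thesis by (simp add: g_def scaleR_conv_of_real mult_ac)
  qed
  show "integrable lborel (\<lambda>\<theta>. gauss_char \<alpha> \<theta> ^ m * iexp (- (x * \<theta>)))"
    unfolding pt using lborel_integrable_real_affine[OF gi, of s 0] s by (intro integrable_scaleR_right) auto
  have lin: "(LINT u|lborel. g u) = s *\<^sub>R (LINT \<theta>|lborel. g (0 + s * \<theta>))"
    using lborel_integral_real_affine[of s g 0] s by simp
  have "(LINT \<theta>|lborel. g (0 + s * \<theta>)) = (1 / s) *\<^sub>R complex_of_real (exp (- (y\<^sup>2) / 2))"
    unfolding G[symmetric] lin using s by simp
  then have "(LINT \<theta>|lborel. gauss_char \<alpha> \<theta> ^ m * iexp (- (x * \<theta>))) = complex_of_real (sqrt (2 * pi) * ((1 / s) * exp (- (y\<^sup>2) / 2)))"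
    unfolding pt by (simp add: scaleR_conv_of_real)
  also have "sqrt (2 * pi) * ((1 / s) * exp (- (y\<^sup>2) / 2)) = 2 * pi * gauss_density \<alpha> x (real m)"
  proof -
    have "sqrt (2 * pi) = 2 * pi / sqrt (2 * pi)" using real_sqrt_mult_self[of "2 * pi"] by (simp add: field_simps)
    then have eq: "sqrt (2 * pi) * z = 2 * pi / sqrt (2 * pi) * z" for z by simp
    show ?thesis unfolding eq gauss_density_def std_normal_density_def y_def[symmetric] \<sigma>_def[symmetric] s_def[symmetric]
      by simp
  qed
  finally show "(LINT \<theta>|lborel. gauss_char \<alpha> \<theta> ^ m * iexp (- (x * \<theta>))) = complex_of_real (2 * pi * gauss_density \<alpha> x (real m))" .
qed

text \<open>
  The difference of the two Fourier integrals is bounded by the integral over the whole line of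
  \<open>D m |\<theta>|^3 exp (- c m \<theta>\<^sup>2)\<close>, a third absolute moment of a normal law, which is of order
  \<open>1 / m\<close>. On \<open>|\<theta>| \<le> pi\<close> this dominates the difference of the \<open>m\<close>-th powers, because the
  difference of the bases is of third order and the remaining \<open>m - 1\<close> factors decay. For
  \<open>|\<theta>| > pi\<close>, where only the Gaussian part is present, it dominates because
  \<open>|\<theta>|^3 \<ge> 1\<close>.
\<close>

lemma local_limit_theorem:
  "\<exists>C>0. \<forall>k m. m > 0 \<longrightarrow> \<bar>binomial_mass \<alpha> k m - gauss_density \<alpha> (real k) (real m)\<bar> \<le> C / real m"
proof -
  define c where "c = \<sigma>\<^sup>2 / 18"
  have c: "c > 0" using sigma_pos by (simp add: c_def)
  \<comment> \<open>The factor \<open>exp (c * pi\<^sup>2)\<close> pays for having \<open>m - 1\<close> instead of \<open>m\<close> decaying factors.\<close>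
  define D where "D = 2 * exp (c * pi\<^sup>2)"
  have D: "D \<ge> 1"
  proof -
    have "exp (c * pi\<^sup>2) \<ge> 1" using c by simp
    then show ?thesis unfolding D_def by linarith
  qed
  have main: "\<bar>binomial_mass \<alpha> k m - gauss_density \<alpha> (real k) (real m)\<bar> \<le> (D / c\<^sup>2) / real m" if m: "m > 0" for k m
  proof -
    \<comment> \<open>The standard deviation for which \<open>exp (- c m \<theta>\<^sup>2)\<close> is an unnormalised normal density.\<close>
    define s where "s = 1 / sqrt (2 * (c * real m))"
    have cm: "c * real m > 0" using c m by simp
    have s: "s > 0" using cm by (simp add: s_def)
    have s2: "s\<^sup>2 = 1 / (2 * (c * real m))" using cm by (simp add: s_def power_divide)
    define h where "h \<theta> = (D * real m * (sqrt (2 * pi) * s)) * (normal_density 0 s \<theta> * \<bar>\<theta>\<bar> ^ 3)" for \<theta>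
    have h_eq: "h \<theta> = D * real m * (\<bar>\<theta>\<bar> ^ 3 * exp (- (c * real m * \<theta>\<^sup>2)))" for \<theta>
    proof -
      have "normal_density 0 s \<theta> = exp (- (c * real m * \<theta>\<^sup>2)) / (sqrt (2 * pi) * s)"
      proof -
        have "sqrt (2 * pi * s\<^sup>2) = sqrt (2 * pi) * s" using s by (simp add: real_sqrt_mult)
        moreover have "- (\<theta> - 0)\<^sup>2 / (2 * s\<^sup>2) = - (c * real m * \<theta>\<^sup>2)" by (simp add: s2)
        ultimately show ?thesis unfolding normal_density_def by simp
      qed
      then show ?thesis using s by (simp add: h_def)
    qed
    have mom: "has_bochner_integral lborel (\<lambda>\<theta>. normal_density 0 s \<theta> * \<bar>\<theta>\<bar> ^ 3) (2 * s ^ 3 * sqrt (2 / pi))"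
      using normal_moment_abs_odd[OF s, of 0 1] by simp
    have hi: "integrable lborel h" unfolding h_def
      using mom by (intro integrable_mult_right) (auto simp: has_bochner_integral_iff)
    have hI: "(LINT \<theta>|lborel. h \<theta>) = D / c\<^sup>2 / real m"
    proof -
      have "(LINT \<theta>|lborel. h \<theta>) = (D * real m * (sqrt (2 * pi) * s)) * (2 * s ^ 3 * sqrt (2 / pi))"
        unfolding h_def using mom by (simp add: has_bochner_integral_iff)
      also have "\<dots> = D * real m * (2 * (s\<^sup>2 * s\<^sup>2)) * (sqrt (2 * pi) * sqrt (2 / pi))"
        by (simp add: eval_nat_numeral)
      also have "sqrt (2 * pi) * sqrt (2 / pi) = 2" by (simp add: real_sqrt_mult[symmetric])
      also have "D * real m * (2 * (s\<^sup>2 * s\<^sup>2)) * 2 = D / c\<^sup>2 / real m"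
        unfolding s2 using c m by (simp add: power2_eq_square)
      finally show ?thesis .
    qed
    define f where "f \<theta> = indicator {-pi..pi} \<theta> *\<^sub>R (bernoulli_char \<alpha> \<theta> ^ m * iexp (- (real k * \<theta>)))" for \<theta>
    define g where "g \<theta> = gauss_char \<alpha> \<theta> ^ m * iexp (- (real k * \<theta>))" for \<theta>
    have fs: "set_integrable lborel {-pi..pi} (\<lambda>\<theta>. bernoulli_char \<alpha> \<theta> ^ m * iexp (- (real k * \<theta>)))"
      by (rule borel_integrable_atLeastAtMost'[OF continuous_bernoulli_char])
    have fi: "integrable lborel f" using fs by (simp add: f_def[abs_def] set_integrable_def)
    have fI: "(LINT \<theta>|lborel. f \<theta>) = complex_of_real (2 * pi * binomial_mass \<alpha> k m)"
      using set_borel_integral_eq_integral(2)[OF fs] binomial_mass_fourier[of \<alpha> m "int k"]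
      by (simp add: f_def[abs_def] set_lebesgue_integral_def)
    have gi: "integrable lborel g" and gI: "(LINT \<theta>|lborel. g \<theta>) = complex_of_real (2 * pi * gauss_density \<alpha> (real k) (real m))"
      using gauss_density_fourier[OF m, of "real k"] by (simp_all add: g_def[abs_def])
    have bound: "norm (f \<theta> - g \<theta>) \<le> h \<theta>" for \<theta>
    proof (cases "\<bar>\<theta>\<bar> \<le> pi")
      case True
      obtain m' where m': "m = Suc m'" using m by (cases m) auto
      have "f \<theta> - g \<theta> = (bernoulli_char \<alpha> \<theta> ^ m - gauss_char \<alpha> \<theta> ^ m) * iexp (- (real k * \<theta>))"
        using True by (simp add: f_def g_def algebra_simps abs_le_iff)
      then have "norm (f \<theta> - g \<theta>) = norm (bernoulli_char \<alpha> \<theta> ^ m - gauss_char \<alpha> \<theta> ^ m)"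
        by (simp add: norm_mult)
      also have "\<dots> \<le> real m * exp (- (c * \<theta>\<^sup>2)) ^ m' * norm (bernoulli_char \<alpha> \<theta> - gauss_char \<alpha> \<theta>)"
        unfolding m' c_def using norm_bernoulli_char[OF True] norm_gauss_char by (rule norm_power_diff_le)
      also have "\<dots> \<le> real m * exp (- (c * \<theta>\<^sup>2)) ^ m' * (2 * \<bar>\<theta>\<bar> ^ 3)"
        by (intro mult_left_mono char_diff_bound True) auto
      also have "exp (- (c * \<theta>\<^sup>2)) ^ m' = exp (- (c * real m * \<theta>\<^sup>2)) * exp (c * \<theta>\<^sup>2)"
        unfolding exp_of_nat_mult[symmetric] exp_add[symmetric] m' by (simp add: algebra_simps)
      also have "real m * (exp (- (c * real m * \<theta>\<^sup>2)) * exp (c * \<theta>\<^sup>2)) * (2 * \<bar>\<theta>\<bar> ^ 3)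
          \<le> real m * (exp (- (c * real m * \<theta>\<^sup>2)) * exp (c * pi\<^sup>2)) * (2 * \<bar>\<theta>\<bar> ^ 3)"
      proof -
        have "\<theta>\<^sup>2 \<le> pi\<^sup>2" using True by (simp add: abs_le_square_iff[symmetric])
        then show ?thesis using c by (intro mult_right_mono mult_left_mono) auto
      qed
      also have "\<dots> = h \<theta>" by (simp add: h_eq D_def)
      finally show ?thesis .
    next
      case False
      then have "norm (f \<theta> - g \<theta>) = norm (gauss_char \<alpha> \<theta>) ^ m"
        by (auto simp: f_def g_def norm_mult norm_power indicator_def abs_le_iff)
      also have "\<dots> \<le> exp (- (c * \<theta>\<^sup>2)) ^ m" unfolding c_def by (intro power_mono norm_gauss_char) auto
      also have "\<dots> = exp (- (c * real m * \<theta>\<^sup>2))"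
        unfolding exp_of_nat_mult[symmetric] by (simp add: algebra_simps)
      also have "\<dots> \<le> (D * real m * \<bar>\<theta>\<bar> ^ 3) * exp (- (c * real m * \<theta>\<^sup>2))"
      proof -
        have "1 \<le> \<bar>\<theta>\<bar> ^ 3" using False pi_gt3 by (intro one_le_power) auto
        moreover have "1 \<le> D * real m" using D m mult_mono[of 1 D 1 "real m"] by simp
        ultimately have "1 * 1 \<le> (D * real m) * \<bar>\<theta>\<bar> ^ 3" by (intro mult_mono) auto
        then show ?thesis by (simp add: mult_le_cancel_right1)
      qed
      also have "\<dots> = h \<theta>" by (simp add: h_eq)
      finally show ?thesis .
    qed
    have "2 * pi * \<bar>binomial_mass \<alpha> k m - gauss_density \<alpha> (real k) (real m)\<bar> = norm (complex_of_real (2 * pi * binomial_mass \<alpha> k m) - complex_of_real (2 * pi * gauss_density \<alpha> (real k) (real m)))"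
      unfolding of_real_diff[symmetric] norm_of_real right_diff_distrib[symmetric] abs_mult by simp
    also have "\<dots> = norm (LINT \<theta>|lborel. f \<theta> - g \<theta>)"
      by (simp only: fI gI Bochner_Integration.integral_diff[OF fi gi])
    also have "\<dots> \<le> (LINT \<theta>|lborel. norm (f \<theta> - g \<theta>))" by (rule integral_norm_bound)
    also have "\<dots> \<le> (LINT \<theta>|lborel. h \<theta>)"
      by (rule integral_mono) (use fi gi hi bound in auto)
    finally have "2 * pi * \<bar>binomial_mass \<alpha> k m - gauss_density \<alpha> (real k) (real m)\<bar> \<le> D / c\<^sup>2 / real m"
      unfolding hI .
    moreover have "\<bar>d\<bar> \<le> 2 * pi * \<bar>d\<bar>" for d :: real
      using mult_right_mono[of 1 "2 * pi" "\<bar>d\<bar>"] pi_gt3 by simp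
    ultimately show ?thesis using order.trans by blast
  qed
  have "D / c\<^sup>2 > 0" using D c by simp
  with main show ?thesis by blast
qed

end

section \<open>Exponential tail bounds away from the front\<close>

lemma binomial_tail_nonneg: "0 \<le> \<alpha> \<Longrightarrow> \<alpha> \<le> 1 \<Longrightarrow> 0 \<le> binomial_tail \<alpha> k m"
  by (induction \<alpha> k m rule: binomial_tail.induct) auto

lemma binomial_tail_le_1: "0 \<le> \<alpha> \<Longrightarrow> \<alpha> \<le> 1 \<Longrightarrow> binomial_tail \<alpha> k m \<le> 1"
  by (induction \<alpha> k m rule: binomial_tail.induct) (auto intro: convex_bound_le)

lemma binomial_mass_nonneg:
  assumes "0 \<le> \<alpha>" "\<alpha> \<le> 1"
  shows "0 \<le> binomial_mass \<alpha> k m"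
proof (induction m arbitrary: k)
  case 0
  show ?case by (cases k) (auto simp: binomial_mass_def)
next
  case (Suc m)
  show ?case
  proof (cases k)
    case 0
    then have "binomial_mass \<alpha> k (Suc m) = (1 - \<alpha>) * binomial_mass \<alpha> 0 m"
      by (simp add: binomial_mass_def algebra_simps)
    then show ?thesis using assms Suc by simp
  next
    case (Suc j)
    then have "binomial_mass \<alpha> k (Suc m) = (1 - \<alpha>) * binomial_mass \<alpha> (Suc j) m + \<alpha> * binomial_mass \<alpha> j m"
      by (simp add: binomial_mass_def algebra_simps)
    then show ?thesis using assms Suc.IH by simp
  qed
qed

text \<open>
  The Chernoff bound, by induction along the recursion: the right-hand side satisfies the same
  recursion with equality.
\<close>

lemma binomial_tail_mgf_bound:
  assumes "0 \<le> \<alpha>" "\<alpha> \<le> 1" "0 \<le> s"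
  shows "binomial_tail \<alpha> k m \<le> exp (- (s * real k)) * (1 - \<alpha> + \<alpha> * exp s) ^ m"
  using assms
proof (induction \<alpha> k m rule: binomial_tail.induct)
  case (1 \<alpha> m)
  have "\<alpha> * 1 \<le> \<alpha> * exp s" using 1 by (intro mult_left_mono) auto
  then show ?case by (simp add: one_le_power)
next
  case (2 \<alpha> k)
  then show ?case by simp
next
  case (3 \<alpha> k m)
  have "(1 - \<alpha>) * binomial_tail \<alpha> (Suc k) m + \<alpha> * binomial_tail \<alpha> k m
     \<le> (1 - \<alpha>) * (exp (- (s * real (Suc k))) * (1 - \<alpha> + \<alpha> * exp s) ^ m) + \<alpha> * (exp (- (s * real k)) * (1 - \<alpha> + \<alpha> * exp s) ^ m)"
    using 3 by (intro add_mono mult_left_mono) auto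
  also have "exp (- (s * real k)) = exp (- (s * real (Suc k))) * exp s"
    unfolding exp_add[symmetric] by (simp add: algebra_simps)
  finally show ?case by (simp add: algebra_simps)
qed

lemma binomial_cotail_mgf_bound:
  assumes "0 \<le> \<alpha>" "\<alpha> \<le> 1" "0 \<le> s"
  shows "1 - binomial_tail \<alpha> k m \<le> exp (s * real k) * (1 - \<alpha> + \<alpha> * exp (- s)) ^ m"
  using assms
proof (induction \<alpha> k m rule: binomial_tail.induct)
  case (1 \<alpha> m)
  then show ?case by simp
next
  case (2 \<alpha> k)
  then show ?case by simp
next
  case (3 \<alpha> k m)
  have "1 - binomial_tail \<alpha> (Suc k) (Suc m) = (1 - \<alpha>) * (1 - binomial_tail \<alpha> (Suc k) m) + \<alpha> * (1 - binomial_tail \<alpha> k m)"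
    by (simp add: algebra_simps)
  also have "\<dots> \<le> (1 - \<alpha>) * (exp (s * real (Suc k)) * (1 - \<alpha> + \<alpha> * exp (- s)) ^ m) + \<alpha> * (exp (s * real k) * (1 - \<alpha> + \<alpha> * exp (- s)) ^ m)"
    using 3 by (intro add_mono mult_left_mono) auto
  also have "exp (s * real k) = exp (s * real (Suc k)) * exp (- s)"
    unfolding exp_add[symmetric] by (simp add: algebra_simps)
  finally show ?case by (simp add: algebra_simps)
qed

text \<open>
  The exponent \<open>- s r + s\<^sup>2 j\<close> that remains after using \<open>exp s \<le> 1 + s + s\<^sup>2\<close> is minimal at
  \<open>s = r / (2 j)\<close>. The bound is stated in terms of the threshold \<open>j\<close> instead of the number of trials,
  so that it is uniform in all \<open>m\<close> below the front.
\<close>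

lemma binomial_tail_chernoff:
  assumes a: "0 \<le> \<alpha>" "\<alpha> \<le> 1" and r: "0 \<le> r" "r \<le> real j" "0 < j" and le: "\<alpha> * real m \<le> real j - r"
  shows "binomial_tail \<alpha> j m \<le> exp (- (r\<^sup>2 / (4 * real j)))"
proof -
  define s where "s = r / (2 * real j)"
  have s: "0 \<le> s" "s \<le> 1" using r by (auto simp: s_def)
  have e: "1 - \<alpha> + \<alpha> * exp s \<le> exp (\<alpha> * (s + s\<^sup>2))"
  proof -
    have "\<alpha> * exp s \<le> \<alpha> * (1 + s + s\<^sup>2)" using exp_bound[OF s] a by (intro mult_left_mono) auto
    then have "1 - \<alpha> + \<alpha> * exp s \<le> 1 + \<alpha> * (s + s\<^sup>2)" by (simp add: algebra_simps)
    also have "\<dots> \<le> exp (\<alpha> * (s + s\<^sup>2))" by (rule exp_ge_add_one_self)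
    finally show ?thesis .
  qed
  have "binomial_tail \<alpha> j m \<le> exp (- (s * real j)) * (1 - \<alpha> + \<alpha> * exp s) ^ m"
    by (rule binomial_tail_mgf_bound[OF a s(1)])
  also have "\<dots> \<le> exp (- (s * real j)) * exp (\<alpha> * (s + s\<^sup>2)) ^ m"
    using a e by (intro mult_left_mono power_mono) auto
  also have "\<dots> = exp (- (s * real j) + (\<alpha> * real m) * (s + s\<^sup>2))"
    unfolding exp_of_nat_mult[symmetric] exp_add[symmetric] by (simp add: algebra_simps)
  also have "\<dots> \<le> exp (- (r\<^sup>2 / (4 * real j)))"
  proof -
    have "(\<alpha> * real m) * (s + s\<^sup>2) \<le> (real j - r) * (s + s\<^sup>2)" using le s by (intro mult_right_mono) auto
    also have "\<dots> \<le> real j * s - r * s + real j * s\<^sup>2" using r by (simp add: algebra_simps)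
    finally have "- (s * real j) + (\<alpha> * real m) * (s + s\<^sup>2) \<le> real j * s\<^sup>2 - r * s" by (simp add: algebra_simps)
    also have "\<dots> = - (r\<^sup>2 / (4 * real j))" using r(3) by (simp add: s_def field_simps power2_eq_square)
    finally show ?thesis by simp
  qed
  finally show ?thesis .
qed

text \<open>
  The counterpart beyond the front. There \<open>m\<close> is unbounded, but its contribution to the exponent is
  decreasing in \<open>m\<close>, so that the worst case is \<open>\<alpha> m = j + r\<close>.
\<close>

lemma binomial_cotail_chernoff:
  assumes a: "0 \<le> \<alpha>" "\<alpha> \<le> 1" and r: "0 \<le> r" "r \<le> real j" "0 < j" and le: "real j + r \<le> \<alpha> * real m"
  shows "1 - binomial_tail \<alpha> j m \<le> exp (- (r\<^sup>2 / (8 * real j)))"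
proof -
  define s where "s = r / (4 * real j)"
  have s: "0 \<le> s" "s \<le> 1" using r by (auto simp: s_def)
  have e: "1 - \<alpha> + \<alpha> * exp (- s) \<le> exp (- (\<alpha> * (s - s\<^sup>2)))"
  proof -
    have "exp (- s) \<le> 1 - s + s\<^sup>2 / 2" using exp_minus_bounds[OF s(1)] by linarith
    also have "\<dots> \<le> 1 - s + s\<^sup>2" by simp
    finally have "\<alpha> * exp (- s) \<le> \<alpha> * (1 - s + s\<^sup>2)" using a by (intro mult_left_mono) auto
    then have "1 - \<alpha> + \<alpha> * exp (- s) \<le> 1 + - (\<alpha> * (s - s\<^sup>2))" by (simp add: algebra_simps)
    also have "\<dots> \<le> exp (- (\<alpha> * (s - s\<^sup>2)))" by (rule exp_ge_add_one_self)
    finally show ?thesis .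
  qed
  have "1 - binomial_tail \<alpha> j m \<le> exp (s * real j) * (1 - \<alpha> + \<alpha> * exp (- s)) ^ m"
    by (rule binomial_cotail_mgf_bound[OF a s(1)])
  also have "\<dots> \<le> exp (s * real j) * exp (- (\<alpha> * (s - s\<^sup>2))) ^ m"
    using a e by (intro mult_left_mono power_mono) auto
  also have "\<dots> = exp (s * real j - (\<alpha> * real m) * (s - s\<^sup>2))"
    unfolding exp_of_nat_mult[symmetric] exp_add[symmetric] by (simp add: algebra_simps)
  also have "\<dots> \<le> exp (- (r\<^sup>2 / (8 * real j)))"
  proof -
    have ss: "s\<^sup>2 \<le> s" using s by (simp add: power2_eq_square mult_left_le_one_le)
    have "(real j + r) * (s - s\<^sup>2) \<le> (\<alpha> * real m) * (s - s\<^sup>2)" using le ss by (intro mult_right_mono) auto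
    moreover have "(real j + r) * s\<^sup>2 \<le> 2 * real j * s\<^sup>2" using r by (intro mult_right_mono) auto
    ultimately have "s * real j - (\<alpha> * real m) * (s - s\<^sup>2) \<le> 2 * real j * s\<^sup>2 - r * s" by (simp add: algebra_simps)
    also have "\<dots> = - (r\<^sup>2 / (8 * real j))" using r(3) by (simp add: s_def field_simps power2_eq_square)
    finally show ?thesis by simp
  qed
  finally show ?thesis .
qed

lemma abs_times_exp_le_1: "\<bar>y\<bar> * exp (- (y\<^sup>2 / 2)) \<le> (1::real)"
proof -
  have "0 \<le> (\<bar>y\<bar> - 1)\<^sup>2" by simp
  then have "\<bar>y\<bar> \<le> 1 + y\<^sup>2 / 2" by (simp add: power2_eq_square algebra_simps)
  also have "\<dots> \<le> exp (y\<^sup>2 / 2)" by (rule exp_ge_add_one_self)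
  finally show ?thesis by (simp add: exp_minus field_simps)
qed

definition tail_error :: "real \<Rightarrow> nat \<Rightarrow> real \<Rightarrow> real" where
  "tail_error \<alpha> k z = binomial_tail \<alpha> k (nat \<lfloor>z\<rfloor>) - gauss_tail \<alpha> (real k) z"

text \<open>
  The sign is that of \<open>X_{k+2}(n) - X_{k+1}(n)\<close>, in which the increments have minus the point masses as
  coefficients.
\<close>

definition mass_error :: "real \<Rightarrow> nat \<Rightarrow> real \<Rightarrow> real" where
  "mass_error \<alpha> k z = gauss_density \<alpha> (real k) z - binomial_mass \<alpha> k (nat \<lfloor>z\<rfloor>)"

context conga_rate
begin

lemma gauss_density_nonneg: "gauss_density \<alpha> x z \<ge> 0" if "z \<ge> 0"
  using sigma_pos that by (simp add: gauss_density_def \<sigma>_def)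

text \<open>
  The Gaussian counterpart of the Chernoff exponents, again uniform in the time; it uses
  \<open>\<sigma>\<^sup>2 \<le> \<alpha>\<close> to replace the variance \<open>\<sigma>\<^sup>2 z\<close> by \<open>\<alpha> z \<le> x\<close>.
\<close>

lemma gauss_exponent_low:
  assumes z: "z > 0" and r: "0 \<le> r" "r \<le> x" "0 < x" and le: "\<alpha> * z \<le> x - r"
  shows "r\<^sup>2 / (4 * x) \<le> (standardized \<alpha> x z)\<^sup>2 / 2"
proof -
  have "r\<^sup>2 / (4 * x) \<le> r\<^sup>2 / (2 * (\<sigma>\<^sup>2 * z))"
  proof (rule divide_left_mono)
    have "\<sigma>\<^sup>2 * z \<le> \<alpha> * z" using sigma_pos sigma_sq_le z by (intro mult_right_mono) auto
    then show "2 * (\<sigma>\<^sup>2 * z) \<le> 4 * x" using le r by linarith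
  qed (use sigma_pos z r in auto)
  also have "\<dots> \<le> (x - \<alpha> * z)\<^sup>2 / (2 * (\<sigma>\<^sup>2 * z))"
    using le r sigma_pos z by (intro divide_right_mono power_mono) auto
  also have "\<dots> = (standardized \<alpha> x z)\<^sup>2 / 2"
    using standardized_sq[OF z, of x] by (simp add: \<sigma>_def mult_ac)
  finally show ?thesis .
qed

text \<open>
  Beyond the front the variance grows with \<open>z\<close>, but with \<open>s = \<alpha> z - x\<close> the exponent is at least
  \<open>s\<^sup>2 / (2 (s + x))\<close>, which increases with \<open>s\<close>.
\<close>

lemma gauss_exponent_high:
  assumes z: "z > 0" and r: "0 \<le> r" "r \<le> x" "0 < x" and le: "x + r \<le> \<alpha> * z"
  shows "r\<^sup>2 / (4 * x) \<le> (standardized \<alpha> x z)\<^sup>2 / 2"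
proof -
  define s where "s = \<alpha> * z - x"
  have s: "r \<le> s" using le by (simp add: s_def)
  have z_eq: "\<alpha> * z = s + x" by (simp add: s_def)
  have "r\<^sup>2 / (4 * x) \<le> s\<^sup>2 / (2 * (s + x))"
  proof -
    have "r\<^sup>2 * (2 * (s + x)) \<le> s\<^sup>2 * (4 * x)"
    proof -
      have "r\<^sup>2 * s = r * (r * s)" by (simp add: power2_eq_square)
      also have "\<dots> \<le> x * (s * s)" using r s by (intro mult_mono) auto
      finally have 1: "r\<^sup>2 * s \<le> s\<^sup>2 * x" by (simp add: power2_eq_square mult_ac)
      have "r\<^sup>2 * x \<le> s\<^sup>2 * x" using r s by (intro mult_right_mono power_mono) auto
      with 1 show ?thesis by (simp add: algebra_simps)
    qed
    then show ?thesis using r s by (simp add: frac_le_eq divide_le_eq field_simps)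
  qed
  also have "\<dots> \<le> s\<^sup>2 / (2 * (\<sigma>\<^sup>2 * z))"
  proof (rule divide_left_mono)
    have "\<sigma>\<^sup>2 * z \<le> \<alpha> * z" using sigma_pos sigma_sq_le z by (intro mult_right_mono) auto
    then show "2 * (\<sigma>\<^sup>2 * z) \<le> 2 * (s + x)" unfolding z_eq by simp
  qed (use sigma_pos z r s in auto)
  also have "\<dots> = (x - \<alpha> * z)\<^sup>2 / (2 * (\<sigma>\<^sup>2 * z))"
    by (simp add: s_def power2_commute)
  also have "\<dots> = (standardized \<alpha> x z)\<^sup>2 / 2"
    using standardized_sq[OF z, of x] by (simp add: \<sigma>_def mult_ac)
  finally show ?thesis .
qed

text \<open>
  Half of the exponent is spent on the factor \<open>1 / sqrt z\<close>, which is large only for small \<open>z\<close>.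
  There the point \<open>x \<ge> 1\<close> lies at distance at least \<open>1 - \<alpha>\<close> from the mean, and
  \<open>exp (- A / z) \<le> z / A\<close>.
\<close>

lemma gauss_density_le_exp:
  "\<exists>C>0. \<forall>x\<ge>1. \<forall>z>0. gauss_density \<alpha> x z \<le> C * exp (- ((standardized \<alpha> x z)\<^sup>2 / 4))"
proof -
  define A where "A = (1 - \<alpha>)\<^sup>2 / (4 * \<sigma>\<^sup>2)"
  have A: "A > 0" using a sigma_pos by (simp add: A_def)
  define C where "C = (1 + 1 / A) / \<sigma>"
  have C: "C > 0" using A sigma_pos by (simp add: C_def add_pos_pos)
  have "gauss_density \<alpha> x z \<le> C * exp (- ((standardized \<alpha> x z)\<^sup>2 / 4))" if x: "x \<ge> 1" and z: "z > 0" for x z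
  proof -
    define y where "y = standardized \<alpha> x z"
    have key: "exp (- (y\<^sup>2 / 4)) \<le> (1 + 1 / A) * sqrt z"
    proof (cases "z \<ge> 1")
      case True
      have "exp (- (y\<^sup>2 / 4)) \<le> 1 * 1" by simp
      also have "\<dots> \<le> (1 + 1 / A) * sqrt z" using A True by (intro mult_mono) auto
      finally show ?thesis .
    next
      case False
      have "A / z \<le> y\<^sup>2 / 4"
      proof -
        have "\<alpha> * z \<le> \<alpha>" using False a by (simp add: mult_left_le)
        then have "1 - \<alpha> \<le> x - \<alpha> * z" using x by linarith
        then have "(1 - \<alpha>)\<^sup>2 \<le> (x - \<alpha> * z)\<^sup>2" using a by (intro power_mono) auto
        then have "(1 - \<alpha>)\<^sup>2 / (2 * \<sigma>\<^sup>2 * z) \<le> (x - \<alpha> * z)\<^sup>2 / (2 * \<sigma>\<^sup>2 * z)"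
          using sigma_pos z by (intro divide_right_mono) auto
        also have "\<dots> = y\<^sup>2 / 2" using standardized_sq[OF z, of x] by (simp add: \<sigma>_def y_def)
        finally have "(1 - \<alpha>)\<^sup>2 / (2 * \<sigma>\<^sup>2 * z) / 2 \<le> y\<^sup>2 / 2 / 2" by (rule divide_right_mono) simp
        then show ?thesis by (simp add: A_def mult_ac)
      qed
      then have "exp (- (y\<^sup>2 / 4)) \<le> exp (- (A / z))" by simp
      also have "\<dots> \<le> z / A"
      proof -
        have "A / z \<le> exp (A / z)" using exp_ge_add_one_self[of "A/z"] by linarith
        then have "inverse (exp (A / z)) \<le> inverse (A / z)" using A z by (intro le_imp_inverse_le) auto
        then show ?thesis by (simp add: exp_minus)
      qed
      also have "\<dots> \<le> (1 / A) * sqrt z"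
      proof -
        have "z = sqrt z * sqrt z" using z by simp
        also have "\<dots> \<le> 1 * sqrt z" using False z by (intro mult_right_mono) auto
        finally show ?thesis using A by (simp add: divide_right_mono)
      qed
      also have "\<dots> \<le> (1 + 1 / A) * sqrt z" using z by (intro mult_right_mono) auto
      finally show ?thesis .
    qed
    have "gauss_density \<alpha> x z \<le> exp (- (y\<^sup>2 / 2)) / (\<sigma> * sqrt z)"
    proof -
      have "1 \<le> sqrt (2 * pi)" using pi_gt3 by simp
      then have "std_normal_density y \<le> exp (- (y\<^sup>2 / 2))"
        unfolding std_normal_density_def by (simp add: divide_le_eq)
      then show ?thesis unfolding gauss_density_def y_def \<sigma>_def using sigma_pos z
        by (intro divide_right_mono) (auto simp: \<sigma>_def)
    qed
    also have "exp (- (y\<^sup>2 / 2)) = exp (- (y\<^sup>2 / 4)) * exp (- (y\<^sup>2 / 4))"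
      unfolding exp_add[symmetric] by simp
    also have "exp (- (y\<^sup>2 / 4)) * exp (- (y\<^sup>2 / 4)) / (\<sigma> * sqrt z) \<le> ((1 + 1 / A) * sqrt z) * exp (- (y\<^sup>2 / 4)) / (\<sigma> * sqrt z)"
      using key sigma_pos z by (intro divide_right_mono mult_right_mono) auto
    also have "\<dots> = C * exp (- (y\<^sup>2 / 4))" using z by (simp add: C_def)
    finally show ?thesis by (simp add: y_def)
  qed
  with C show ?thesis by blast
qed

text \<open>
  Outside the window both distributions are extreme on the same side: in front of it both tails are
  small, behind it both are close to 1, and the masses are differences of tails. The constant 64 leaves
  room for replacing \<open>R\<close> by \<open>R / 2\<close>, which absorbs both the rounding of \<open>z\<close> to an integer and the
  step from \<open>k\<close> to \<open>k + 1\<close> in the mass.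
\<close>

lemma far_bounds:
  "\<exists>C>0. \<forall>k R z. 4 \<le> R \<longrightarrow> R \<le> real k \<longrightarrow> 0 \<le> z \<longrightarrow> R \<le> \<bar>\<alpha> * z - real k\<bar> \<longrightarrow>
     \<bar>tail_error \<alpha> k z\<bar> \<le> C * exp (- (R\<^sup>2 / (64 * real k))) \<and>
     \<bar>mass_error \<alpha> k z\<bar> \<le> C * exp (- (R\<^sup>2 / (64 * real k)))"
proof -
  obtain C where C: "C > 0" "\<And>x z. x \<ge> 1 \<Longrightarrow> z > 0 \<Longrightarrow> gauss_density \<alpha> x z \<le> C * exp (- ((standardized \<alpha> x z)\<^sup>2 / 4))"
    using gauss_density_le_exp by blast
  have a': "0 \<le> \<alpha>" "\<alpha> \<le> 1" using a by auto
  have "\<bar>tail_error \<alpha> k z\<bar> \<le> (C + 1) * exp (- (R\<^sup>2 / (64 * real k))) \<and>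
     \<bar>mass_error \<alpha> k z\<bar> \<le> (C + 1) * exp (- (R\<^sup>2 / (64 * real k)))"
    if R: "4 \<le> R" "R \<le> real k" and z: "0 \<le> z" and far: "R \<le> \<bar>\<alpha> * z - real k\<bar>" for k R z
  proof -
    define e where "e = exp (- (R\<^sup>2 / (64 * real k)))"
    have e: "e > 0" by (simp add: e_def)
    define m where "m = nat \<lfloor>z\<rfloor>"
    have k: "real k \<ge> 4" "k > 0" using R by auto
    have weaken: "exp (- t) \<le> e" if "R\<^sup>2 / (64 * real k) \<le> t" for t using that by (simp add: e_def)
    have frac: "R\<^sup>2 / (64 * real k) \<le> R\<^sup>2 / d" if "d \<le> 64 * real k" "d > 0" for d
      using that by (intro divide_left_mono) auto
    have frac4: "R\<^sup>2 / (64 * real k) \<le> R\<^sup>2 / (4 * real k) / 2"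
      using frac[of "8 * real k"] k by simp
    have mz: "real m \<le> z" "z - 1 \<le> real m" using z by (auto simp: m_def)
    have F01: "0 \<le> binomial_tail \<alpha> j m" "binomial_tail \<alpha> j m \<le> 1" for j
      using binomial_tail_nonneg binomial_tail_le_1 a' by auto
    have b: "0 \<le> binomial_mass \<alpha> k m" by (rule binomial_mass_nonneg[OF a'])
    have G01: "0 \<le> gauss_tail \<alpha> (real k) z" "gauss_tail \<alpha> (real k) z \<le> 1"
      using normal_tail_nonneg normal_tail_le_1 by (auto simp: gauss_tail_def)
    have q0: "0 \<le> gauss_density \<alpha> (real k) z" by (rule gauss_density_nonneg[OF z])
    have q: "gauss_density \<alpha> (real k) z \<le> C * e" 
      if E: "z > 0 \<Longrightarrow> R\<^sup>2 / (4 * real k) \<le> (standardized \<alpha> (real k) z)\<^sup>2 / 2"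
    proof (cases "z > 0")
      case True
      have "gauss_density \<alpha> (real k) z \<le> C * exp (- ((standardized \<alpha> (real k) z)\<^sup>2 / 4))"
        using C(2)[of "real k" z] k True by simp
      also have "\<dots> \<le> C * e" using C(1) E[OF True] frac4 by (intro mult_left_mono weaken) auto
      finally show ?thesis .
    next
      case False
      then show ?thesis using z C(1) e by (simp add: gauss_density_def)
    qed
    have "\<bar>binomial_tail \<alpha> k m - gauss_tail \<alpha> (real k) z\<bar> \<le> (C + 1) * e \<and>
      \<bar>binomial_mass \<alpha> k m - gauss_density \<alpha> (real k) z\<bar> \<le> (C + 1) * e"
    proof (cases "\<alpha> * z \<le> real k")
      case True
      then have low: "\<alpha> * z \<le> real k - R" using far by linarith
      have "\<alpha> * real m \<le> \<alpha> * z" using mz a by simp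
      then have F: "binomial_tail \<alpha> k m \<le> e"
        using binomial_tail_chernoff[OF a', of R k m] R k low weaken[OF frac[of "4 * real k"]] by fastforce
      then have bm: "binomial_mass \<alpha> k m \<le> e" using F01(1)[of "Suc k"] by (simp add: binomial_mass_def)
      have E: "R\<^sup>2 / (4 * real k) \<le> (standardized \<alpha> (real k) z)\<^sup>2 / 2" if "z > 0"
        by (rule gauss_exponent_low[OF that]) (use R k low in auto)
      have G: "gauss_tail \<alpha> (real k) z \<le> e"
      proof (cases "z > 0")
        case True
        have "standardized \<alpha> (real k) z \<ge> 0"
          using low R True sigma_pos by (simp add: standardized_def \<sigma>_def)
        from normal_tail_upper[OF this] have "gauss_tail \<alpha> (real k) z \<le> exp (- ((standardized \<alpha> (real k) z)\<^sup>2 / 2))"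
          using True by (simp add: gauss_tail_def)
        also have "\<dots> \<le> e" using E[OF True] frac[of "4 * real k"] k by (intro weaken) auto
        finally show ?thesis .
      next
        case False
        then show ?thesis using e by (simp add: gauss_tail_def)
      qed
      have "e \<le> (C + 1) * e" "C * e \<le> (C + 1) * e" using C e by (simp_all add: algebra_simps)
      then show ?thesis using F F01(1)[of k] G G01 bm b q[OF E] q0 by linarith
    next
      case False
      then have high: "real k + R \<le> \<alpha> * z" using far by linarith
      then have z0: "z > 0" using R z by (cases "z = 0") auto
      have "\<alpha> * (z - 1) \<le> \<alpha> * real m" using mz a by simp
      then have am: "real k + R - 1 \<le> \<alpha> * real m" using high a by (simp add: algebra_simps)
      have F: "1 - binomial_tail \<alpha> k m \<le> e"
      proof -
        have "1 - binomial_tail \<alpha> k m \<le> exp (- ((R/2)\<^sup>2 / (8 * real k)))"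
          by (rule binomial_cotail_chernoff[OF a']) (use R k am in auto)
        also have "\<dots> \<le> e" using frac[of "32 * real k"] k by (intro weaken) (simp add: power_divide)
        finally show ?thesis .
      qed
      have bm: "binomial_mass \<alpha> k m \<le> e"
      proof -
        have "1 - binomial_tail \<alpha> (Suc k) m \<le> exp (- ((R/2)\<^sup>2 / (8 * real (Suc k))))"
          by (rule binomial_cotail_chernoff[OF a']) (use R k am in auto)
        also have "\<dots> \<le> e" using frac[of "32 * real (Suc k)"] k by (intro weaken) (simp add: power_divide)
        finally show ?thesis using F01(2)[of k] by (simp add: binomial_mass_def)
      qed
      have E: "R\<^sup>2 / (4 * real k) \<le> (standardized \<alpha> (real k) z)\<^sup>2 / 2"
        by (rule gauss_exponent_high[OF z0]) (use R k high in auto)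
      have G: "1 - gauss_tail \<alpha> (real k) z \<le> e"
      proof -
        have "standardized \<alpha> (real k) z \<le> 0"
          using high R z0 sigma_pos unfolding standardized_def \<sigma>_def[symmetric] by (intro divide_nonpos_pos) auto
        from normal_tail_lower[OF this] have "1 - gauss_tail \<alpha> (real k) z \<le> exp (- ((standardized \<alpha> (real k) z)\<^sup>2 / 2))"
          using z0 by (simp add: gauss_tail_def)
        also have "\<dots> \<le> e" using E frac[of "4 * real k"] k by (intro weaken) auto
        finally show ?thesis .
      qed
      have "e \<le> (C + 1) * e" "C * e \<le> (C + 1) * e" using C e by (simp_all add: algebra_simps)
      then show ?thesis using F F01(2)[of k] G G01 bm b q[OF E] q0 by linarith
    qed
    then show ?thesis by (simp add: m_def e_def tail_error_def mass_error_def abs_minus_commute)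
  qed
  then show ?thesis using C(1) by (intro exI[of _ "C + 1"]) auto
qed

end

section \<open>Comparison near the front\<close>

lemma abs_diff_le_of_deriv_bound:
  fixes f f' :: "real \<Rightarrow> real"
  assumes "l \<le> u" and deriv: "\<And>s. l \<le> s \<Longrightarrow> s \<le> u \<Longrightarrow> (f has_real_derivative f' s) (at s)"
    and bound: "\<And>s. l \<le> s \<Longrightarrow> s \<le> u \<Longrightarrow> \<bar>f' s\<bar> \<le> B" and len: "u - l \<le> 1"
  shows "\<bar>f u - f l\<bar> \<le> B"
proof (cases "l = u")
  case True
  then show ?thesis using bound[of l] abs_ge_zero[of "f' l"] by simp
next
  case False
  then have "l < u" using assms(1) by simp
  from MVT2[OF this deriv] obtain s where s: "l < s" "s < u" "f u - f l = (u - l) * f' s" by blast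
  have "\<bar>f u - f l\<bar> = (u - l) * \<bar>f' s\<bar>" using s by (simp add: abs_mult)
  also have "\<dots> \<le> 1 * B" using s len bound[of s] by (intro mult_mono) auto
  finally show ?thesis by simp
qed

context conga_rate
begin

text \<open>
  The rates at which the Gaussian coefficients vary in time near and beyond the front. The factor
  \<open>x - \<alpha> s\<close> in \<open>conga_kernel_dx\<close> is of the order \<open>sqrt s\<close> of the fluctuations, because
  \<open>|y| exp (- y\<^sup>2 / 2) \<le> 1\<close>; this is where the density gains a factor \<open>1 / sqrt s\<close> over the tail.
\<close>

lemma kernel_large_time_bounds:
  "\<exists>C>0. \<forall>x s. 0 \<le> x \<longrightarrow> 1 \<le> s \<longrightarrow> x \<le> 4 * \<alpha> * s \<longrightarrow>
     \<bar>conga_kernel \<alpha> x s\<bar> \<le> C / sqrt s \<and> \<bar>conga_kernel_dx \<alpha> x s\<bar> \<le> C / s"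
proof -
  define A where "A = 5 * \<alpha> / \<sigma>"
  have A: "A > 0" using a sigma_pos by (simp add: A_def)
  define C where "C = (1 + A) / \<sigma> + A"
  have C: "C > 0" using A sigma_pos by (simp add: C_def add_pos_pos)
  have "\<bar>conga_kernel \<alpha> x s\<bar> \<le> C / sqrt s \<and> \<bar>conga_kernel_dx \<alpha> x s\<bar> \<le> C / s"
    if x: "0 \<le> x" "1 \<le> s" "x \<le> 4 * \<alpha> * s" for x s
  proof -
    define c where "c = sqrt (2 * pi)"
    have c: "c \<ge> 1" using pi_gt3 by (simp add: c_def)
    define r where "r = sqrt s"
    have r: "r \<ge> 1" "s = r * r" using x by (simp_all add: r_def)
    define y where "y = standardized \<alpha> x s"
    define E where "E = exp (- (y\<^sup>2 / 2))"
    have E: "0 \<le> E" "E \<le> 1" by (simp_all add: E_def)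
    have Eeq: "exp (- ((x - \<alpha> * s)\<^sup>2 / (2 * \<sigma>\<^sup>2 * s))) = E"
      using standardized_sq[of s x] x by (simp add: E_def y_def \<sigma>_def)
    have sum5: "0 \<le> x + \<alpha> * s" "x + \<alpha> * s \<le> 5 * \<alpha> * s" using x a by (auto simp: algebra_simps)
    have ratio: "0 \<le> (x + \<alpha> * s) / (\<sigma> * r)" "(x + \<alpha> * s) / (\<sigma> * r) \<le> A * r"
    proof -
      show "0 \<le> (x + \<alpha> * s) / (\<sigma> * r)" using sum5 sigma_pos r by simp
      have "(x + \<alpha> * s) / (\<sigma> * r) \<le> (5 * \<alpha> * s) / (\<sigma> * r)" using sum5 sigma_pos r by (intro divide_right_mono) auto
      also have "\<dots> = A * r" using r by (simp add: A_def)
      finally show "(x + \<alpha> * s) / (\<sigma> * r) \<le> A * r" .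
    qed
    have 1: "\<bar>conga_kernel \<alpha> x s\<bar> \<le> C / sqrt s"
    proof -
      have "conga_kernel \<alpha> x s = ((x + \<alpha> * s) / (\<sigma> * r)) * (E / (2 * c)) / s"
        unfolding conga_kernel_def powr_3_2[OF order.trans[OF zero_le_one x(2)]] \<sigma>_def[symmetric] Eeq c_def[symmetric] r_def[symmetric]
        by simp
      also have "\<dots> \<le> (A * r) * 1 / s"
      proof (intro divide_right_mono mult_mono ratio(2))
        show "E / (2 * c) \<le> 1" "0 \<le> E / (2 * c)" using E c by (auto simp: divide_le_eq)
      qed (use A r x in auto)
      also have "\<dots> = A / r" using r by simp
      also have "\<dots> \<le> C / r" using r A sigma_pos by (intro divide_right_mono) (auto simp: C_def)
      finally have "conga_kernel \<alpha> x s \<le> C / r" .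
      moreover have "0 \<le> conga_kernel \<alpha> x s"
        unfolding conga_kernel_def \<sigma>_def[symmetric] using sum5 sigma_pos by simp
      ultimately show ?thesis by (simp add: r_def)
    qed
    have 2: "\<bar>conga_kernel_dx \<alpha> x s\<bar> \<le> C / s"
    proof -
      have "(x - \<alpha> * s) * (x + \<alpha> * s) / (\<sigma>\<^sup>2 * s) = y * ((x + \<alpha> * s) / (\<sigma> * r))"
        unfolding y_def standardized_def \<sigma>_def[symmetric] r_def[symmetric] unfolding r(2) by (simp add: power2_eq_square)
      then have "conga_kernel_dx \<alpha> x s = (1 - y * ((x + \<alpha> * s) / (\<sigma> * r))) * E / (c * (2 * \<sigma> * (s * r)))"
        unfolding conga_kernel_dx_def \<sigma>_def[symmetric] Eeq c_def[symmetric] r_def[symmetric] by simp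
      then have "\<bar>conga_kernel_dx \<alpha> x s\<bar> = \<bar>E - (y * E) * ((x + \<alpha> * s) / (\<sigma> * r))\<bar> / (c * (2 * \<sigma> * (s * r)))"
        using c sigma_pos x r by (simp add: abs_mult abs_divide algebra_simps)
      also have "\<dots> \<le> (1 + A * r) / (c * (2 * \<sigma> * (s * r)))"
      proof (rule divide_right_mono)
        have "\<bar>(y * E) * ((x + \<alpha> * s) / (\<sigma> * r))\<bar> \<le> 1 * (A * r)"
        proof -
          have "\<bar>y * E\<bar> \<le> 1" using abs_times_exp_le_1[of y] by (simp add: abs_mult E_def)
          then show ?thesis unfolding abs_mult[of "y * E"] using ratio by (intro mult_mono) auto
        qed
        then show "\<bar>E - (y * E) * ((x + \<alpha> * s) / (\<sigma> * r))\<bar> \<le> 1 + A * r" using E by linarith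
        show "0 \<le> c * (2 * \<sigma> * (s * r))" using c sigma_pos x r by simp
      qed
      also have "\<dots> \<le> (r + A * r) / (1 * (1 * \<sigma> * (s * r)))"
        using r A c sigma_pos x by (intro frac_le mult_mono) auto
      also have "\<dots> = (1 + A) / \<sigma> / s"       proof -
        have "r + A * r = (1 + A) * r" by (simp add: algebra_simps)
        then show ?thesis using r(1) by simp
      qed
      also have "\<dots> \<le> C / s" using x A by (intro divide_right_mono) (auto simp: C_def)
      finally show ?thesis .
    qed
    from 1 2 show ?thesis by blast
  qed
  with C show ?thesis by blast
qed

text \<open>
  The increment in \<open>j\<close> of the binomial tail is a point mass. That of the Gaussian tail is the density at
  some point between \<open>j\<close> and \<open>j + 1\<close>, which differs from the density at \<open>j\<close> by another term of
  order \<open>1 / m\<close>.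
\<close>

lemma tail_error_increment:
  "\<exists>C>0. \<forall>j m. 0 < m \<longrightarrow>
     \<bar>(binomial_tail \<alpha> j m - gauss_tail \<alpha> (real j) (real m)) - (binomial_tail \<alpha> (Suc j) m - gauss_tail \<alpha> (real (Suc j)) (real m))\<bar> \<le> C / real m"
proof -
  obtain C where C: "C > 0" "\<And>k m. m > 0 \<Longrightarrow> \<bar>binomial_mass \<alpha> k m - gauss_density \<alpha> (real k) (real m)\<bar> \<le> C / real m"
    using local_limit_theorem by blast
  define C' where "C' = C + 1 / \<sigma>\<^sup>2"
  have C': "C' > 0" using C(1) sigma_pos by (simp add: C'_def add_pos_pos)
  have "\<bar>(binomial_tail \<alpha> j m - gauss_tail \<alpha> (real j) (real m)) - (binomial_tail \<alpha> (Suc j) m - gauss_tail \<alpha> (real (Suc j)) (real m))\<bar> \<le> C' / real m"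
    if m: "0 < m" for j m
  proof -
    have m': "real m > 0" using m by simp
    have slope: "\<bar>- (standardized \<alpha> x (real m) * std_normal_density (standardized \<alpha> x (real m))) / (\<sigma>\<^sup>2 * real m)\<bar> \<le> 1 / \<sigma>\<^sup>2 / real m" for x
    proof -
      define y where "y = standardized \<alpha> x (real m)"
      have "\<bar>y * std_normal_density y\<bar> \<le> \<bar>y\<bar> * exp (- (y\<^sup>2 / 2))"
      proof -
        have "1 \<le> sqrt (2 * pi)" using pi_gt3 by simp
        then have "std_normal_density y \<le> exp (- (y\<^sup>2 / 2))"
          unfolding std_normal_density_def by (simp add: divide_le_eq)
        then show ?thesis by (simp add: abs_mult mult_left_mono)
      qed
      also have "\<dots> \<le> 1" by (rule abs_times_exp_le_1)
      finally have "\<bar>y * std_normal_density y\<bar> / (\<sigma>\<^sup>2 * real m) \<le> 1 / (\<sigma>\<^sup>2 * real m)"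
        using sigma_pos m by (intro divide_right_mono) auto
      then show ?thesis using sigma_pos m by (simp add: y_def abs_mult)
    qed
    have "\<exists>x>real j. x < real (Suc j) \<and> gauss_tail \<alpha> (real (Suc j)) (real m) - gauss_tail \<alpha> (real j) (real m) = (real (Suc j) - real j) * - gauss_density \<alpha> x (real m)"
      by (rule MVT2) (auto intro: gauss_tail_deriv_x[OF m'])
    then obtain x where x: "real j < x" "x < real j + 1" "gauss_tail \<alpha> (real j) (real m) - gauss_tail \<alpha> (real (Suc j)) (real m) = gauss_density \<alpha> x (real m)"
      by auto
    have "\<bar>gauss_density \<alpha> x (real m) - gauss_density \<alpha> (real j) (real m)\<bar> \<le> 1 / \<sigma>\<^sup>2 / real m"
    proof (rule abs_diff_le_of_deriv_bound[where f="\<lambda>x. gauss_density \<alpha> x (real m)"])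
      show "((\<lambda>x. gauss_density \<alpha> x (real m)) has_real_derivative
        - (standardized \<alpha> s (real m) * std_normal_density (standardized \<alpha> s (real m))) / (\<sigma>\<^sup>2 * real m)) (at s)" for s
        by (rule gauss_density_deriv_x[OF m'])
    qed (use x slope in auto)
    then have "\<bar>binomial_mass \<alpha> j m - gauss_density \<alpha> x (real m)\<bar> \<le> C / real m + 1 / \<sigma>\<^sup>2 / real m"
      using C(2)[OF m, of j] by linarith
    also have "\<dots> = C' / real m" by (simp add: C'_def add_divide_distrib)
    finally show ?thesis unfolding x(3)[symmetric] binomial_mass_def by (simp add: algebra_simps)
  qed
  with C' show ?thesis by blast
qed

text \<open>
  The density error is the local limit theorem together with the change of the density over
  less than one unit of time. The tail error is obtained by walking from \<open>k\<close> to a level \<open>k + L\<close> beyond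
  the window, where both tails are exponentially small: each of the about \<open>2 R\<close> steps
  costs \<open>C / m\<close>, and \<open>m\<close> is comparable to \<open>k\<close> inside the window.
\<close>

lemma near_bounds:
  "\<exists>C>0. \<forall>k R z. 4 \<le> R \<longrightarrow> 4 * R \<le> real k \<longrightarrow> 0 \<le> z \<longrightarrow> \<bar>\<alpha> * z - real k\<bar> < R \<longrightarrow>
     \<bar>tail_error \<alpha> k z\<bar> \<le> C * (R / real k + 1 / sqrt (real k) + exp (- (R\<^sup>2 / (64 * real k)))) \<and>
     \<bar>mass_error \<alpha> k z\<bar> \<le> C / real k"
proof -
  obtain C1 where C1: "C1 > 0" "\<And>k m. m > 0 \<Longrightarrow> \<bar>binomial_mass \<alpha> k m - gauss_density \<alpha> (real k) (real m)\<bar> \<le> C1 / real m"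
    using local_limit_theorem by blast
  obtain C2 where C2: "C2 > 0" "\<And>x s. 0 \<le> x \<Longrightarrow> 1 \<le> s \<Longrightarrow> x \<le> 4 * \<alpha> * s \<Longrightarrow>
     \<bar>conga_kernel \<alpha> x s\<bar> \<le> C2 / sqrt s \<and> \<bar>conga_kernel_dx \<alpha> x s\<bar> \<le> C2 / s"
    using kernel_large_time_bounds by blast
  obtain C3 where C3: "C3 > 0" "\<And>j m. 0 < m \<Longrightarrow>
     \<bar>(binomial_tail \<alpha> j m - gauss_tail \<alpha> (real j) (real m)) - (binomial_tail \<alpha> (Suc j) m - gauss_tail \<alpha> (real (Suc j)) (real m))\<bar> \<le> C3 / real m"
    using tail_error_increment by blast
  have a': "0 \<le> \<alpha>" "\<alpha> \<le> 1" using a by auto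
  define C where "C = 8 * C3 + 2 * C2 + 2 * C1 + 2"
  have C: "C > 0" using C1(1) C2(1) C3(1) by (simp add: C_def)
  have "\<bar>tail_error \<alpha> k z\<bar> \<le> C * (R / real k + 1 / sqrt (real k) + exp (- (R\<^sup>2 / (64 * real k)))) \<and>
     \<bar>mass_error \<alpha> k z\<bar> \<le> C / real k"
    if R: "4 \<le> R" "4 * R \<le> real k" and z: "0 \<le> z" and near: "\<bar>\<alpha> * z - real k\<bar> < R" for k R z
  proof -
    define m where "m = nat \<lfloor>z\<rfloor>"
    define e where "e = exp (- (R\<^sup>2 / (64 * real k)))"
    have e: "e > 0" by (simp add: e_def)
    have k: "real k \<ge> 16" "k > 0" using R by auto
    have mz: "real m \<le> z" "z - real m \<le> 1" using z unfolding m_def by linarith+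
    have "\<alpha> * (z - real m) \<le> 1 * 1" using mz a by (intro mult_mono) auto
    then have am: "real k / 2 \<le> \<alpha> * real m" using near R by (simp add: right_diff_distrib abs_less_iff)
    have "\<alpha> * real m \<le> 1 * real m" using a by (intro mult_right_mono) auto
    then have mk: "real k / 2 \<le> real m" using am by linarith
    have m: "m > 0" "real m \<ge> 1" using mk k by (auto intro: Nat.gr0I)
    have inv_m: "1 / real m \<le> 2 / real k" using mk k m by (simp add: frac_le_eq divide_le_eq field_simps)
    have seg: "0 \<le> real k" "1 \<le> s" "real k \<le> 4 * \<alpha> * s" "real k / 2 \<le> s" if s: "real m \<le> s" for s
    proof -
      have "\<alpha> * real m \<le> \<alpha> * s" using s a by (intro mult_left_mono) auto
      then show "real k \<le> 4 * \<alpha> * s" using am k by linarith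
    qed (use s m mk in auto)
    have "\<bar>gauss_density \<alpha> (real k) z - gauss_density \<alpha> (real k) (real m)\<bar> \<le> C2 * (2 / real k)"
    proof (rule abs_diff_le_of_deriv_bound[where f="gauss_density \<alpha> (real k)", OF mz(1) gauss_density_deriv_z])
      fix s assume s: "real m \<le> s"
      show "0 < s" using seg(2)[OF s] by simp
      have "\<bar>conga_kernel_dx \<alpha> (real k) s\<bar> \<le> C2 / s" using C2(2) seg[OF s] by blast
      also have "\<dots> \<le> C2 / (real k / 2)" using seg(4)[OF s] k C2(1) by (intro divide_left_mono) auto
      finally show "\<bar>- conga_kernel_dx \<alpha> (real k) s\<bar> \<le> C2 * (2 / real k)" by simp
    qed (rule mz)
    moreover have "C1 / real m \<le> C1 * (2 / real k)" using mult_left_mono[OF inv_m, of C1] C1(1) by simp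
    ultimately have "\<bar>binomial_mass \<alpha> k m - gauss_density \<alpha> (real k) z\<bar> \<le> C1 * (2 / real k) + C2 * (2 / real k)"
      using C1(2)[OF m(1), of k] by linarith
    also have "\<dots> = (2 * C1 + 2 * C2) / real k" by (simp add: add_divide_distrib mult.commute)
    also have "\<dots> \<le> C / real k" using C3(1) k by (intro divide_right_mono) (auto simp: C_def)
    finally have mass: "\<bar>binomial_mass \<alpha> k m - gauss_density \<alpha> (real k) z\<bar> \<le> C / real k" .
    have time: "\<bar>gauss_tail \<alpha> (real k) z - gauss_tail \<alpha> (real k) (real m)\<bar> \<le> 2 * C2 * (1 / sqrt (real k))"
    proof (rule abs_diff_le_of_deriv_bound[where f="gauss_tail \<alpha> (real k)", OF mz(1) gauss_tail_deriv_z])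
      fix s assume s: "real m \<le> s"
      show "0 < s" using seg(2)[OF s] by simp
      have "sqrt (real k) \<le> sqrt (4 * s)" using seg(4)[OF s] seg(2)[OF s] by (intro real_sqrt_le_mono) linarith
      then have sq: "sqrt (real k) / 2 \<le> sqrt s" by (simp add: real_sqrt_mult)
      have "\<bar>conga_kernel \<alpha> (real k) s\<bar> \<le> C2 / sqrt s" using C2(2) seg[OF s] by blast
      also have "\<dots> \<le> C2 / (sqrt (real k) / 2)" using sq k C2(1) seg(2)[OF s] by (intro divide_left_mono) auto
      finally show "\<bar>conga_kernel \<alpha> (real k) s\<bar> \<le> 2 * C2 * (1 / sqrt (real k))" by (simp add: mult.commute)
    qed (rule mz)
    \<comment> \<open>Inside the window \<open>\<alpha> * m\<close> is at most \<open>k + R\<close>, so after \<open>2 * R\<close> levels the distance is at least \<open>R\<close>.\<close>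
    define L where "L = nat \<lceil>2 * R\<rceil>"
    have L: "2 * R \<le> real L" "real L \<le> 4 * R" "real L \<le> real k" using R by (simp_all add: L_def) linarith+
    let ?d = "\<lambda>j. binomial_tail \<alpha> j m - gauss_tail \<alpha> (real j) (real m)"
    have tele: "\<bar>?d k - ?d (k + i)\<bar> \<le> real i * (C3 / real m)" for i
    proof (induction i)
      case (Suc i)
      have "\<bar>?d (k + i) - ?d (Suc (k + i))\<bar> \<le> C3 / real m" by (rule C3(2)[OF m(1)])
      then have "\<bar>?d k - ?d (Suc (k + i))\<bar> \<le> real i * (C3 / real m) + C3 / real m" using Suc by linarith
      moreover have "real (Suc i) * y = real i * y + y" for y by (simp add: algebra_simps)
      ultimately show ?case by (simp only: add_Suc_right)
    qed simp
    have "real L * (C3 / real m) \<le> (4 * R) * (C3 * (2 / real k))"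
      using L R C3(1) mult_left_mono[OF inv_m, of C3] by (intro mult_mono) auto
    also have "\<dots> = 8 * C3 * (R / real k)" by (simp add: mult_ac)
    finally have tele': "\<bar>?d k - ?d (k + L)\<bar> \<le> 8 * C3 * (R / real k)" using tele[of L] by (rule order.trans[rotated])
    have kL: "0 < k + L" "R \<le> real (k + L)" "\<alpha> * real m \<le> real (k + L) - R" "real (k + L) \<le> 2 * real k"
    proof -
      have "\<alpha> * real m \<le> \<alpha> * z" using mz a by simp
      then show "\<alpha> * real m \<le> real (k + L) - R" using near L by (simp add: abs_less_iff)
    qed (use k R L in auto)
    have weaken: "exp (- t) \<le> e" if "R\<^sup>2 / (4 * real (k + L)) \<le> t" for t
    proof -
      have "R\<^sup>2 / (64 * real k) \<le> R\<^sup>2 / (4 * real (k + L))" using kL k by (intro divide_left_mono) auto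
      then show ?thesis using that by (simp add: e_def)
    qed
    have "binomial_tail \<alpha> (k + L) m \<le> exp (- (R\<^sup>2 / (4 * real (k + L))))"
      by (rule binomial_tail_chernoff[OF a']) (use R kL in auto)
    then have F: "binomial_tail \<alpha> (k + L) m \<le> e" using weaken[OF order_refl] by linarith
    have G: "gauss_tail \<alpha> (real (k + L)) (real m) \<le> e"
    proof -
      have "R\<^sup>2 / (4 * real (k + L)) \<le> (standardized \<alpha> (real (k + L)) (real m))\<^sup>2 / 2"
        by (rule gauss_exponent_low) (use R kL m in auto)
      moreover have "standardized \<alpha> (real (k + L)) (real m) \<ge> 0"
        unfolding standardized_def \<sigma>_def[symmetric] using kL R sigma_pos by (intro divide_nonneg_nonneg) auto
      ultimately show ?thesis
        using normal_tail_upper[of "standardized \<alpha> (real (k + L)) (real m)"] weaken m by (fastforce simp: gauss_tail_def)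
    qed
    have nn: "0 \<le> binomial_tail \<alpha> (k + L) m" "0 \<le> gauss_tail \<alpha> (real (k + L)) (real m)"
      using binomial_tail_nonneg[OF a'] normal_tail_nonneg by (auto simp: gauss_tail_def)
    have "\<bar>?d (k + L)\<bar> \<le> e" using F G nn by linarith
    then have "\<bar>binomial_tail \<alpha> k m - gauss_tail \<alpha> (real k) z\<bar> \<le> 8 * C3 * (R / real k) + 2 * C2 * (1 / sqrt (real k)) + e"
      using tele' time by linarith
    also have "\<dots> \<le> C * (R / real k) + C * (1 / sqrt (real k)) + C * e"
      using C1(1) C2(1) C3(1) R k e by (intro add_mono mult_right_mono) (auto simp: C_def)
    also have "\<dots> = C * (R / real k + 1 / sqrt (real k) + e)" by (simp add: algebra_simps)
    finally show ?thesis using mass by (simp add: m_def e_def tail_error_def mass_error_def abs_minus_commute)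
  qed
  with C show ?thesis by blast
qed

lemma card_near_grid:
  assumes N: "N > 0" and R: "R \<ge> 0"
  shows "finite {i::nat. \<bar>\<alpha> * (real i / real N) - x\<bar> < R}"
    and "real (card {i::nat. \<bar>\<alpha> * (real i / real N) - x\<bar> < R}) \<le> real N * (2 * R / \<alpha> + 1)"
proof -
  let ?S = "{i::nat. \<bar>\<alpha> * (real i / real N) - x\<bar> < R}"
  have bnd: "(x - R) * real N / \<alpha> \<le> real i \<and> real i \<le> (x + R) * real N / \<alpha>" if "i \<in> ?S" for i
  proof -
    have "x - R < \<alpha> * (real i / real N)" "\<alpha> * (real i / real N) < x + R" using that by (auto simp: abs_less_iff)
    then have "(x - R) * real N < \<alpha> * real i" "\<alpha> * real i < (x + R) * real N"
      using N by (auto simp: field_simps)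
    then show ?thesis using a by (auto simp: field_simps)
  qed
  show fin: "finite ?S"
  proof (rule finite_subset)
    show "?S \<subseteq> {..nat \<lceil>(x + R) * real N / \<alpha>\<rceil>}"
    proof
      fix i assume "i \<in> ?S"
      then have "real i \<le> (x + R) * real N / \<alpha>" using bnd by blast
      then show "i \<in> {..nat \<lceil>(x + R) * real N / \<alpha>\<rceil>}" by simp linarith
    qed
  qed simp
  show "real (card ?S) \<le> real N * (2 * R / \<alpha> + 1)"
  proof (cases "?S = {}")
    case True
    then show ?thesis using R a by simp
  next
    case False
    have "?S \<subseteq> {Min ?S..Max ?S}" using fin by auto
    then have "card ?S \<le> card {Min ?S..Max ?S}" by (intro card_mono) auto
    also have "\<dots> = Suc (Max ?S) - Min ?S" by simp
    finally have "real (card ?S) \<le> real (Max ?S) + 1 - real (Min ?S)"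
      using Min_le[OF fin Max_in[OF fin False]] by linarith
    also have "\<dots> \<le> (x + R) * real N / \<alpha> + 1 - (x - R) * real N / \<alpha>"
      using bnd[OF Max_in[OF fin False]] bnd[OF Min_in[OF fin False]] by linarith
    also have "\<dots> = real N * (2 * R / \<alpha>) + 1" using a by (simp add: field_simps)
    also have "\<dots> \<le> real N * (2 * R / \<alpha>) + real N" using N by simp
    finally show ?thesis by (simp add: algebra_simps)
  qed
qed

text \<open>
  A discretised integral of \<open>(c z)\<^sup>2\<close>: the window has length \<open>2 R / \<alpha>\<close>, the additional 1
  covers the one grid point more that it may contain, and the rest of \<open>(0, n)\<close> is estimated by its full length.
\<close>

lemma grid_variance_split:
  fixes c :: "real \<Rightarrow> real"
  assumes N: "N > 0" and R: "R \<ge> 0"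
    and near: "\<And>z. 0 \<le> z \<Longrightarrow> \<bar>\<alpha> * z - x\<bar> < R \<Longrightarrow> \<bar>c z\<bar> \<le> A"
    and far: "\<And>z. 0 \<le> z \<Longrightarrow> R \<le> \<bar>\<alpha> * z - x\<bar> \<Longrightarrow> \<bar>c z\<bar> \<le> B"
  shows "(\<Sum>i<n * N. (c (real i / real N))\<^sup>2) / real N \<le> A\<^sup>2 * (2 * R / \<alpha> + 1) + real n * B\<^sup>2"
proof -
  let ?S = "{i::nat. \<bar>\<alpha> * (real i / real N) - x\<bar> < R}"
  note S = card_near_grid[OF N R, of x]
  have pt: "(c (real i / real N))\<^sup>2 \<le> A\<^sup>2 * indicator ?S i + B\<^sup>2" for i
  proof (cases "i \<in> ?S")
    case True
    then have "\<bar>c (real i / real N)\<bar> \<le> A" using near by simp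
    then have "\<bar>c (real i / real N)\<bar>\<^sup>2 \<le> A\<^sup>2" by (intro power_mono) auto
    then show ?thesis using True by (simp add: add_increasing2)
  next
    case False
    then have "\<bar>c (real i / real N)\<bar> \<le> B" using far by simp
    then have "\<bar>c (real i / real N)\<bar>\<^sup>2 \<le> B\<^sup>2" by (intro power_mono) auto
    then show ?thesis using False by simp
  qed
  have "(\<Sum>i<n * N. (c (real i / real N))\<^sup>2) \<le> (\<Sum>i<n * N. A\<^sup>2 * indicator ?S i + B\<^sup>2)"
    by (rule sum_mono) (rule pt)
  also have "\<dots> = A\<^sup>2 * real (card ({..<n * N} \<inter> ?S)) + real (n * N) * B\<^sup>2"
  proof -
    have "(\<Sum>i<n * N. indicator ?S i) = real (card ({..<n * N} \<inter> ?S))"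
      by (subst sum_indicator_eq_card[symmetric]) (auto simp: indicator_def intro!: sum.cong)
    then show ?thesis by (simp only: sum.distrib sum_distrib_left[symmetric] sum_constant card_lessThan)
  qed
  also have "\<dots> \<le> A\<^sup>2 * (real N * (2 * R / \<alpha> + 1)) + real (n * N) * B\<^sup>2"
  proof -
    have "real (card ({..<n * N} \<inter> ?S)) \<le> real (card ?S)" using S(1) by (intro of_nat_mono card_mono) auto
    then have "real (card ({..<n * N} \<inter> ?S)) \<le> real N * (2 * R / \<alpha> + 1)" using S(2) by linarith
    then show ?thesis by (intro add_right_mono mult_left_mono) auto
  qed
  also have "\<dots> = real N * (A\<^sup>2 * (2 * R / \<alpha> + 1) + real n * B\<^sup>2)" by (simp add: algebra_simps)
  finally show ?thesis using N by (simp add: divide_le_eq mult_ac)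
qed

end

section \<open>Error probabilities and Borel-Cantelli\<close>

context conga_rate
begin

text \<open>
  With \<open>R = k^(1/2 + \<delta>)\<close> the window contributes \<open>(R / k)\<^sup>2 R = k^(-1/2 + 3 \<delta>)\<close> for the tails
  and \<open>R / k\<^sup>2 = k^(-3/2 + \<delta>)\<close> for the masses. The exponential smallness outside absorbs the
  polynomial length \<open>n \<le> k^(1/\<epsilon>)\<close>.
\<close>

lemma variance_bounds:
  fixes \<epsilon> \<eta> :: real
  assumes \<epsilon>: "\<epsilon> > 0" and \<eta>: "\<eta> > 0"
  shows "\<exists>C>0. \<exists>k0. \<forall>k\<ge>k0. \<forall>n N. 0 < N \<longrightarrow> real n \<le> real k powr (1 / \<epsilon>) \<longrightarrow>
     (\<Sum>i<n * N. (tail_error \<alpha> k (real i / real N))\<^sup>2) / real N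
       \<le> C * real k powr (- (1/2) + \<eta>) \<and>
     (\<Sum>i<n * N. (mass_error \<alpha> k (real i / real N))\<^sup>2) / real N
       \<le> C * real k powr (- (3/2) + \<eta>)"
proof -
  \<comment> \<open>The first bound makes \<open>3 * \<delta> \<le> \<eta>\<close>, the second keeps the window well inside \<open>(0, 2 * k)\<close>.\<close>
  define \<delta> where "\<delta> = min (\<eta> / 3) (1 / 4)"
  have \<delta>: "0 < \<delta>" "\<delta> \<le> 1/4" "3 * \<delta> \<le> \<eta>" using \<eta> by (auto simp: \<delta>_def)
  obtain Cf where Cf: "Cf > 0" "\<And>k R z. 4 \<le> R \<Longrightarrow> R \<le> real k \<Longrightarrow> 0 \<le> z \<Longrightarrow> R \<le> \<bar>\<alpha> * z - real k\<bar> \<Longrightarrow>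
     \<bar>tail_error \<alpha> k z\<bar> \<le> Cf * exp (- (R\<^sup>2 / (64 * real k))) \<and>
     \<bar>mass_error \<alpha> k z\<bar> \<le> Cf * exp (- (R\<^sup>2 / (64 * real k)))"
    using far_bounds by blast
  obtain Cn where Cn: "Cn > 0" "\<And>k R z. 4 \<le> R \<Longrightarrow> 4 * R \<le> real k \<Longrightarrow> 0 \<le> z \<Longrightarrow> \<bar>\<alpha> * z - real k\<bar> < R \<Longrightarrow>
     \<bar>tail_error \<alpha> k z\<bar> \<le> Cn * (R / real k + 1 / sqrt (real k) + exp (- (R\<^sup>2 / (64 * real k)))) \<and>
     \<bar>mass_error \<alpha> k z\<bar> \<le> Cn / real k"
    using near_bounds by blast
  define E where "E x = exp (- (x powr (2 * \<delta>)) / 64)" for x :: real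
  define good where "good x \<longleftrightarrow> 4 \<le> x powr (1/2 + \<delta>) \<and> 4 * x powr (1/2 + \<delta>) \<le> x \<and> E x \<le> x powr (1/2 + \<delta>) / x
      \<and> x powr (1 / \<epsilon>) * (E x)\<^sup>2 \<le> x powr (- (3/2)) \<and> 1 \<le> x" for x :: real
  have "eventually (\<lambda>x::real. 4 \<le> x powr (1/2 + \<delta>)) at_top" using \<delta>(1,2) by real_asymp
  moreover have "eventually (\<lambda>x::real. 4 * x powr (1/2 + \<delta>) \<le> x) at_top" using \<delta>(1,2) by real_asymp
  moreover have "eventually (\<lambda>x::real. E x \<le> x powr (1/2 + \<delta>) / x) at_top" unfolding E_def using \<delta>(1,2) by real_asymp
  moreover have "eventually (\<lambda>x::real. x powr (1 / \<epsilon>) * (E x)\<^sup>2 \<le> x powr (- (3/2))) at_top" unfolding E_def using \<delta>(1,2) \<epsilon> by real_asymp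
  moreover have "eventually (\<lambda>x::real. x \<ge> 1) at_top" by (rule eventually_ge_at_top)
  ultimately have "eventually good at_top"
    by eventually_elim (simp add: good_def)
  then have "eventually (\<lambda>k. good (real k)) sequentially"
    by (rule eventually_compose_filterlim[OF _ filterlim_real_sequentially])
  then obtain k0 where k0: "\<And>k. k \<ge> k0 \<Longrightarrow> good (real k)"
    unfolding eventually_sequentially by blast
  define C where "C = 27 * Cn\<^sup>2 / \<alpha> + Cf\<^sup>2"
  have C: "C > 0" using Cn(1) a by (simp add: C_def add_pos_nonneg)
  have main: "(\<Sum>i<n * N. (tail_error \<alpha> k (real i / real N))\<^sup>2) / real N
       \<le> C * real k powr (- (1/2) + \<eta>) \<and>
     (\<Sum>i<n * N. (mass_error \<alpha> k (real i / real N))\<^sup>2) / real N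
       \<le> C * real k powr (- (3/2) + \<eta>)"
    if k: "k \<ge> k0" and N: "N > 0" and n: "real n \<le> real k powr (1 / \<epsilon>)" for k n N
  proof -
    define x where "x = real k"
    define R where "R = x powr (1/2 + \<delta>)"
    define e where "e = exp (- (R\<^sup>2 / (64 * x)))"
    have kk: "4 \<le> R" "4 * R \<le> x" "E x \<le> R / x" "x powr (1 / \<epsilon>) * (E x)\<^sup>2 \<le> x powr (- (3/2))" "1 \<le> x"
      using k0[OF k] by (auto simp: good_def x_def R_def)
    have R2: "R\<^sup>2 = x * x powr (2 * \<delta>)"
    proof -
      have "R\<^sup>2 = x powr ((1/2 + \<delta>) + (1/2 + \<delta>))" unfolding R_def power2_eq_square by (rule powr_add[symmetric])
      also have "\<dots> = x powr (1 + 2 * \<delta>)" by (simp add: algebra_simps)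
      finally show ?thesis using kk(5) by (simp add: powr_add)
    qed
    have eE: "e = E x" unfolding e_def E_def R2 using kk(5) by simp
    have sq: "1 / sqrt x \<le> R / x"
    proof -
      have "sqrt x = x powr (1/2)" using kk(5) by (simp add: powr_half_sqrt)
      also have "\<dots> \<le> R" unfolding R_def using kk(5) \<delta> by (intro powr_mono) auto
      finally have "sqrt x / x \<le> R / x" using kk(5) by (intro divide_right_mono) auto
      then show ?thesis using sqrt_divide_self_eq[of x] kk(5) by (simp add: inverse_eq_divide)
    qed
    define A1 where "A1 = 3 * Cn * (R / x)"
    define A2 where "A2 = Cn / x"
    define B where "B = Cf * e"
    have V1: "(\<Sum>i<n * N. (tail_error \<alpha> k (real i / real N))\<^sup>2) / real N
       \<le> A1\<^sup>2 * (2 * R / \<alpha> + 1) + real n * B\<^sup>2"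
    proof (rule grid_variance_split[OF N, where x=x and c="tail_error \<alpha> k"])
      fix z :: real assume z: "0 \<le> z" "\<bar>\<alpha> * z - x\<bar> < R"
      have "\<bar>tail_error \<alpha> k z\<bar> \<le> Cn * (R / x + 1 / sqrt x + e)"
        using Cn(2)[of R k z] kk z by (simp add: x_def e_def)
      also have "\<dots> \<le> Cn * (R / x + R / x + R / x)"
        using sq kk(3) eE Cn(1) by (intro mult_left_mono add_mono) auto
      finally show "\<bar>tail_error \<alpha> k z\<bar> \<le> A1" by (simp add: A1_def mult_ac)
    next
      fix z :: real assume z: "0 \<le> z" "R \<le> \<bar>\<alpha> * z - x\<bar>"
      then show "\<bar>tail_error \<alpha> k z\<bar> \<le> B"
        using Cf(2)[of R k z] kk by (simp add: x_def e_def B_def)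
    qed (use kk in auto)
    have V2: "(\<Sum>i<n * N. (mass_error \<alpha> k (real i / real N))\<^sup>2) / real N
       \<le> A2\<^sup>2 * (2 * R / \<alpha> + 1) + real n * B\<^sup>2"
    proof (rule grid_variance_split[OF N, where x=x and c="mass_error \<alpha> k"])
      fix z :: real assume z: "0 \<le> z" "\<bar>\<alpha> * z - x\<bar> < R"
      then show "\<bar>mass_error \<alpha> k z\<bar> \<le> A2"
        using Cn(2)[of R k z] kk by (simp add: x_def A2_def)
    next
      fix z :: real assume z: "0 \<le> z" "R \<le> \<bar>\<alpha> * z - x\<bar>"
      then show "\<bar>mass_error \<alpha> k z\<bar> \<le> B"
        using Cf(2)[of R k z] kk by (simp add: x_def e_def B_def)
    qed (use kk in auto)
    have nB: "real n * B\<^sup>2 \<le> Cf\<^sup>2 * x powr (- (3/2))"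
    proof -
      have "real n * e\<^sup>2 \<le> x powr (1 / \<epsilon>) * e\<^sup>2" using n by (intro mult_right_mono) (auto simp: x_def)
      also have "\<dots> \<le> x powr (- (3/2))" using kk(4) eE by simp
      finally have "Cf\<^sup>2 * (real n * e\<^sup>2) \<le> Cf\<^sup>2 * x powr (- (3/2))" by (intro mult_left_mono) auto
      then show ?thesis by (simp add: B_def power_mult_distrib mult_ac)
    qed
    have width: "2 * R / \<alpha> + 1 \<le> 3 * R / \<alpha>"
    proof -
      have "\<alpha> \<le> R" using a kk by linarith
      then have "1 \<le> R / \<alpha>" using a by simp
      then show ?thesis by (simp add: add_divide_distrib[symmetric])
    qed
    have pw: "x powr b \<le> x powr c" if "b \<le> c" for b c using kk(5) that by (rule powr_mono[rotated])
    have "A1\<^sup>2 * (2 * R / \<alpha> + 1) \<le> A1\<^sup>2 * (3 * R / \<alpha>)" using width by (intro mult_left_mono) auto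
    also have "\<dots> = (27 * Cn\<^sup>2 / \<alpha>) * (R * R\<^sup>2 / x\<^sup>2)"
      by (simp add: A1_def power_mult_distrib power_divide mult_ac)
    also have "R * R\<^sup>2 / x\<^sup>2 = x powr (- (1/2) + 3 * \<delta>)"
    proof -
      have "R * R\<^sup>2 / x\<^sup>2 = x powr (1/2 + \<delta>) * x powr (2 * \<delta>) * x powr (-1)"
        unfolding R2 unfolding R_def using kk(5) by (simp add: power2_eq_square powr_minus_divide)
      also have "\<dots> = x powr (- (1/2) + 3 * \<delta>)" unfolding powr_add[symmetric] by (simp add: algebra_simps)
      finally show ?thesis .
    qed
    also have "27 * Cn\<^sup>2 / \<alpha> * x powr (- (1/2) + 3 * \<delta>) \<le> 27 * Cn\<^sup>2 / \<alpha> * x powr (- (1/2) + \<eta>)"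
      using a \<delta> by (intro mult_left_mono pw) auto
    finally have "A1\<^sup>2 * (2 * R / \<alpha> + 1) + real n * B\<^sup>2 \<le> 27 * Cn\<^sup>2 / \<alpha> * x powr (- (1/2) + \<eta>) + Cf\<^sup>2 * x powr (- (3/2))"
      using nB by (rule add_mono)
    also have "\<dots> \<le> 27 * Cn\<^sup>2 / \<alpha> * x powr (- (1/2) + \<eta>) + Cf\<^sup>2 * x powr (- (1/2) + \<eta>)"
      using \<eta> by (intro add_left_mono mult_left_mono pw) auto
    also have "\<dots> = C * x powr (- (1/2) + \<eta>)" by (simp add: C_def algebra_simps)
    finally have 1: "A1\<^sup>2 * (2 * R / \<alpha> + 1) + real n * B\<^sup>2 \<le> C * x powr (- (1/2) + \<eta>)" .
    have "A2\<^sup>2 * (2 * R / \<alpha> + 1) \<le> A2\<^sup>2 * (3 * R / \<alpha>)" using width by (intro mult_left_mono) auto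
    also have "\<dots> = (3 * Cn\<^sup>2 / \<alpha>) * (R / x\<^sup>2)"
      by (simp add: A2_def power_divide mult_ac)
    also have "R / x\<^sup>2 = x powr (- (3/2) + \<delta>)"
    proof -
      have "R / x\<^sup>2 = x powr (1/2 + \<delta>) * x powr (-2)"
        unfolding R_def using kk(5) by (simp add: powr_minus_divide)
      also have "\<dots> = x powr (- (3/2) + \<delta>)" unfolding powr_add[symmetric] by (simp add: algebra_simps)
      finally show ?thesis .
    qed
    also have "3 * Cn\<^sup>2 / \<alpha> * x powr (- (3/2) + \<delta>) \<le> 27 * Cn\<^sup>2 / \<alpha> * x powr (- (3/2) + \<eta>)"
      using a \<delta> by (intro mult_mono pw divide_right_mono) auto
    finally have "A2\<^sup>2 * (2 * R / \<alpha> + 1) + real n * B\<^sup>2 \<le> 27 * Cn\<^sup>2 / \<alpha> * x powr (- (3/2) + \<eta>) + Cf\<^sup>2 * x powr (- (3/2))"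
      using nB by (rule add_mono)
    also have "\<dots> \<le> 27 * Cn\<^sup>2 / \<alpha> * x powr (- (3/2) + \<eta>) + Cf\<^sup>2 * x powr (- (3/2) + \<eta>)"
      using \<eta> by (intro add_left_mono mult_left_mono pw) auto
    also have "\<dots> = C * x powr (- (3/2) + \<eta>)" by (simp add: C_def algebra_simps)
    finally have 2: "A2\<^sup>2 * (2 * R / \<alpha> + 1) + real n * B\<^sup>2 \<le> C * x powr (- (3/2) + \<eta>)" .
    show ?thesis using order.trans[OF V1 1] order.trans[OF V2 2] by (simp add: x_def)
  qed
  show ?thesis using C main by blast
qed

end

text \<open>
  The ages run backwards in time. In forward order the sum has the form required by the estimates for
  Brownian increments.
\<close>

lemma grid_sum_reversed:
  assumes N: "N > 0"
  shows "grid_sum w n N c =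
    (\<Sum>l<n * N. c (real (n * N - Suc l) / real N) *\<^sub>R (w (real (Suc l) / real N) - w (real l / real N)))"
proof -
  let ?g = "\<lambda>i. c (real i / real N) *\<^sub>R (w (real n - real i / real N) - w (real n - real (Suc i) / real N))"
  have "grid_sum w n N c = (\<Sum>l<n * N. ?g (n * N - Suc l))"
    unfolding grid_sum_def by (rule sum.nat_diff_reindex[symmetric])
  also have "\<dots> = (\<Sum>l<n * N. c (real (n * N - Suc l) / real N) *\<^sub>R (w (real (Suc l) / real N) - w (real l / real N)))"
  proof (rule sum.cong[OF refl])
    fix l assume l: "l \<in> {..<n * N}"
    then have "real (n * N - Suc l) = real n * real N - real (Suc l)" "real (Suc (n * N - Suc l)) = real n * real N - real l"
      by (auto simp: of_nat_diff Suc_diff_Suc)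
    then have "real n - real (n * N - Suc l) / real N = real (Suc l) / real N" "real n - real (Suc (n * N - Suc l)) / real N = real l / real N"
    proof -
      have "real n * real N / real N = real n" using N by simp
      then have "(real n * real N - y) / real N = real n - y / real N" for y by (simp only: diff_divide_distrib)
      then show "real n - real (n * N - Suc l) / real N = real (Suc l) / real N" "real n - real (Suc (n * N - Suc l)) / real N = real l / real N"
        using \<open>real (n * N - Suc l) = real n * real N - real (Suc l)\<close> \<open>real (Suc (n * N - Suc l)) = real n * real N - real l\<close>
        by (simp_all only: diff_diff_eq2 add_diff_cancel_left')
    qed
    then show "?g (n * N - Suc l) = c (real (n * N - Suc l) / real N) *\<^sub>R (w (real (Suc l) / real N) - w (real l / real N))"
      by (simp only:)
  qed
  finally show ?thesis .
qed

lemma grid_sum_measurable: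
  fixes W :: "real \<Rightarrow> 'a \<Rightarrow> real ^ 'n"
  assumes BM: "standard_brownian_motion M W" and N: "N > 0"
  shows "(\<lambda>\<omega>. grid_sum (\<lambda>t. W t \<omega>) n N c) \<in> borel_measurable M"
  unfolding grid_sum_reversed[OF N] by (rule brownian_increment_sum_measurable[OF BM]) simp

lemma grid_sum_tail:
  fixes W :: "real \<Rightarrow> 'a \<Rightarrow> real ^ 2"
  assumes BM: "standard_brownian_motion M W" and N: "N > 0"
    and v: "(\<Sum>i<n * N. (c (real i / real N))\<^sup>2) / real N \<le> v" "v > 0" and L: "L > 0"
  shows "emeasure M {\<omega> \<in> space M. norm (grid_sum (\<lambda>t. W t \<omega>) n N c) > L} \<le> ennreal (4 * exp (- (L\<^sup>2 / (8 * v))))"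
  unfolding grid_sum_reversed[OF N]
proof (rule brownian_increment_sum_tail[OF BM _ _ _ v(2) L])
  let ?V = "\<Sum>l<n * N. (c (real (n * N - Suc l) / real N))\<^sup>2 * (real (Suc l) / real N - real l / real N)"
  have "?V
     = (\<Sum>l<n * N. (c (real (n * N - Suc l) / real N))\<^sup>2) / real N"
    by (simp add: sum_divide_distrib diff_divide_distrib[symmetric])
  also have "\<dots> = (\<Sum>i<n * N. (c (real i / real N))\<^sup>2) / real N"
    using sum.nat_diff_reindex[of "\<lambda>i. (c (real i / real N))\<^sup>2" "n * N"] by simp
  finally show "?V \<le> v"
    using v(1) by simp
qed (use N in \<open>auto simp: divide_strict_right_mono\<close>)

text \<open>
  The set of points that lie in all but finitely many \<open>A N\<close> is an increasing union of the sets
  \<open>\<Inter>j\<ge>N. A j\<close>, each of which is contained in \<open>A N\<close>.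
\<close>

lemma emeasure_eventually_le:
  fixes A :: "nat \<Rightarrow> 'a set"
  assumes A: "\<And>N. A N \<in> sets M" and le: "\<And>N. emeasure M (A N) \<le> b"
  shows "(\<Union>N. \<Inter>j\<in>{N..}. A j) \<in> sets M" "emeasure M (\<Union>N. \<Inter>j\<in>{N..}. A j) \<le> b"
proof -
  let ?B = "\<lambda>N. \<Inter>j\<in>{N..}. A j"
  have B: "?B N \<in> sets M" for N by (intro sets.countable_INT') (auto simp: A)
  then show "(\<Union>N. ?B N) \<in> sets M" by auto
  have "incseq ?B" by (auto simp: incseq_def)
  then have "emeasure M (\<Union>N. ?B N) = (SUP N. emeasure M (?B N))"
    using B by (intro SUP_emeasure_incseq[symmetric]) auto
  also have "\<dots> \<le> b"
  proof (rule SUP_least)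
    fix N
    have "emeasure M (?B N) \<le> emeasure M (A N)" by (rule emeasure_mono) (use A in auto)
    then show "emeasure M (?B N) \<le> b" using le[of N] by (rule order.trans)
  qed
  finally show "emeasure M (\<Union>N. ?B N) \<le> b" .
qed

text \<open>
  A measurable event that stands in for the excess of the limit: if the grid sums converge to a vector of
  norm above \<open>L\<close>, then their norms exceed \<open>L\<close> on all fine grids. The index \<open>j\<close> gives the mesh
  \<open>1 / (j + 1)\<close>.
\<close>

definition persistent_excess :: "'a measure \<Rightarrow> (real \<Rightarrow> 'a \<Rightarrow> real ^ 2) \<Rightarrow> nat \<Rightarrow> (real \<Rightarrow> real) \<Rightarrow> real \<Rightarrow> 'a set" where
  "persistent_excess M W n c L =
     (\<Union>N. \<Inter>j\<in>{N..}. {\<omega> \<in> space M. norm (grid_sum (\<lambda>t. W t \<omega>) n (Suc j) c) > L})"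

lemma persistent_excess_bound:
  fixes W :: "real \<Rightarrow> 'a \<Rightarrow> real ^ 2"
  assumes BM: "standard_brownian_motion M W"
    and v: "\<And>N. N > 0 \<Longrightarrow> (\<Sum>i<n * N. (c (real i / real N))\<^sup>2) / real N \<le> v" "v > 0" and L: "L > 0"
  shows "emeasure M (persistent_excess M W n c L) \<le> ennreal (4 * exp (- (L\<^sup>2 / (8 * v))))"
  unfolding persistent_excess_def
proof (rule emeasure_eventually_le(2))
  have [measurable]: "(\<lambda>\<omega>. grid_sum (\<lambda>t. W t \<omega>) n (Suc N) c) \<in> borel_measurable M" for N
    by (rule grid_sum_measurable[OF BM]) simp
  show "{\<omega> \<in> space M. norm (grid_sum (\<lambda>t. W t \<omega>) n (Suc N) c) > L} \<in> sets M" for N by measurable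
qed (use grid_sum_tail[OF BM _ v L] in auto)

lemma persistent_excess_sets:
  fixes W :: "real \<Rightarrow> 'a \<Rightarrow> real ^ 2"
  assumes BM: "standard_brownian_motion M W"
  shows "persistent_excess M W n c L \<in> sets M"
  unfolding persistent_excess_def
proof (rule emeasure_eventually_le(1))
  have [measurable]: "(\<lambda>\<omega>. grid_sum (\<lambda>t. W t \<omega>) n (Suc N) c) \<in> borel_measurable M" for N
    by (rule grid_sum_measurable[OF BM]) simp
  show "{\<omega> \<in> space M. norm (grid_sum (\<lambda>t. W t \<omega>) n (Suc N) c) > L} \<in> sets M" for N by measurable
  show "emeasure M {\<omega> \<in> space M. norm (grid_sum (\<lambda>t. W t \<omega>) n (Suc N) c) > L} \<le> emeasure M (space M)" for N
    by (rule emeasure_mono) auto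
qed

lemma persistent_excessI:
  assumes "(\<lambda>N. grid_sum (\<lambda>t. W t \<omega>) n (Suc N) c) \<longlonglongrightarrow> D" "norm D > L" "\<omega> \<in> space M"
  shows "\<omega> \<in> persistent_excess M W n c L"
proof -
  have "eventually (\<lambda>N. norm (grid_sum (\<lambda>t. W t \<omega>) n (Suc N) c) > L) sequentially"
    by (rule order_tendstoD(1)[OF tendsto_norm[OF assms(1)] assms(2)])
  then show ?thesis using assms(3) by (auto simp: persistent_excess_def eventually_sequentially)
qed

text \<open>
  The discrete line equals its grid sum on every grid, so only the continuous line has to pass to the limit.
\<close>

lemma (in conga_rate) conga_error_grid_limits:
  fixes w :: "real \<Rightarrow> real ^ 2"
  assumes contw: "continuous_on {0..} w" and w0: "w 0 = 0" and k: "k > 0"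
  shows "(\<lambda>N. grid_sum w n (Suc N) (tail_error \<alpha> k)) \<longlonglongrightarrow> conga \<alpha> w (k + 1) n - cont_conga \<alpha> w (real k) (real n)"
    and "(\<lambda>N. grid_sum w n (Suc N) (mass_error \<alpha> k)) \<longlonglongrightarrow>
      (conga \<alpha> w (k + 2) n - conga \<alpha> w (k + 1) n) - cont_conga_dx \<alpha> w (real k) (real n)"
proof -
  have kpos: "0 < real k" using k by simp
  have X1: "conga \<alpha> w (k + 1) n = grid_sum w n (Suc N) (\<lambda>z. binomial_tail \<alpha> k (nat \<lfloor>z\<rfloor>))" for N
    using conga_eq_grid_sum[of w "Suc N" \<alpha> k n] w0 by simp
  have X2: "conga \<alpha> w (k + 2) n = grid_sum w n (Suc N) (\<lambda>z. binomial_tail \<alpha> (Suc k) (nat \<lfloor>z\<rfloor>))" for N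
    using conga_eq_grid_sum[of w "Suc N" \<alpha> "Suc k" n] w0 by simp
  have e1: "conga \<alpha> w (k + 1) n - grid_sum w n (Suc N) (gauss_tail \<alpha> (real k)) = grid_sum w n (Suc N) (tail_error \<alpha> k)" for N
    unfolding X1[of N] grid_sum_diff tail_error_def[abs_def] ..
  have e2: "conga \<alpha> w (k + 2) n - conga \<alpha> w (k + 1) n - grid_sum w n (Suc N) (\<lambda>z. - gauss_density \<alpha> (real k) z)
      = grid_sum w n (Suc N) (mass_error \<alpha> k)" for N
    unfolding X1[of N] X2[of N] grid_sum_diff
    by (rule arg_cong[where f="grid_sum w n (Suc N)"]) (auto simp: mass_error_def binomial_mass_def)
  show "(\<lambda>N. grid_sum w n (Suc N) (tail_error \<alpha> k)) \<longlonglongrightarrow> conga \<alpha> w (k + 1) n - cont_conga \<alpha> w (real k) (real n)"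
    unfolding e1[symmetric] by (intro tendsto_diff tendsto_const cont_conga_grid_limit contw w0 kpos)
  show "(\<lambda>N. grid_sum w n (Suc N) (mass_error \<alpha> k)) \<longlonglongrightarrow>
      (conga \<alpha> w (k + 2) n - conga \<alpha> w (k + 1) n) - cont_conga_dx \<alpha> w (real k) (real n)"
    unfolding e2[symmetric] by (intro tendsto_diff tendsto_const cont_conga_dx_grid_limit contw w0 kpos)
qed

theorem theorem1:
  fixes M :: "'a measure" and W :: "real \<Rightarrow> 'a \<Rightarrow> real ^ 2"
    and \<alpha> \<mu> \<epsilon> \<eta> :: real
  assumes "0 < \<alpha>" and "\<alpha> < 1"
    and "standard_brownian_motion M W"
    and "\<And>s \<omega>. s \<le> 0 \<Longrightarrow> \<omega> \<in> space M \<Longrightarrow> W s \<omega> = 0"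
    and "\<mu> > 0" and "\<epsilon> > 0" and "\<eta> > 0"
  shows "limsup (\<lambda>n. event_B M W \<alpha> \<mu> \<eta> \<epsilon> n) \<in> null_sets (completion M)"
proof -
  note BM = assms(3) and W0 = assms(4)
  interpret conga_rate \<alpha> "conga_sigma \<alpha>" by unfold_locales (use assms(1,2) in auto)
  interpret prob_space M using BM by (simp add: standard_brownian_motion_def)
  obtain C k0 where C: "C > 0" and var: "\<And>k n N. k0 \<le> k \<Longrightarrow> 0 < N \<Longrightarrow> real n \<le> real k powr (1 / \<epsilon>) \<Longrightarrow>
     (\<Sum>i<n * N. (tail_error \<alpha> k (real i / real N))\<^sup>2) / real N
       \<le> C * real k powr (- (1/2) + \<eta>) \<and>
     (\<Sum>i<n * N. (mass_error \<alpha> k (real i / real N))\<^sup>2) / real N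
       \<le> C * real k powr (- (3/2) + \<eta>)"
    using variance_bounds[OF assms(6,7)] by blast
  define c where "c = \<mu>\<^sup>2 / (8 * C)"
  have c: "c > 0" using assms(5) C by (simp add: c_def)
  define L1 where "L1 k = \<mu> * real k powr (- (1/4 - \<eta>))" for k
  define L2 where "L2 k = \<mu> * real k powr (- (3/4 - \<eta>))" for k
  define U where "U k n = persistent_excess M W n (tail_error \<alpha> k) (L1 k) \<union> persistent_excess M W n (mass_error \<alpha> k) (L2 k)" for k n
  have U_sets: "U k n \<in> sets M" for k n unfolding U_def using persistent_excess_sets[OF BM] by auto
  \<comment> \<open>Threshold squared over variance: the surplus \<open>2 * \<eta>\<close> in the threshold minus the loss \<open>\<eta>\<close> in the variance leaves \<open>x powr \<eta>\<close>. The cases are \<open>d = 1/2\<close> and \<open>d = 3/2\<close>.\<close>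
  have rate: "(\<mu> * x powr (- (d / 2 - \<eta>)))\<^sup>2 / (8 * (C * x powr (- d + \<eta>))) = c * x powr \<eta>" if "x > 0" for x d :: real
  proof -
    have "(x powr (- (d / 2 - \<eta>)))\<^sup>2 = x powr (- d + \<eta>) * x powr \<eta>"
      unfolding power2_eq_square powr_add[symmetric] by (simp add: algebra_simps)
    then show ?thesis using that C by (simp add: c_def power_mult_distrib)
  qed
  have U_bound: "emeasure M (U k n) \<le> ennreal (8 * exp (- (c * real k powr \<eta>)))"
    if k: "k0 \<le> k" "1 \<le> k" and n: "real n \<le> real k powr (1 / \<epsilon>)" for k n
  proof -
    have kpos: "real k > 0" using k by simp
    have 1: "emeasure M (persistent_excess M W n (tail_error \<alpha> k) (L1 k)) \<le> ennreal (4 * exp (- (c * real k powr \<eta>)))"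
      unfolding rate[OF kpos, of "1/2", symmetric] L1_def
      using persistent_excess_bound[OF BM, where n=n and c="tail_error \<alpha> k" and v="C * real k powr (- (1/2) + \<eta>)" and L="\<mu> * real k powr (- (1/4 - \<eta>))"]
        var[OF k(1) _ n] kpos C assms(5) by simp
    have 2: "emeasure M (persistent_excess M W n (mass_error \<alpha> k) (L2 k)) \<le> ennreal (4 * exp (- (c * real k powr \<eta>)))"
      unfolding rate[OF kpos, of "3/2", symmetric] L2_def
      using persistent_excess_bound[OF BM, where n=n and c="mass_error \<alpha> k" and v="C * real k powr (- (3/2) + \<eta>)" and L="\<mu> * real k powr (- (3/4 - \<eta>))"]
        var[OF k(1) _ n] kpos C assms(5) by simp
    have "emeasure M (U k n) \<le> emeasure M (persistent_excess M W n (tail_error \<alpha> k) (L1 k)) + emeasure M (persistent_excess M W n (mass_error \<alpha> k) (L2 k))"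
      unfolding U_def by (rule emeasure_subadditive) (rule persistent_excess_sets[OF BM])+
    also have "\<dots> \<le> ennreal (4 * exp (- (c * real k powr \<eta>))) + ennreal (4 * exp (- (c * real k powr \<eta>)))"
      by (rule add_mono[OF 1 2])
    also have "\<dots> = ennreal (8 * exp (- (c * real k powr \<eta>)))"
      by (simp add: ennreal_plus[symmetric] del: ennreal_plus)
    finally show ?thesis .
  qed
  define K where "K n = {k. real n powr \<epsilon> \<le> real k \<and> k \<le> n}" for n
  have K_fin: "finite (K n)" "card (K n) \<le> n + 1" for n
  proof -
    have sub: "K n \<subseteq> {..n}" by (auto simp: K_def)
    then show "finite (K n)" by (rule finite_subset) simp
    show "card (K n) \<le> n + 1" using card_mono[OF _ sub] by simp
  qed
  have "eventually (\<lambda>x::real. real k0 \<le> x powr \<epsilon>) at_top" using assms(6) by real_asymp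
  then have "eventually (\<lambda>n. real k0 \<le> real n powr \<epsilon>) sequentially"
    by (rule eventually_compose_filterlim[OF _ filterlim_real_sequentially])
  then obtain n0 where n0: "\<And>n. n \<ge> n0 \<Longrightarrow> real k0 \<le> real n powr \<epsilon>"
    unfolding eventually_sequentially by blast
  \<comment> \<open>For small \<open>n\<close> the estimate of the variance may fail; these finitely many indices have no influence on the limes superior.\<close>
  define S where "S n = (if n0 \<le> n \<and> 1 \<le> n then \<Union>k\<in>K n. U k n else {})" for n
  have S_sets: "S n \<in> sets M" for n
    unfolding S_def using K_fin U_sets by auto
  have S_bound: "measure M (S n) \<le> (real n + 1) * (8 * exp (- (c * real n powr (\<epsilon> * \<eta>))))" for n
  proof (cases "n0 \<le> n \<and> 1 \<le> n")
    case True
    have pt: "measure M (U k n) \<le> 8 * exp (- (c * real n powr (\<epsilon> * \<eta>)))" if k: "k \<in> K n" for k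
    proof -
      have nk: "real n powr \<epsilon> \<le> real k" using k by (simp add: K_def)
      then have "k0 \<le> k" using n0[of n] True by simp
      moreover have "1 \<le> real n powr \<epsilon>" using True assms(6) by (simp add: ge_one_powr_ge_zero)
      then have "1 \<le> k" using nk by linarith
      moreover have "real n \<le> real k powr (1 / \<epsilon>)"
      proof -
        have "real n = (real n powr \<epsilon>) powr (1 / \<epsilon>)" using True assms(6) by (simp add: powr_powr)
        also have "\<dots> \<le> real k powr (1 / \<epsilon>)" using nk assms(6) by (intro powr_mono2) auto
        finally show ?thesis .
      qed
      ultimately have "emeasure M (U k n) \<le> ennreal (8 * exp (- (c * real k powr \<eta>)))" by (rule U_bound)
      then have "measure M (U k n) \<le> 8 * exp (- (c * real k powr \<eta>))"
        by (simp add: emeasure_eq_measure)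
      also have "\<dots> \<le> 8 * exp (- (c * real n powr (\<epsilon> * \<eta>)))"
      proof -
        have "real n powr (\<epsilon> * \<eta>) = (real n powr \<epsilon>) powr \<eta>" by (simp add: powr_powr)
        also have "\<dots> \<le> real k powr \<eta>" using nk assms(7) by (intro powr_mono2) auto
        finally show ?thesis using c by simp
      qed
      finally show ?thesis .
    qed
    have "measure M (S n) \<le> (\<Sum>k\<in>K n. measure M (U k n))"
      using True U_sets K_fin(1) by (simp add: S_def) (rule finite_measure_subadditive_finite, auto)
    also have "\<dots> \<le> real (card (K n)) * (8 * exp (- (c * real n powr (\<epsilon> * \<eta>))))"
      using sum_bounded_above[of "K n" "\<lambda>k. measure M (U k n)"] pt by simp
    also have "\<dots> \<le> (real n + 1) * (8 * exp (- (c * real n powr (\<epsilon> * \<eta>))))"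
      using K_fin(2)[of n] by (intro mult_right_mono) auto
    finally show ?thesis .
  next
    case False
    then have "S n = {}" by (auto simp: S_def)
    then show ?thesis by simp
  qed
  have "eventually (\<lambda>x::real. (x + 1) * (8 * exp (- (c * x powr (\<epsilon> * \<eta>)))) \<le> x powr (-2)) at_top"
    using c mult_pos_pos[OF assms(6,7)] by real_asymp
  then have "eventually (\<lambda>n. (real n + 1) * (8 * exp (- (c * real n powr (\<epsilon> * \<eta>)))) \<le> real n powr (-2)) sequentially"
    by (rule eventually_compose_filterlim[OF _ filterlim_real_sequentially])
  then have "eventually (\<lambda>n. norm (measure M (S n)) \<le> real n powr (-2)) sequentially"
    by eventually_elim (use S_bound order.trans in auto)
  moreover have "summable (\<lambda>n. real n powr (-2))" by (simp add: summable_real_powr_iff)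
  ultimately have "summable (\<lambda>n. measure M (S n))" by (rule summable_comparison_test_ev)
  then have S_null: "limsup S \<in> null_sets M"
    by (intro borel_cantelli_limsup1 S_sets) (simp_all add: emeasure_eq_measure)
  have "AE \<omega> in M. continuous_on {0..} (\<lambda>t. W t \<omega>)"
    using BM by (simp add: standard_brownian_motion_def)
  then obtain Z where Z: "Z \<in> null_sets M" "{\<omega> \<in> space M. \<not> continuous_on {0..} (\<lambda>t. W t \<omega>)} \<subseteq> Z"
    by (auto elim!: AE_E)
  \<comment> \<open>Off the exceptional set \<open>Z\<close> of discontinuous paths the error is the limit of its grid sums.\<close>
  have A_sub: "event_A M W \<alpha> \<mu> \<eta> k n \<subseteq> Z \<union> U k n" if k: "k > 0" for k n
  proof
    fix \<omega> assume \<omega>: "\<omega> \<in> event_A M W \<alpha> \<mu> \<eta> k n"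
    then have sp: "\<omega> \<in> space M" by (simp add: event_A_def)
    show "\<omega> \<in> Z \<union> U k n"
    proof (cases "\<omega> \<in> Z")
      case False
      then have cont: "continuous_on {0..} (\<lambda>t. W t \<omega>)" using Z(2) sp by blast
      note lim = conga_error_grid_limits[OF cont W0[OF order_refl sp] k, of n]
      from \<omega> show ?thesis
        using persistent_excessI[where W=W and \<omega>=\<omega>, OF lim(1) _ sp, of "L1 k"] persistent_excessI[where W=W and \<omega>=\<omega>, OF lim(2) _ sp, of "L2 k"]
        by (auto simp: event_A_def U_def L1_def L2_def)
    qed simp
  qed
  have "limsup (\<lambda>n. event_B M W \<alpha> \<mu> \<eta> \<epsilon> n) \<subseteq> Z \<union> limsup S"
  proof
    fix \<omega> assume "\<omega> \<in> limsup (\<lambda>n. event_B M W \<alpha> \<mu> \<eta> \<epsilon> n)"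
    then have freq: "\<exists>\<^sub>F n in sequentially. \<omega> \<in> event_B M W \<alpha> \<mu> \<eta> \<epsilon> n" by (simp add: mem_limsup_iff)
    show "\<omega> \<in> Z \<union> limsup S"
    proof (cases "\<omega> \<in> Z")
      case False
      have "eventually (\<lambda>n. \<omega> \<in> event_B M W \<alpha> \<mu> \<eta> \<epsilon> n \<longrightarrow> \<omega> \<in> S n) sequentially"
        using eventually_ge_at_top[of "max n0 1"]
      proof eventually_elim
        case (elim n)
        show ?case
        proof
          assume "\<omega> \<in> event_B M W \<alpha> \<mu> \<eta> \<epsilon> n"
          then obtain k where k: "k \<in> K n" "\<omega> \<in> event_A M W \<alpha> \<mu> \<eta> k n" by (auto simp: event_B_def K_def)
          have "0 < real n powr \<epsilon>" using elim by simp
          moreover have "real n powr \<epsilon> \<le> real k" using k(1) by (simp add: K_def)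
          ultimately have "0 < real k" by (rule less_le_trans)
          then have "k > 0" by simp
          then have "\<omega> \<in> U k n" using A_sub[of k n] k(2) False by blast
          then show "\<omega> \<in> S n" using elim k(1) by (auto simp: S_def)
        qed
      qed
      with freq have "\<exists>\<^sub>F n in sequentially. \<omega> \<in> S n" by (rule frequently_rev_mp)
      then show ?thesis by (simp add: mem_limsup_iff)
    qed simp
  qed
  moreover have "Z \<union> limsup S \<in> null_sets M" using Z(1) S_null by (rule null_sets.Un)
  ultimately show ?thesis
    by (metis null_sets_completion_subset null_sets_completionI)
qed

end
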